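(* Let $X, d$ be an algebraic Yoneda-complete quasi-metric space, with a strong basis $\mathcal B$. The space $\mathbf V_1 X, d_{\mathrm{KR}}^a$ is algebraic Yoneda-complete, for every $a \in \mathbb{R}_+$, $a > 0$. All the simple normalized valuations $\sum_{i=1}^n a_i \delta_{x_i}$ with $x_i$ center points in $X, d$, $\sum_{i=1}^n a_i = 1$, are center points, and form a strong basis, even when each $x_i$ is taken from $\mathcal B$.
   Context: $\mathbb{R}_+=[0,+\infty)$. A quasi-metric on $X$ is a map $d \colon X \times X \to [0,+\infty]$ with $d(x,x)=0$, the triangle inequality, and $d(x,y)=d(y,x)=0 \Rightarrow x=y$. Formal balls are pairs $(x,r)$, $x\in X$, $r\in \mathbb{R}_+$, ordered by $(x,r) \leq^{d^+} (y,s)$ iff $d(x,y) \leq r-s$; they form the poset $\mathbf{B}(X,d)$, with its Scott topology. $X$ is given the $d$-Scott topology, the coarsest one making $x \mapsto (x,0) \in \mathbf{B}(X,d)$ continuous. $X,d$ is Yoneda-complete iff $\mathbf{B}(X,d)$ is a dcpo. A point $x$ is a center point iff for every $\epsilon>0$, $\{(y,s) \in \mathbf{B}(X,d) \mid d(x,y) < \epsilon - s\}$ is Scott-open. A strong basis is a set $\mathcal{B}$ of center points such that for every $x \in X$, $(x,0)$ is the supremum in $\mathbf{B}(X,d)$ of a directed family of formal balls with centers in $\mathcal{B}$. $X,d$ is algebraic iff it has a strong basis. $[0,+\infty]$ carries the quasi-metric $\mathsf{d}_{\mathbb R}$ with $\mathsf{d}_{\mathbb R}(x,y)=0$ if $x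 \leq y$, $\mathsf{d}_{\mathbb R}(+\infty,y)=+\infty$ if $y\neq+\infty$, and $\mathsf{d}_{\mathbb R}(x,y)=x-y$ if $+\infty > x>y$. A map $h \colon X,d \to Y,\partial$ is $1$-Lipschitz continuous iff $(x,r) \mapsto (h(x), r)$ is Scott-continuous from $\mathbf{B}(X,d)$ to $\mathbf{B}(Y,\partial)$. $\mathcal{L}_1^a(X,d)$ is the set of $1$-Lipschitz continuous maps from $X,d$ to $[0,+\infty],\mathsf{d}_{\mathbb R}$ that are bounded above by $a$ (they are lower semicontinuous). A continuous valuation on $X$ is a map $\nu$ from the lattice of open subsets of $X$ to $[0,+\infty]$ that is strict ($\nu(\emptyset)=0$), modular ($\nu(U\cup V)+\nu(U\cap V)=\nu(U)+\nu(V)$) and Scott-continuous (monotonic, preserving directed unions). $\mathbf{V}_1 X$ is the set of those with $\nu(X)=1$ (normalized). $\delta_x(U)=1$ if $x\in U$, $0$ otherwise; a simple valuation is a finite linear combination $\sum_{i=1}^n a_i\delta_{x_i}$ with $a_i \in \mathbb{R}_+$. For $h$ lower semicontinuous, $\int_{x\in X} h(x)\,d\nu = \int_0^{+\infty} \nu(h^{-1}(]t,+\infty]))\,dt$. Finally $d_{\mathrm{KR}}^a(\nu,\nu') = \sup_{h \in \mathcal{L}_1^a(X,d)} \mathsf{d}_{\mathbb R}(\int h\,d\nu, \int h\,d\nu')$. *)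

theory Defs
  imports "HOL-Analysis.Analysis"
begin

section \<open>Posets on a carrier set and their Scott topology\<close>

definition directed_in :: "'b set \<Rightarrow> ('b \<Rightarrow> 'b \<Rightarrow> bool) \<Rightarrow> 'b set \<Rightarrow> bool" where
  "directed_in P le D \<longleftrightarrow>
     D \<subseteq> P \<and> D \<noteq> {} \<and> (\<forall>x\<in>D. \<forall>y\<in>D. \<exists>z\<in>D. le x z \<and> le y z)"

definition supremum_in :: "'b set \<Rightarrow> ('b \<Rightarrow> 'b \<Rightarrow> bool) \<Rightarrow> 'b set \<Rightarrow> 'b \<Rightarrow> bool" where
  "supremum_in P le D s \<longleftrightarrow>
     s \<in> P \<and> (\<forall>x\<in>D. le x s) \<and> (\<forall>u\<in>P. (\<forall>x\<in>D. le x u) \<longrightarrow> le s u)"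

definition dcpo_on :: "'b set \<Rightarrow> ('b \<Rightarrow> 'b \<Rightarrow> bool) \<Rightarrow> bool" where
  "dcpo_on P le \<longleftrightarrow> (\<forall>D. directed_in P le D \<longrightarrow> (\<exists>s. supremum_in P le D s))"

definition scott_open :: "'b set \<Rightarrow> ('b \<Rightarrow> 'b \<Rightarrow> bool) \<Rightarrow> 'b set \<Rightarrow> bool" where
  "scott_open P le U \<longleftrightarrow>
     U \<subseteq> P \<and> (\<forall>x\<in>U. \<forall>y\<in>P. le x y \<longrightarrow> y \<in> U) \<and>
     (\<forall>D s. directed_in P le D \<and> supremum_in P le D s \<and> s \<in> U \<longrightarrow> D \<inter> U \<noteq> {})"

definition scott_topology :: "'b set \<Rightarrow> ('b \<Rightarrow> 'b \<Rightarrow> bool) \<Rightarrow> 'b topology" where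
  "scott_topology P le = topology (scott_open P le)"

lemma scott_openI:
  assumes "U \<subseteq> P"
    and "\<And>x y. x \<in> U \<Longrightarrow> y \<in> P \<Longrightarrow> le x y \<Longrightarrow> y \<in> U"
    and "\<And>D s. directed_in P le D \<Longrightarrow> supremum_in P le D s \<Longrightarrow> s \<in> U \<Longrightarrow> \<exists>x\<in>D. x \<in> U"
  shows "scott_open P le U"
  unfolding scott_open_def
proof (intro conjI ballI allI impI)
  fix D s assume "directed_in P le D \<and> supremum_in P le D s \<and> s \<in> U"
  then show "D \<inter> U \<noteq> {}" using assms(3)[of D s] by blast
qed (use assms(1,2) in blast)+

lemma scott_openD:
  assumes "scott_open P le U"
  shows "x \<in> U \<Longrightarrow> x \<in> P"
    and "x \<in> U \<Longrightarrow> y \<in> P \<Longrightarrow> le x y \<Longrightarrow> y \<in> U"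
    and "directed_in P le D \<Longrightarrow> supremum_in P le D s \<Longrightarrow> s \<in> U \<Longrightarrow> \<exists>x\<in>D. x \<in> U"
proof -
  show "x \<in> U \<Longrightarrow> x \<in> P" using assms by (auto simp only: scott_open_def)
  show "x \<in> U \<Longrightarrow> y \<in> P \<Longrightarrow> le x y \<Longrightarrow> y \<in> U"
    using assms by (simp only: scott_open_def)
  assume "directed_in P le D" "supremum_in P le D s" "s \<in> U"
  then have "D \<inter> U \<noteq> {}" using assms unfolding scott_open_def by metis
  then show "\<exists>x\<in>D. x \<in> U" by blast
qed

lemma istopology_scott_open: "istopology (scott_open P le)"
  unfolding istopology_def
proof (intro conjI allI impI)
  fix S T assume S: "scott_open P le S" and T: "scott_open P le T"
  show "scott_open P le (S \<inter> T)"
  proof (rule scott_openI)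
    show "S \<inter> T \<subseteq> P" using scott_openD(1)[OF S] by blast
  next
    fix x y assume "x \<in> S \<inter> T" "y \<in> P" "le x y"
    then show "y \<in> S \<inter> T"
      using scott_openD(2)[OF S, of x y] scott_openD(2)[OF T, of x y] by simp
  next
    fix D s assume D: "directed_in P le D" and s: "supremum_in P le D s" "s \<in> S \<inter> T"
    obtain u v where u: "u \<in> D" "u \<in> S" and v: "v \<in> D" "v \<in> T"
      using scott_openD(3)[OF S D s(1)] scott_openD(3)[OF T D s(1)] s(2) by auto
    then obtain w where w: "w \<in> D" "le u w" "le v w" "w \<in> P"
      using D unfolding directed_in_def by (meson subsetD)
    then have "w \<in> S \<inter> T"
      using scott_openD(2)[OF S u(2), of w] scott_openD(2)[OF T v(2), of w] by simp
    with w(1) show "\<exists>x\<in>D. x \<in> S \<inter> T" ..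
  qed
next
  fix K assume K: "\<forall>S\<in>K. scott_open P le S"
  show "scott_open P le (\<Union>K)"
  proof (rule scott_openI)
    have "S \<subseteq> P" if "S \<in> K" for S
      using K that by (simp add: scott_open_def)
    then show "\<Union>K \<subseteq> P" by (rule Union_least)
  next
    fix x y assume "x \<in> \<Union>K" "y \<in> P" "le x y"
    then obtain S where S: "S \<in> K" "x \<in> S" by blast
    then have "y \<in> S" using K scott_openD(2)[of P le S x y] \<open>y \<in> P\<close> \<open>le x y\<close> by simp
    with S(1) show "y \<in> \<Union>K" by blast
  next
    fix D s assume D: "directed_in P le D" "supremum_in P le D s" and "s \<in> \<Union>K"
    then obtain S where S: "S \<in> K" "s \<in> S" by blast
    then have "\<exists>x\<in>D. x \<in> S" using scott_openD(3)[OF _ D, of S] K by simp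
    with S(1) show "\<exists>x\<in>D. x \<in> \<Union>K" by blast
  qed
qed

lemma openin_scott_topology [simp]: "openin (scott_topology P le) U \<longleftrightarrow> scott_open P le U"
  by (simp add: scott_topology_def topology_inverse' istopology_scott_open)

lemma topspace_scott_topology [simp]: "topspace (scott_topology P le) = P"
proof (rule antisym)
  show "topspace (scott_topology P le) \<subseteq> P"
    using openin_topspace[of "scott_topology P le"] by (simp only: openin_scott_topology scott_open_def)
  have "scott_open P le P"
    by (rule scott_openI) (auto simp: directed_in_def)
  then show "P \<subseteq> topspace (scott_topology P le)"
    by (intro openin_subset) simp
qed

section \<open>Quasi-metric spaces and formal balls\<close>

definition quasi_metric_on :: "'a set \<Rightarrow> ('a \<Rightarrow> 'a \<Rightarrow> ennreal) \<Rightarrow> bool" where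
  "quasi_metric_on X d \<longleftrightarrow>
     (\<forall>x\<in>X. d x x = 0) \<and>
     (\<forall>x\<in>X. \<forall>y\<in>X. \<forall>z\<in>X. d x z \<le> d x y + d y z) \<and>
     (\<forall>x\<in>X. \<forall>y\<in>X. d x y = 0 \<and> d y x = 0 \<longrightarrow> x = y)"

definition formal_balls :: "'a set \<Rightarrow> ('a \<times> real) set" where
  "formal_balls X = X \<times> {0..}"

text \<open>Comparisons with differences of radii are made in the extended reals, since
  those differences may be negative.\<close>

definition ball_le :: "('a \<Rightarrow> 'a \<Rightarrow> ennreal) \<Rightarrow> 'a \<times> real \<Rightarrow> 'a \<times> real \<Rightarrow> bool" where
  "ball_le d = (\<lambda>(x, r) (y, s). enn2ereal (d x y) \<le> ereal (r - s))"

definition ball_topology :: "'a set \<Rightarrow> ('a \<Rightarrow> 'a \<Rightarrow> ennreal) \<Rightarrow> ('a \<times> real) topology" where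
  "ball_topology X d = scott_topology (formal_balls X) (ball_le d)"

text \<open>The coarsest topology on \<open>X\<close> making \<open>x \<mapsto> (x, 0)\<close> continuous consists of the
  preimages of the Scott-open sets of formal balls.\<close>

definition d_scott_topology :: "'a set \<Rightarrow> ('a \<Rightarrow> 'a \<Rightarrow> ennreal) \<Rightarrow> 'a topology" where
  "d_scott_topology X d = pullback_topology X (\<lambda>x. (x, 0)) (ball_topology X d)"

lemma topspace_d_scott_topology [simp]: "topspace (d_scott_topology X d) = X"
  by (auto simp: d_scott_topology_def topspace_pullback_topology ball_topology_def formal_balls_def)

definition yoneda_complete :: "'a set \<Rightarrow> ('a \<Rightarrow> 'a \<Rightarrow> ennreal) \<Rightarrow> bool" where
  "yoneda_complete X d \<longleftrightarrow> dcpo_on (formal_balls X) (ball_le d)"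

definition center_points :: "'a set \<Rightarrow> ('a \<Rightarrow> 'a \<Rightarrow> ennreal) \<Rightarrow> 'a set" where
  "center_points X d =
     {x \<in> X. \<forall>\<epsilon>::real. \<epsilon> > 0 \<longrightarrow>
        openin (ball_topology X d)
          {(y, s). (y, s) \<in> formal_balls X \<and> enn2ereal (d x y) < ereal (\<epsilon> - s)}}"

definition strong_basis :: "'a set \<Rightarrow> ('a \<Rightarrow> 'a \<Rightarrow> ennreal) \<Rightarrow> 'a set \<Rightarrow> bool" where
  "strong_basis X d B \<longleftrightarrow>
     B \<subseteq> center_points X d \<and>
     (\<forall>x\<in>X. \<exists>D. D \<subseteq> formal_balls B \<and> directed_in (formal_balls X) (ball_le d) D \<and>
        supremum_in (formal_balls X) (ball_le d) D (x, 0))"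

definition algebraic_qms :: "'a set \<Rightarrow> ('a \<Rightarrow> 'a \<Rightarrow> ennreal) \<Rightarrow> bool" where
  "algebraic_qms X d \<longleftrightarrow> (\<exists>B. strong_basis X d B)"

section \<open>Lipschitz continuous maps\<close>

definition dR :: "ennreal \<Rightarrow> ennreal \<Rightarrow> ennreal" where
  "dR x y = (if x \<le> y then 0 else if x = \<infinity> then \<infinity> else x - y)"

definition lipschitz1_continuous ::
  "'a set \<Rightarrow> ('a \<Rightarrow> 'a \<Rightarrow> ennreal) \<Rightarrow> 'b set \<Rightarrow> ('b \<Rightarrow> 'b \<Rightarrow> ennreal) \<Rightarrow> ('a \<Rightarrow> 'b) \<Rightarrow> bool" where
  "lipschitz1_continuous X d Y e h \<longleftrightarrow>
     h \<in> X \<rightarrow> Y \<and>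
     continuous_map (ball_topology X d) (ball_topology Y e) (\<lambda>(x, r). (h x, r))"

text \<open>Values of \<open>h\<close> outside \<open>X\<close> are unconstrained; nothing below depends on them.\<close>

definition L1 :: "real \<Rightarrow> 'a set \<Rightarrow> ('a \<Rightarrow> 'a \<Rightarrow> ennreal) \<Rightarrow> ('a \<Rightarrow> ennreal) set" where
  "L1 a X d = {h. lipschitz1_continuous X d UNIV dR h \<and> (\<forall>x\<in>X. h x \<le> ennreal a)}"

section \<open>Continuous valuations\<close>

text \<open>A valuation is a function on the open sets only: membership in \<open>extensional\<close> pins
  its values elsewhere, so that valuations agreeing on all open sets are equal.\<close>

definition continuous_valuation :: "'a topology \<Rightarrow> ('a set \<Rightarrow> ennreal) \<Rightarrow> bool" where
  "continuous_valuation T \<nu> \<longleftrightarrow>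
     \<nu> \<in> extensional {U. openin T U} \<and>
     \<nu> {} = 0 \<and>
     (\<forall>U V. openin T U \<and> openin T V \<longrightarrow> \<nu> (U \<union> V) + \<nu> (U \<inter> V) = \<nu> U + \<nu> V) \<and>
     (\<forall>U V. openin T U \<and> openin T V \<and> U \<subseteq> V \<longrightarrow> \<nu> U \<le> \<nu> V) \<and>
     (\<forall>\<U>. directed_in {U. openin T U} (\<subseteq>) \<U> \<longrightarrow> \<nu> (\<Union>\<U>) = (SUP U\<in>\<U>. \<nu> U))"

definition V1 :: "'a topology \<Rightarrow> ('a set \<Rightarrow> ennreal) set" where
  "V1 T = {\<nu>. continuous_valuation T \<nu> \<and> \<nu> (topspace T) = 1}"

definition dirac :: "'a \<Rightarrow> 'a set \<Rightarrow> ennreal" where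
  "dirac x U = (if x \<in> U then 1 else 0)"

definition simple_normalized_valuations :: "'a topology \<Rightarrow> 'a set \<Rightarrow> ('a set \<Rightarrow> ennreal) set" where
  "simple_normalized_valuations T C =
     {restrict (\<lambda>U. \<Sum>i=1..n. ennreal (\<alpha> i) * dirac (x i) U) {U. openin T U} |
        (n::nat) (\<alpha>::nat \<Rightarrow> real) x.
        (\<forall>i\<in>{1..n}. 0 \<le> \<alpha> i \<and> x i \<in> C) \<and> (\<Sum>i=1..n. \<alpha> i) = 1}"

definition val_integral :: "'a topology \<Rightarrow> ('a \<Rightarrow> ennreal) \<Rightarrow> ('a set \<Rightarrow> ennreal) \<Rightarrow> ennreal" where
  "val_integral T h \<nu> = (\<integral>\<^sup>+t\<in>{0..}. \<nu> {x \<in> topspace T. ennreal t < h x} \<partial>lborel)"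

definition dKR ::
  "real \<Rightarrow> 'a set \<Rightarrow> ('a \<Rightarrow> 'a \<Rightarrow> ennreal) \<Rightarrow> ('a set \<Rightarrow> ennreal) \<Rightarrow> ('a set \<Rightarrow> ennreal) \<Rightarrow> ennreal" where
  "dKR a X d \<nu> \<nu>' =
     (SUP h\<in>L1 a X d. dR (val_integral (d_scott_topology X d) h \<nu>)
                         (val_integral (d_scott_topology X d) h \<nu>'))"

end

theory Submission
  imports Defs
begin

text \<open>
  A valuation is controlled by its integrals on the bounded Lipschitz continuous functions, and these
  are determined by cones \<open>c - d(b, x)\<close> with centers \<open>b\<close> in the strong basis. Along a directed family of
  formal balls over \<open>V\<^sub>1 X\<close> the integrals converge to a functional \<open>J\<close> that is Scott-continuous on
  each set of functions with a fixed Lipschitz constant, since there it is a supremum of Scott-continuous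
  functionals. Let \<open>\<nu>(U)\<close> be the supremum of \<open>J h\<close> over Lipschitz \<open>h \<le> \<chi>\<^sub>U\<close>. Scott-continuity of
  \<open>\<nu>\<close> is a tightness argument: if no member of a directed cover carried enough mass, then repeatedly
  replacing \<open>h\<close> by a finite maximum of steeper cones would give a finitely branching tree of shrinking
  balls, and an infinite branch (Koenig) would converge, by Yoneda-completeness, to an uncovered point.

  The distance from a simple valuation to another one involves only finitely many test functions up
  to \<open>\<epsilon>\<close>, because only the values at the atoms matter; hence simple valuations on center points are
  center points. Density of the simple valuations follows by matching \<open>\<nu>\<close> with a finite measure on the
  level sets of finitely many functions and moving its atoms to centers.
\<close>

section \<open>Lipschitz continuous functions and integrals\<close>

text \<open>The obstacle is that \<open>\<nu>(U)\<close> is a supremum over tests of all Lipschitz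
  constants, while along a directed family of formal balls only integral minus radius increases. For
  1-Lipschitz \<open>h\<close> the value \<open>J h - R\<close>, with \<open>R\<close> the infimum
  of the radii, is therefore a supremum, but a \<open>\<gamma>\<close>-Lipschitz function must first
  be divided by \<open>\<gamma> + 1\<close>. The continuity of \<open>J\<close> obtained in this way
  is not uniform in the constant, and the tests for an open set become arbitrarily steep: tightness
  has to bridge this gap.

  Continuity of \<open>dt c\<close> along the filters is guaranteed for center points
  \<open>c\<close>, so cones at centers are the Lipschitz functions that can be built by hand; all
  others are approximated from below by finite maxima of them.

  Normalization keeps the development real-valued: integrals of bounded functions are finite, and
  since the constant 1 is Lipschitz with constant \<open>1 / a\<close>, the mass 1 survives passing
  to the limit. The assumption \<open>ball_chain_limit\<close> is the sequential part of
  Yoneda-completeness that closes the tightness argument.\<close>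

text \<open>
  \<open>dt\<close> stands for the distance truncated at \<open>a\<close>, which suffices for test functions bounded by \<open>a\<close>, and
  \<open>Fl x\<close> for the filter generated by the centers of a directed family of formal balls with supremum
  \<open>(x, 0)\<close>, so that continuity along the family becomes convergence along \<open>Fl x\<close>.
\<close>

locale kr_space =
  fixes X B C :: "'a set" and dt :: "'a \<Rightarrow> 'a \<Rightarrow> real" and a :: real
    and Fl :: "'a \<Rightarrow> 'a filter" and T :: "'a topology"
  assumes a_pos: "a > 0" and B_sub: "B \<subseteq> C" and C_sub: "C \<subseteq> X" and topspace_T: "topspace T = X"
    and dt_nonneg: "0 \<le> dt x y" and dt_le: "dt x y \<le> a"
    and dt_refl: "x \<in> X \<Longrightarrow> dt x x = 0"
    and dt_triangle: "x \<in> X \<Longrightarrow> y \<in> X \<Longrightarrow> z \<in> X \<Longrightarrow> dt x z \<le> dt x y + dt y z"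
    and Fl_nontriv: "x \<in> X \<Longrightarrow> Fl x \<noteq> bot"
    and Fl_B: "x \<in> X \<Longrightarrow> eventually (\<lambda>b. b \<in> B) (Fl x)"
    and Fl_dt: "x \<in> X \<Longrightarrow> ((\<lambda>b. dt b x) \<longlongrightarrow> 0) (Fl x)"
    and Fl_center: "c \<in> C \<Longrightarrow> x \<in> X \<Longrightarrow> ((\<lambda>y. dt c y) \<longlongrightarrow> dt c x) (Fl x)"
    and open_iff: "openin T U \<longleftrightarrow> U \<subseteq> X \<and>
      (\<forall>x\<in>U. \<exists>b\<in>B. \<exists>\<rho>>0. \<rho> \<le> a \<and> dt b x < \<rho> \<and> {y \<in> X. dt b y < \<rho>} \<subseteq> U)"
    and ball_chain_limit: "(\<And>m. b m \<in> B) \<Longrightarrow> (\<And>m. dt (b m) (b (Suc m)) < s m - s (Suc m)) \<Longrightarrow>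
      s \<longlonglongrightarrow> 0 \<Longrightarrow> s 0 \<le> a \<Longrightarrow>
      \<exists>x\<in>X. (\<forall>m. dt (b m) x \<le> s m) \<and>
        (\<forall>U. openin T U \<and> x \<in> U \<longrightarrow> (\<exists>m. {y \<in> X. dt (b m) y < s m} \<subseteq> U))"
begin

lemma B_X: "b \<in> B \<Longrightarrow> b \<in> X" using B_sub C_sub by blast

lemma Fl_X: "x \<in> X \<Longrightarrow> eventually (\<lambda>b. b \<in> X) (Fl x)"
  using Fl_B[of x] by (rule eventually_mono) (auto simp: B_X)

text \<open>The bound \<open>\<gamma> * a\<close> grows with the Lipschitz constant, so that scaling
  by \<open>c\<close> turns \<open>lip \<gamma>\<close> into \<open>lip (c * \<gamma>)\<close>. For
  \<open>\<gamma> = 1\<close> these are the real-valued forms of the members of \<open>L1\<close>;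
  Scott-continuity survives as convergence along every \<open>Fl x\<close>.\<close>

definition lip :: "real \<Rightarrow> ('a \<Rightarrow> real) \<Rightarrow> bool" where
  "lip \<gamma> f \<longleftrightarrow> 0 \<le> \<gamma> \<and> (\<forall>x\<in>X. 0 \<le> f x \<and> f x \<le> \<gamma> * a) \<and>
     (\<forall>x\<in>X. \<forall>y\<in>X. f x \<le> f y + \<gamma> * dt x y) \<and> (\<forall>x\<in>X. (f \<longlongrightarrow> f x) (Fl x))"

lemma lipD:
  assumes "lip \<gamma> f"
  shows "0 \<le> \<gamma>" "x \<in> X \<Longrightarrow> 0 \<le> f x" "x \<in> X \<Longrightarrow> f x \<le> \<gamma> * a"
    "x \<in> X \<Longrightarrow> y \<in> X \<Longrightarrow> f x \<le> f y + \<gamma> * dt x y" "x \<in> X \<Longrightarrow> (f \<longlongrightarrow> f x) (Fl x)"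
  using assms by (auto simp: lip_def)

section \<open>Closure of the Lipschitz classes under lattice operations, scaling, sums and
  truncation\<close>

lemma lip_mono:
  assumes f: "lip \<gamma> f" and le: "\<gamma> \<le> \<gamma>'"
  shows "lip \<gamma>' f"
  unfolding lip_def
proof (intro conjI ballI)
  have m: "\<gamma> * t \<le> \<gamma>' * t" if "0 \<le> t" for t using le that by (rule mult_right_mono)
  show "0 \<le> \<gamma>'" using lipD(1)[OF f] le by simp
  fix x assume x: "x \<in> X"
  show "0 \<le> f x" "(f \<longlongrightarrow> f x) (Fl x)" using lipD[OF f] x by auto
  show "f x \<le> \<gamma>' * a" using lipD(3)[OF f x] m[of a] a_pos by linarith
  fix y assume y: "y \<in> X"
  show "f x \<le> f y + \<gamma>' * dt x y" using lipD(4)[OF f x y] m[OF dt_nonneg[of x y]] by linarith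
qed

lemma lip_max:
  assumes f: "lip \<gamma> f" and g: "lip \<gamma> g" shows "lip \<gamma> (\<lambda>x. max (f x) (g x))"
  unfolding lip_def
proof (intro conjI ballI)
  fix x assume x: "x \<in> X"
  show "0 \<le> max (f x) (g x)" "max (f x) (g x) \<le> \<gamma> * a"
    using lipD(2,3)[OF f x] lipD(2,3)[OF g x] by auto
  show "((\<lambda>x. max (f x) (g x)) \<longlongrightarrow> max (f x) (g x)) (Fl x)"
    using lipD(5)[OF f x] lipD(5)[OF g x] by (rule tendsto_max)
  fix y assume y: "y \<in> X"
  show "max (f x) (g x) \<le> max (f y) (g y) + \<gamma> * dt x y"
    using lipD(4)[OF f x y] lipD(4)[OF g x y] by linarith
qed (rule lipD(1)[OF f])

lemma lip_min:
  assumes f: "lip \<gamma> f" and g: "lip \<gamma> g" shows "lip \<gamma> (\<lambda>x. min (f x) (g x))"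
  unfolding lip_def
proof (intro conjI ballI)
  fix x assume x: "x \<in> X"
  show "0 \<le> min (f x) (g x)" "min (f x) (g x) \<le> \<gamma> * a"
    using lipD(2,3)[OF f x] lipD(2,3)[OF g x] by auto
  show "((\<lambda>x. min (f x) (g x)) \<longlongrightarrow> min (f x) (g x)) (Fl x)"
    using lipD(5)[OF f x] lipD(5)[OF g x] by (rule tendsto_min)
  fix y assume y: "y \<in> X"
  show "min (f x) (g x) \<le> min (f y) (g y) + \<gamma> * dt x y"
    using lipD(4)[OF f x y] lipD(4)[OF g x y] by linarith
qed (rule lipD(1)[OF f])

lemma lip_const: "0 \<le> \<gamma> \<Longrightarrow> 0 \<le> c \<Longrightarrow> c \<le> \<gamma> * a \<Longrightarrow> lip \<gamma> (\<lambda>_. c)"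
  unfolding lip_def by (auto simp: dt_nonneg)

lemma lip_scale:
  assumes "lip \<gamma> f" "0 \<le> c" shows "lip (c * \<gamma>) (\<lambda>x. c * f x)"
  unfolding lip_def
proof (intro conjI ballI)
  fix x assume x: "x \<in> X"
  show "0 \<le> c * f x" "((\<lambda>x. c * f x) \<longlongrightarrow> c * f x) (Fl x)"
    using lipD[OF assms(1)] x assms(2) by (auto intro!: tendsto_intros)
  show "c * f x \<le> c * \<gamma> * a"
    using mult_left_mono[OF lipD(3)[OF assms(1) x] assms(2)] by (simp add: mult.assoc)
  fix y assume y: "y \<in> X"
  show "c * f x \<le> c * f y + c * \<gamma> * dt x y"
    using mult_left_mono[OF lipD(4)[OF assms(1) x y] assms(2)] by (simp add: algebra_simps)
qed (use assms lipD(1) in auto)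

lemma lip_add:
  assumes "lip \<gamma> f" "lip \<gamma>' g" shows "lip (\<gamma> + \<gamma>') (\<lambda>x. f x + g x)"
  unfolding lip_def
proof (intro conjI ballI)
  fix x assume x: "x \<in> X"
  show "0 \<le> f x + g x" "f x + g x \<le> (\<gamma> + \<gamma>') * a"
    "((\<lambda>x. f x + g x) \<longlongrightarrow> f x + g x) (Fl x)"
    using lipD[OF assms(1)] lipD[OF assms(2)] x
    by (auto intro!: tendsto_intros add_mono simp: algebra_simps add_mono)
  fix y assume y: "y \<in> X"
  show "f x + g x \<le> f y + g y + (\<gamma> + \<gamma>') * dt x y"
    using lipD(4)[OF assms(1) x y] lipD(4)[OF assms(2) x y] by (simp add: algebra_simps)
qed (use assms lipD(1) in auto)

lemma lip_sum:
  assumes "finite G" "\<And>g. g \<in> G \<Longrightarrow> lip 1 g"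
  shows "lip (real (card G)) (\<lambda>x. \<Sum>g\<in>G. g x)"
  using assms
proof (induction G rule: finite_induct)
  case empty
  then show ?case using lip_const[of 0 0] by simp
next
  case (insert g G)
  then have "lip (1 + real (card G)) (\<lambda>x. g x + (\<Sum>g\<in>G. g x))" by (intro lip_add) auto
  then show ?case using insert by simp
qed

text \<open>The bound \<open>1 / a \<le> \<gamma>'\<close> makes room for the constant 1 at which
  the function is cut off, since values in \<open>lip \<gamma>'\<close> may not exceed
  \<open>\<gamma>' * a\<close>.\<close>

lemma lip_layer:
  assumes "lip \<gamma> f" "0 < \<delta>" "0 \<le> c" "\<gamma> / \<delta> \<le> \<gamma>'" "1 / a \<le> \<gamma>'"
  shows "lip \<gamma>' (\<lambda>x. min 1 (max 0 (f x - c) / \<delta>))"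
proof -
  have g: "0 \<le> \<gamma>" using lipD(1) assms(1) .
  have le: "max 0 (f x - c) \<le> f x" if "x \<in> X" for x using lipD(2)[OF assms(1) that] assms(3) by simp
  have "lip \<gamma> (\<lambda>x. max 0 (f x - c))"
    unfolding lip_def
  proof (intro conjI ballI)
    fix x assume x: "x \<in> X"
    show "0 \<le> max 0 (f x - c)" "max 0 (f x - c) \<le> \<gamma> * a"
      using le[OF x] lipD(3)[OF assms(1) x] by linarith+
    show "((\<lambda>x. max 0 (f x - c)) \<longlongrightarrow> max 0 (f x - c)) (Fl x)"
      using lipD(5)[OF assms(1) x] by (intro tendsto_intros)
    fix y assume y: "y \<in> X"
    show "max 0 (f x - c) \<le> max 0 (f y - c) + \<gamma> * dt x y"
      using lipD(4)[OF assms(1) x y] mult_nonneg_nonneg[OF g dt_nonneg[of x y]] by (auto simp: max_def)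
  qed (rule g)
  from lip_scale[OF this, of "1/\<delta>"] assms(2)
  have "lip (\<gamma> / \<delta>) (\<lambda>x. max 0 (f x - c) / \<delta>)" by simp
  then have "lip \<gamma>' (\<lambda>x. max 0 (f x - c) / \<delta>)" using assms(4) by (rule lip_mono)
  moreover have "lip \<gamma>' (\<lambda>_. 1)"
  proof (rule lip_const)
    show "0 \<le> \<gamma>'" using assms(5) a_pos by (smt (verit) divide_pos_pos)
    show "1 \<le> \<gamma>' * a" using assms(5) a_pos by (simp add: field_simps)
  qed auto
  ultimately show ?thesis by (intro lip_min)
qed

section \<open>Finite maxima of cones\<close>

definition cones :: "real \<Rightarrow> ('a \<Rightarrow> real) \<Rightarrow> 'a set \<Rightarrow> 'a \<Rightarrow> real" where
  "cones \<gamma> v S x = Max (insert 0 ((\<lambda>b. v b - \<gamma> * dt b x) ` S))"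

lemma cones_ge: "finite S \<Longrightarrow> b \<in> S \<Longrightarrow> v b - \<gamma> * dt b x \<le> cones \<gamma> v S x"
  unfolding cones_def by (rule Max_ge) auto

lemma cones_cases:
  assumes "finite S"
  obtains "cones \<gamma> v S x = 0" | b where "b \<in> S" "cones \<gamma> v S x = v b - \<gamma> * dt b x"
proof -
  have "cones \<gamma> v S x \<in> insert 0 ((\<lambda>b. v b - \<gamma> * dt b x) ` S)"
    unfolding cones_def by (rule Max_in) (use assms in auto)
  then show ?thesis using that by auto
qed

lemma cones_mono: "finite S' \<Longrightarrow> S \<subseteq> S' \<Longrightarrow> cones \<gamma> v S x \<le> cones \<gamma> v S' x"
  unfolding cones_def by (rule Max_mono) auto

lemma cones_insert: "finite S \<Longrightarrow> cones \<gamma> v (insert b S) x = max (max 0 (v b - \<gamma> * dt b x)) (cones \<gamma> v S x)"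
  unfolding cones_def by (cases "S = {}") (auto simp: Max_insert insert_commute max.assoc max.left_commute)

text \<open>Center points are required because \<open>Fl_center\<close> supplies the continuity of
  \<open>dt b\<close> only for them; the Lipschitz inequality is the triangle inequality.\<close>

lemma lip_cones:
  assumes "finite S" "S \<subseteq> C" "0 \<le> \<gamma>" "\<And>b. b \<in> S \<Longrightarrow> v b \<le> \<gamma> * a"
  shows "lip \<gamma> (cones \<gamma> v S)"
  using assms(1,2,4)
proof (induction S rule: finite_induct)
  case empty
  have "cones \<gamma> v {} = (\<lambda>_. 0)" by (auto simp: cones_def)
  then show ?case using lip_const[of \<gamma> 0] assms(3) a_pos by simp
next
  case (insert b S)
  have b: "b \<in> C" "b \<in> X" using insert C_sub by auto
  have "lip \<gamma> (\<lambda>x. max 0 (v b - \<gamma> * dt b x))"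
    unfolding lip_def
  proof (intro conjI ballI)
    fix x assume x: "x \<in> X"
    have p: "0 \<le> \<gamma> * dt b x" using assms(3) dt_nonneg by auto
    show "max 0 (v b - \<gamma> * dt b x) \<le> \<gamma> * a"
      using insert(5)[of b] p assms(3) a_pos by auto
    show "((\<lambda>x. max 0 (v b - \<gamma> * dt b x)) \<longlongrightarrow> max 0 (v b - \<gamma> * dt b x)) (Fl x)"
      using Fl_center[OF b(1) x] by (intro tendsto_intros)
    fix y assume y: "y \<in> X"
    have "\<gamma> * dt b y \<le> \<gamma> * dt b x + \<gamma> * dt x y"
      using mult_left_mono[OF dt_triangle[OF b(2) x y] assms(3)] by (simp add: algebra_simps)
    then show "max 0 (v b - \<gamma> * dt b x) \<le> max 0 (v b - \<gamma> * dt b y) + \<gamma> * dt x y"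
      using mult_nonneg_nonneg[OF assms(3) dt_nonneg[of x y]] by (auto simp: max_def)
  qed (use assms(3) in auto)
  then have "lip \<gamma> (\<lambda>x. max (max 0 (v b - \<gamma> * dt b x)) (cones \<gamma> v S x))"
    using insert by (intro lip_max[of \<gamma> "\<lambda>x. max 0 (v b - \<gamma> * dt b x)"]) auto
  then show ?case using cones_insert[OF insert(1)] by simp
qed

text \<open>Minimality: \<open>cones\<close> is a lower envelope in the style of McShane, the least
  nonnegative function compatible with the prescribed values \<open>v\<close> on \<open>S\<close>
  and the slope \<open>\<gamma>\<close>.\<close>

lemma cones_le:
  assumes "finite S" "S \<subseteq> X" "x \<in> X" "0 \<le> f x" "\<And>b. b \<in> S \<Longrightarrow> v b \<le> f x + \<gamma> * dt b x"
  shows "cones \<gamma> v S x \<le> f x"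
proof (cases rule: cones_cases[OF assms(1), of \<gamma> v x])
  case (2 b)
  then show ?thesis using assms(5)[of b] by simp
qed (use assms(4) in simp)

lemma lip_cones_self:
  assumes "finite S" "S \<subseteq> C" "lip \<gamma> f"
  shows "lip \<gamma> (cones \<gamma> f S)"
  using assms lipD(1,3)[OF assms(3)] C_sub by (intro lip_cones) auto

lemma cones_self_le:
  assumes "finite S" "S \<subseteq> C" "lip \<gamma> f" "x \<in> X"
  shows "cones \<gamma> f S x \<le> f x"
  using assms lipD[OF assms(3)] C_sub by (intro cones_le) auto

text \<open>Along \<open>Fl x\<close>, \<open>f b\<close> tends to \<open>f x\<close> and
  \<open>dt b x\<close> to 0. The slope \<open>\<gamma>\<close> of the cone is thus arbitrary and
  may exceed the Lipschitz constant \<open>\<gamma>'\<close>, which the tightness argument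
  exploits.\<close>

lemma cone_approx:
  assumes "lip \<gamma>' f" "x \<in> X" "t < f x"
  shows "\<exists>b\<in>B. t < f b - \<gamma> * dt b x \<and> dt b x < a"
proof -
  have "((\<lambda>b. f b - \<gamma> * dt b x) \<longlongrightarrow> f x - \<gamma> * 0) (Fl x)"
    using lipD(5)[OF assms(1,2)] Fl_dt[OF assms(2)] by (intro tendsto_intros)
  then have "eventually (\<lambda>b. t < f b - \<gamma> * dt b x) (Fl x)"
    by (rule order_tendstoD) (use assms(3) in simp)
  moreover have "eventually (\<lambda>b. dt b x < a) (Fl x)"
    using Fl_dt[OF assms(2)] by (rule order_tendstoD) (rule a_pos)
  ultimately have "eventually (\<lambda>b. b \<in> B \<and> t < f b - \<gamma> * dt b x \<and> dt b x < a) (Fl x)"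
    using Fl_B[OF assms(2)] by eventually_elim simp
  then show ?thesis using eventually_happens Fl_nontriv[OF assms(2)] by blast
qed

section \<open>Level sets and real-valued valuations\<close>

definition level :: "('a \<Rightarrow> real) \<Rightarrow> real \<Rightarrow> 'a set" where
  "level f t = {x \<in> X. t < f x}"

lemma open_level:
  assumes "lip \<gamma> f" shows "openin T (level f t)"
  unfolding open_iff level_def
proof (intro conjI ballI)
  fix x assume x: "x \<in> {x \<in> X. t < f x}"
  have g: "0 \<le> \<gamma>" using lipD(1) assms .
  \<comment> \<open>Slope \<open>\<gamma> + 1\<close> rather than \<open>\<gamma>\<close> makes the
    divisor in \<open>\<rho>\<close> positive even when \<open>\<gamma> = 0\<close>; as
    \<open>dt\<close> is nonnegative, the surplus does no harm.\<close>
  obtain b where b: "b \<in> B" "t < f b - (\<gamma> + 1) * dt b x" "dt b x < a"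
    using cone_approx[OF assms, of x t "\<gamma> + 1"] x by auto
  define \<rho> where "\<rho> = min a ((f b - t) / (\<gamma> + 1))"
  have "0 \<le> (\<gamma> + 1) * dt b x" using g dt_nonneg by simp
  then have ft: "0 < f b - t" using b by linarith
  then have "0 < \<rho>" using a_pos g by (simp add: \<rho>_def)
  moreover have "dt b x < \<rho>" using b g by (simp add: \<rho>_def pos_less_divide_eq algebra_simps)
  moreover have "{y \<in> X. dt b y < \<rho>} \<subseteq> {x \<in> X. t < f x}"
  proof safe
    fix y assume y: "y \<in> X" "dt b y < \<rho>"
    then have "dt b y * (\<gamma> + 1) < f b - t" using g by (simp add: \<rho>_def pos_less_divide_eq)
    moreover have "f b \<le> f y + \<gamma> * dt b y" using lipD(4)[OF assms B_X[OF b(1)] y(1)] .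
    ultimately show "t < f y" using dt_nonneg[of b y] by (simp add: algebra_simps)
  qed
  ultimately show "\<exists>b\<in>B. \<exists>\<rho>>0. \<rho> \<le> a \<and> dt b x < \<rho> \<and> {y \<in> X. dt b y < \<rho>} \<subseteq> {x \<in> X. t < f x}"
    using b(1) by (intro bexI[of _ b] exI[of _ \<rho>]) (auto simp: \<rho>_def)
qed auto

text \<open>The real-valued form of \<open>V1\<close>. Scott-continuity is put in epsilon form, so
  that no supremum of reals has to be shown bounded. Values off the open sets are left free;
  equality of valuations is therefore only ever derived on open sets at this level.\<close>

definition rval :: "('a set \<Rightarrow> real) \<Rightarrow> bool" where
  "rval m \<longleftrightarrow> m {} = 0 \<and> m X = 1 \<and>
     (\<forall>U V. openin T U \<and> openin T V \<longrightarrow> m (U \<union> V) + m (U \<inter> V) = m U + m V) \<and>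
     (\<forall>U V. openin T U \<and> openin T V \<and> U \<subseteq> V \<longrightarrow> m U \<le> m V) \<and>
     (\<forall>\<U> \<epsilon>. directed_in {U. openin T U} (\<subseteq>) \<U> \<and> 0 < \<epsilon> \<longrightarrow> (\<exists>U\<in>\<U>. m (\<Union>\<U>) < m U + \<epsilon>))"

lemma openin_X: "openin T X" using topspace_T openin_topspace by metis

lemma rvalD:
  assumes "rval m"
  shows "m {} = 0" "m X = 1"
    "openin T U \<Longrightarrow> openin T V \<Longrightarrow> m (U \<union> V) + m (U \<inter> V) = m U + m V"
    "openin T U \<Longrightarrow> openin T V \<Longrightarrow> U \<subseteq> V \<Longrightarrow> m U \<le> m V"
    "directed_in {U. openin T U} (\<subseteq>) \<U> \<Longrightarrow> 0 < \<epsilon> \<Longrightarrow> \<exists>U\<in>\<U>. m (\<Union>\<U>) < m U + \<epsilon>"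
  using assms unfolding rval_def by blast+

lemma rval_bounds:
  assumes "rval m" "openin T U" shows "0 \<le> m U" "m U \<le> 1"
proof -
  show "0 \<le> m U" using rvalD(4)[OF assms(1) _ assms(2), of "{}"] rvalD(1)[OF assms(1)] by simp
  have "U \<subseteq> X" using assms(2) topspace_T openin_subset by metis
  then show "m U \<le> 1" using rvalD(4)[OF assms(1,2) openin_X] rvalD(2)[OF assms(1)] by simp
qed

lemma level_mono: "(\<And>x. x \<in> X \<Longrightarrow> f x \<le> g x) \<Longrightarrow> s \<le> t \<Longrightarrow> level f t \<subseteq> level g s"
  unfolding level_def by force

lemma level_max: "level (\<lambda>x. max (f x) (g x)) t = level f t \<union> level g t"
  and level_min: "level (\<lambda>x. min (f x) (g x)) t = level f t \<inter> level g t"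
  unfolding level_def by auto

section \<open>The layer-cake integral and its Riemann sums\<close>

definition rint :: "('a set \<Rightarrow> real) \<Rightarrow> ('a \<Rightarrow> real) \<Rightarrow> real" where
  "rint m f = enn2real (\<integral>\<^sup>+t\<in>{0..}. ennreal (m (level f t)) \<partial>lborel)"

text \<open>The sum over right endpoints for the antitone function that sends \<open>t\<close> to
  \<open>m (level f t)\<close>, hence a lower Riemann sum of mesh \<open>\<delta>\<close>.\<close>

definition lows :: "real \<Rightarrow> nat \<Rightarrow> ('a set \<Rightarrow> real) \<Rightarrow> ('a \<Rightarrow> real) \<Rightarrow> real" where
  "lows \<delta> N m f = \<delta> * (\<Sum>k<N. m (level f (real (Suc k) * \<delta>)))"

end

text \<open>On each cell of length \<open>\<delta>\<close> an antitone function lies between its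
  values at the right and the left endpoint. Both bounds compare \<open>\<phi>\<close> with a step
  function whose integral is computed exactly.\<close>

lemma antitone_sandwich:
  fixes \<phi> :: "real \<Rightarrow> real" and \<delta> :: real
  assumes anti: "\<And>s t. 0 \<le> s \<Longrightarrow> s \<le> t \<Longrightarrow> \<phi> t \<le> \<phi> s" and nn: "\<And>t. 0 \<le> \<phi> t"
    and zero: "\<And>t. real N * \<delta> \<le> t \<Longrightarrow> \<phi> t = 0" and d: "0 < \<delta>"
  shows "ennreal (\<delta> * (\<Sum>k<N. \<phi> (real (Suc k) * \<delta>))) \<le> (\<integral>\<^sup>+t\<in>{0..}. ennreal (\<phi> t) \<partial>lborel)"
    and "(\<integral>\<^sup>+t\<in>{0..}. ennreal (\<phi> t) \<partial>lborel) \<le> ennreal (\<delta> * (\<Sum>k<N. \<phi> (real k * \<delta>)))"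
proof -
  let ?A = "\<lambda>k::nat. {real k * \<delta>..<real (Suc k) * \<delta>}"
  \<comment> \<open>Each nonnegative \<open>t\<close> lies in exactly one cell, so a sum of cell
    indicators collapses to a single value.\<close>
  have ind: "indicator (?A k) t = (if k = nat \<lfloor>t / \<delta>\<rfloor> then 1 else (0::ennreal))" if "0 \<le> t" for k and t :: real
  proof -
    have "t \<in> ?A k \<longleftrightarrow> real k \<le> t / \<delta> \<and> t / \<delta> < real k + 1"
      using d by (auto simp: field_simps)
    also have "\<dots> \<longleftrightarrow> k = nat \<lfloor>t / \<delta>\<rfloor>"
      using that d by (smt (verit) divide_nonneg_pos floor_eq_iff nat_int of_int_of_nat_eq of_nat_nat zero_le_floor floor_correct)
    finally show ?thesis by (simp add: indicator_def)
  qed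
  have neg: "indicator (?A k) t = (0::ennreal)" if "t < 0" for k and t :: real
  proof -
    have "0 \<le> real k * \<delta>" using d by simp
    then show ?thesis using that by (auto simp: indicator_def)
  qed
  have int: "(\<integral>\<^sup>+t. (\<Sum>k<N. ennreal (c k) * indicator (?A k) t) \<partial>lborel) = ennreal (\<delta> * (\<Sum>k<N. c k))"
    if c: "\<And>k. 0 \<le> c k" for c :: "nat \<Rightarrow> real"
  proof -
    have "(\<integral>\<^sup>+t. (\<Sum>k<N. ennreal (c k) * indicator (?A k) t) \<partial>lborel)
        = (\<Sum>k<N. \<integral>\<^sup>+t. ennreal (c k) * indicator (?A k) t \<partial>lborel)"
      by (rule nn_integral_sum) auto
    also have "\<dots> = (\<Sum>k<N. ennreal (c k) * ennreal \<delta>)"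
    proof (rule sum.cong[OF refl])
      fix k
      have "(\<integral>\<^sup>+t. ennreal (c k) * indicator (?A k) t \<partial>lborel) = ennreal (c k) * emeasure lborel (?A k)"
        by (rule nn_integral_cmult_indicator) auto
      also have "emeasure lborel (?A k) = ennreal \<delta>" using d by (simp add: algebra_simps)
      finally show "(\<integral>\<^sup>+t. ennreal (c k) * indicator (?A k) t \<partial>lborel) = ennreal (c k) * ennreal \<delta>" .
    qed
    also have "\<dots> = (\<Sum>k<N. ennreal (\<delta> * c k))"
      by (rule sum.cong[OF refl]) (use d c in \<open>simp add: ennreal_mult mult.commute\<close>)
    also have "\<dots> = ennreal (\<delta> * (\<Sum>k<N. c k))"
      using d c by (simp add: sum_ennreal sum_distrib_left)
    finally show ?thesis .
  qed
  have pt: "(\<Sum>k<N. ennreal (c k) * indicator (?A k) t) =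
      (if nat \<lfloor>t / \<delta>\<rfloor> < N then ennreal (c (nat \<lfloor>t / \<delta>\<rfloor>)) else 0)" if "0 \<le> t" for t :: real and c :: "nat \<Rightarrow> real"
    unfolding ind[OF that] by (simp add: if_distrib[of "(*) _"] cong: if_cong)
  define q where "q t = nat \<lfloor>t / \<delta>\<rfloor>" for t :: real
  have kt: "real (q t) * \<delta> \<le> t" "t \<le> real (Suc (q t)) * \<delta>" if "0 \<le> t" for t
  proof -
    have "real (q t) \<le> t / \<delta>" "t / \<delta> \<le> real (q t) + 1"
      using that d unfolding q_def by (simp_all add: of_nat_nat)
    then show "real (q t) * \<delta> \<le> t" "t \<le> real (Suc (q t)) * \<delta>" using d by (auto simp: field_simps)
  qed
  have "(\<integral>\<^sup>+t. (\<Sum>k<N. ennreal (\<phi> (real (Suc k) * \<delta>)) * indicator (?A k) t) \<partial>lborel)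
      \<le> (\<integral>\<^sup>+t\<in>{0..}. ennreal (\<phi> t) \<partial>lborel)"
  proof (rule nn_integral_mono)
    fix t :: real
    show "(\<Sum>k<N. ennreal (\<phi> (real (Suc k) * \<delta>)) * indicator (?A k) t) \<le> ennreal (\<phi> t) * indicator {0..} t"
    proof (cases "0 \<le> t")
      case True
      have "\<phi> (real (Suc (q t)) * \<delta>) \<le> \<phi> t" using kt(2)[OF True] anti[OF True] by simp
      then show ?thesis using True pt[OF True, of "\<lambda>k. \<phi> (real (Suc k) * \<delta>)"]
        by (simp add: q_def ennreal_leI del: of_nat_Suc)
    next
      case False
      then have t: "t < 0" by simp
      show ?thesis unfolding neg[OF t] by simp
    qed
  qed
  then show "ennreal (\<delta> * (\<Sum>k<N. \<phi> (real (Suc k) * \<delta>))) \<le> (\<integral>\<^sup>+t\<in>{0..}. ennreal (\<phi> t) \<partial>lborel)"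
    using int[of "\<lambda>k. \<phi> (real (Suc k) * \<delta>)"] nn by simp
  have "(\<integral>\<^sup>+t\<in>{0..}. ennreal (\<phi> t) \<partial>lborel)
      \<le> (\<integral>\<^sup>+t. (\<Sum>k<N. ennreal (\<phi> (real k * \<delta>)) * indicator (?A k) t) \<partial>lborel)"
  proof (rule nn_integral_mono)
    fix t :: real
    show "ennreal (\<phi> t) * indicator {0..} t \<le> (\<Sum>k<N. ennreal (\<phi> (real k * \<delta>)) * indicator (?A k) t)"
    proof (cases "0 \<le> t")
      case True
      have "\<phi> t \<le> \<phi> (real (q t) * \<delta>)" using kt(1)[OF True] d by (intro anti) auto
      moreover have "\<phi> t = 0" if "\<not> q t < N"
      proof (rule zero)
        have "real N * \<delta> \<le> real (q t) * \<delta>" using that d by simp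
        then show "real N * \<delta> \<le> t" using kt(1)[OF True] by linarith
      qed
      ultimately show ?thesis using True pt[OF True, of "\<lambda>k. \<phi> (real k * \<delta>)"]
        by (simp add: q_def ennreal_leI)
    qed simp
  qed
  then show "(\<integral>\<^sup>+t\<in>{0..}. ennreal (\<phi> t) \<partial>lborel) \<le> ennreal (\<delta> * (\<Sum>k<N. \<phi> (real k * \<delta>)))"
    using int[of "\<lambda>k. \<phi> (real k * \<delta>)"] nn by simp
qed

lemma Sup_approx_nat:
  fixes x y :: real
  assumes "\<And>n::nat. x \<le> y + c / real (Suc n)"
  shows "x \<le> y"
proof -
  have "(\<lambda>n. y + c / real (Suc n)) \<longlonglongrightarrow> y + 0"
    by (intro tendsto_add tendsto_const) (rule LIMSEQ_Suc[OF lim_const_over_n])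
  then show ?thesis using assms by (intro LIMSEQ_le_const[of "\<lambda>n. y + c / real (Suc n)"]) auto
qed

lemma directed_finite_upper:
  assumes D: "directed_in P le D" and refl: "\<And>x. x \<in> P \<Longrightarrow> le x x"
    and trans: "\<And>x y z. x \<in> P \<Longrightarrow> y \<in> P \<Longrightarrow> z \<in> P \<Longrightarrow> le x y \<Longrightarrow> le y z \<Longrightarrow> le x z"
    and F: "finite F" "F \<subseteq> D"
  shows "\<exists>z\<in>D. \<forall>x\<in>F. le x z"
  using F
proof (induction F rule: finite_induct)
  case empty
  then show ?case using D unfolding directed_in_def by auto
next
  case (insert x F)
  then obtain z where z: "z \<in> D" "\<forall>y\<in>F. le y z" by auto
  with insert D obtain w where "w \<in> D" "le x w" "le z w" unfolding directed_in_def by (metis insert_subset)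
  then have w: "w \<in> D" "le x w" "le z w" by auto
  have "le y w" if "y \<in> F" for y
    by (rule trans[of y z w]) (use z w that insert D in \<open>auto simp: directed_in_def\<close>)
  with w show ?case by auto
qed

context kr_space begin

text \<open>The upper and lower sums telescope: they differ by \<open>\<delta>\<close> times the
  drop of the level mass between heights 0 and \<open>N * \<delta>\<close>, which is at most 1. The
  last part excludes the infinite integral that \<open>enn2real\<close> would send to 0.\<close>

lemma rint_sandwich:
  assumes m: "rval m" and f: "lip \<gamma> f" and le: "\<And>x. x \<in> X \<Longrightarrow> f x \<le> real N * \<delta>" and d: "0 < \<delta>"
  shows "lows \<delta> N m f \<le> rint m f" "rint m f \<le> \<delta> * (\<Sum>k<N. m (level f (real k * \<delta>)))"
    "\<delta> * (\<Sum>k<N. m (level f (real k * \<delta>))) \<le> lows \<delta> N m f + \<delta>"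
    "(\<integral>\<^sup>+t\<in>{0..}. ennreal (m (level f t)) \<partial>lborel) = ennreal (rint m f)"
proof -
  let ?\<phi> = "\<lambda>t. m (level f t)"
  note op = open_level[OF f]
  have nn: "0 \<le> ?\<phi> t" for t using rval_bounds(1)[OF m op] .
  have anti: "?\<phi> t \<le> ?\<phi> s" if "s \<le> t" for s t
    using rvalD(4)[OF m op op level_mono] that by blast
  have zero: "?\<phi> t = 0" if "real N * \<delta> \<le> t" for t
  proof -
    have "level f t = {}" using le that by (force simp: level_def)
    then show ?thesis using rvalD(1)[OF m] by simp
  qed
  let ?I = "\<integral>\<^sup>+t\<in>{0..}. ennreal (?\<phi> t) \<partial>lborel"
  have s: "ennreal (lows \<delta> N m f) \<le> ?I" "?I \<le> ennreal (\<delta> * (\<Sum>k<N. ?\<phi> (real k * \<delta>)))"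
    unfolding lows_def using anti nn zero d by (intro antitone_sandwich; blast)+
  have fin: "?I < \<infinity>" using s(2) by (rule le_less_trans) auto
  show eq: "?I = ennreal (rint m f)" unfolding rint_def using fin by (simp add: less_top)
  have r: "0 \<le> rint m f" by (simp add: rint_def)
  show "lows \<delta> N m f \<le> rint m f"
    using s(1) r unfolding eq by (subst (asm) ennreal_le_iff) auto
  have "0 \<le> \<delta> * (\<Sum>k<N. m (level f (real k * \<delta>)))"
    using d nn by (intro mult_nonneg_nonneg sum_nonneg) auto
  from s(2)[unfolded eq ennreal_le_iff[OF this]]
  show "rint m f \<le> \<delta> * (\<Sum>k<N. m (level f (real k * \<delta>)))" .
  have "(\<Sum>k<N. ?\<phi> (real k * \<delta>)) + ?\<phi> (real N * \<delta>) = ?\<phi> 0 + (\<Sum>k<N. ?\<phi> (real (Suc k) * \<delta>))"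
    using sum.lessThan_Suc_shift[of "\<lambda>k. ?\<phi> (real k * \<delta>)" N] by (simp del: of_nat_Suc)
  then have "(\<Sum>k<N. ?\<phi> (real k * \<delta>)) \<le> 1 + (\<Sum>k<N. ?\<phi> (real (Suc k) * \<delta>))"
    using rval_bounds[OF m op, of "real N * \<delta>"] rval_bounds[OF m op, of 0] by linarith
  from mult_left_mono[OF this, of \<delta>] d
  show "\<delta> * (\<Sum>k<N. m (level f (real k * \<delta>))) \<le> lows \<delta> N m f + \<delta>"
    by (simp add: lows_def algebra_simps)
qed

text \<open>Numbers squeezed between consecutive level masses form a Riemann sum. They will be
  integrals of slices, or values of a functional \<open>J\<close> not yet known to be an
  integral.\<close>

lemma rint_layers:
  assumes m: "rval m" and f: "lip \<gamma> f" and le: "\<And>x. x \<in> X \<Longrightarrow> f x \<le> real N * \<delta>" and d: "0 < \<delta>"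
    and c: "\<And>k. k < N \<Longrightarrow> m (level f (real (Suc k) * \<delta>)) \<le> c k"
      "\<And>k. k < N \<Longrightarrow> c k \<le> m (level f (real k * \<delta>))"
  shows "\<bar>rint m f - \<delta> * (\<Sum>k<N. c k)\<bar> \<le> \<delta>"
proof -
  have "lows \<delta> N m f \<le> \<delta> * (\<Sum>k<N. c k)"
    unfolding lows_def using c(1) d by (intro mult_left_mono sum_mono) (auto simp del: of_nat_Suc)
  moreover have "\<delta> * (\<Sum>k<N. c k) \<le> \<delta> * (\<Sum>k<N. m (level f (real k * \<delta>)))"
    using c(2) d by (intro mult_left_mono sum_mono) auto
  ultimately show ?thesis using rint_sandwich[OF m f le d] by linarith
qed

text \<open>Relations between masses of level sets pass through this limit to the integrals.\<close>

lemma lows_LIMSEQ: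
  assumes m: "rval m" and f: "lip \<gamma> f" and le: "\<And>x. x \<in> X \<Longrightarrow> f x \<le> M" and M: "0 < M"
  shows "(\<lambda>n. lows (M / Suc n) (Suc n) m f) \<longlonglongrightarrow> rint m f"
proof -
  have *: "lows (M / Suc n) (Suc n) m f \<le> rint m f \<and> rint m f \<le> lows (M / Suc n) (Suc n) m f + M / Suc n" for n
    using rint_sandwich[OF m f, of "Suc n" "M / Suc n"] le M by (force simp del: of_nat_Suc)
  have "(\<lambda>n. rint m f - M / Suc n) \<longlonglongrightarrow> rint m f - 0"
    by (intro tendsto_diff tendsto_const) (rule LIMSEQ_Suc[OF lim_const_over_n])
  then have lower: "(\<lambda>n. rint m f - M / Suc n) \<longlonglongrightarrow> rint m f" by simp
  show ?thesis
  proof (rule tendsto_sandwich[OF always_eventually always_eventually lower tendsto_const]; rule allI)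
    fix n
    show "rint m f - M / Suc n \<le> lows (M / Suc n) (Suc n) m f" using *[of n] by linarith
    show "lows (M / Suc n) (Suc n) m f \<le> rint m f" using *[of n] by linarith
  qed
qed

lemma rint_mono:
  assumes m: "rval m" and f: "lip \<gamma> f" and g: "lip \<gamma>' g" and le: "\<And>x. x \<in> X \<Longrightarrow> f x \<le> g x"
  shows "rint m f \<le> rint m g"
proof -
  define M where "M = \<gamma>' * a + 1"
  have M: "0 < M" using lipD(1)[OF g] a_pos by (simp add: M_def add_nonneg_pos)
  have gM: "g x \<le> M" if "x \<in> X" for x using lipD(3)[OF g that] by (simp add: M_def)
  have fM: "f x \<le> M" if "x \<in> X" for x using le[OF that] gM[OF that] by simp
  have "lows (M / Suc n) (Suc n) m f \<le> lows (M / Suc n) (Suc n) m g" for n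
    unfolding lows_def using M
    by (intro mult_left_mono sum_mono rvalD(4)[OF m] open_level[OF f] open_level[OF g] level_mono le)
      (auto simp del: of_nat_Suc)
  then show ?thesis
    by (intro LIMSEQ_le[OF lows_LIMSEQ[OF m f fM M] lows_LIMSEQ[OF m g gM M]]) auto
qed

text \<open>This lattice identity plays the part of linearity: level sets of a maximum and a minimum
  are unions and intersections, so modularity applies at each height, whereas level sets of a sum
  have no such description.\<close>

lemma rint_max_min:
  assumes m: "rval m" and f: "lip \<gamma> f" and g: "lip \<gamma> g"
  shows "rint m (\<lambda>x. max (f x) (g x)) + rint m (\<lambda>x. min (f x) (g x)) = rint m f + rint m g"
proof -
  define M where "M = \<gamma> * a + 1"
  have M: "0 < M" using lipD(1)[OF g] a_pos by (simp add: M_def add_nonneg_pos)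
  have b: "f x \<le> M" "g x \<le> M" if "x \<in> X" for x
    using lipD(3)[OF g that] lipD(3)[OF f that] by (simp_all add: M_def)
  have b': "max (f x) (g x) \<le> M" "min (f x) (g x) \<le> M" if "x \<in> X" for x using b[OF that] by auto
  note L = lows_LIMSEQ[OF m _ _ M]
  have eq: "lows \<delta> N m (\<lambda>x. max (f x) (g x)) + lows \<delta> N m (\<lambda>x. min (f x) (g x)) = lows \<delta> N m f + lows \<delta> N m g" for \<delta> N
  proof -
    have "m (level (\<lambda>x. max (f x) (g x)) t) + m (level (\<lambda>x. min (f x) (g x)) t) = m (level f t) + m (level g t)" for t
      unfolding level_max level_min by (rule rvalD(3)[OF m open_level[OF f] open_level[OF g]])
    then show ?thesis unfolding lows_def distrib_left[symmetric] sum.distrib[symmetric] by simp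
  qed
  from tendsto_add[OF L[OF lip_max[OF f g] b'(1)] L[OF lip_min[OF f g] b'(2)]]
    tendsto_add[OF L[OF f b(1)] L[OF g b(2)]]
  show ?thesis unfolding eq by (rule LIMSEQ_unique)
qed

lemma rint_scale:
  assumes m: "rval m" and f: "lip \<gamma> f" and c: "0 < c"
  shows "rint m (\<lambda>x. c * f x) = c * rint m f"
proof -
  define M where "M = \<gamma> * a + 1"
  have M: "0 < M" using lipD(1)[OF f] a_pos by (simp add: M_def add_nonneg_pos)
  have b: "f x \<le> M" if "x \<in> X" for x using lipD(3)[OF f that] by (simp add: M_def)
  have b': "c * f x \<le> c * M" if "x \<in> X" for x using b[OF that] c by simp
  have cM: "0 < c * M" using c M by simp
  \<comment> \<open>The mesh is scaled together with \<open>f\<close>, so the level sets in the two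
    sums coincide exactly.\<close>
  have eq: "lows (c * M / Suc n) (Suc n) m (\<lambda>x. c * f x) = c * lows (M / Suc n) (Suc n) m f" for n
  proof -
    have *: "level (\<lambda>x. c * f x) (t * (c * M / Suc n)) = level f (t * (M / Suc n))" for t
    proof -
      have "t * (c * M / Suc n) = c * (t * (M / Suc n))" by simp
      then show ?thesis using c by (simp only: level_def mult_less_cancel_left_pos)
    qed
    show ?thesis unfolding lows_def * by simp
  qed
  have "(\<lambda>n. c * lows (M / Suc n) (Suc n) m f) \<longlonglongrightarrow> rint m (\<lambda>x. c * f x)"
    using lows_LIMSEQ[OF m lip_scale[OF f less_imp_le[OF c]] b' cM] unfolding eq .
  moreover have "(\<lambda>n. c * lows (M / Suc n) (Suc n) m f) \<longlonglongrightarrow> c * rint m f"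
    by (intro tendsto_mult tendsto_const lows_LIMSEQ[OF m f b M])
  ultimately show ?thesis by (rule LIMSEQ_unique)
qed

lemma rint_nonneg: "0 \<le> rint m f"
  by (simp add: rint_def)

text \<open>Cut the range into \<open>n + 1\<close> layers: every height \<open>k / (n + 1)\<close>
  with \<open>k \<le> n\<close> is below 1, so each level set in the upper sum contains
  \<open>U\<close>.\<close>

lemma rint_ge:
  assumes m: "rval m" and f: "lip \<gamma> f" and U: "openin T U" and ge: "\<And>x. x \<in> U \<Longrightarrow> 1 \<le> f x"
    and le: "\<And>x. x \<in> X \<Longrightarrow> f x \<le> 1"
  shows "m U \<le> rint m f"
proof (rule Sup_approx_nat[of _ _ 1])
  fix n :: nat
  let ?d = "1 / real (Suc n)"
  have UX: "U \<subseteq> X" using U topspace_T openin_subset by metis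
  have "m U \<le> m (level f (real k * ?d))" if "k < Suc n" for k
  proof (intro rvalD(4)[OF m U open_level[OF f]] subsetI)
    fix x assume x: "x \<in> U"
    have "real k * ?d < 1" using that by (simp add: divide_simps)
    then have "real k * ?d < f x" using ge[OF x] by linarith
    then show "x \<in> level f (real k * ?d)" using x UX unfolding level_def by blast
  qed
  then have "(\<Sum>k<Suc n. m U) \<le> (\<Sum>k<Suc n. m (level f (real k * ?d)))" by (intro sum_mono) auto
  then have "m U \<le> ?d * (\<Sum>k<Suc n. m (level f (real k * ?d)))"
    by (simp add: pos_le_divide_eq mult.commute del: of_nat_Suc sum.lessThan_Suc)
  then show "m U \<le> rint m f + 1 / real (Suc n)"
    using rint_sandwich[OF m f, of "Suc n" ?d] le by (auto simp del: of_nat_Suc sum.lessThan_Suc)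
qed

text \<open>A single layer of thickness 1 suffices, as \<open>level f 0\<close> lies inside
  \<open>U\<close>.\<close>

lemma rint_le:
  assumes m: "rval m" and f: "lip \<gamma> f" and U: "openin T U" and z: "\<And>x. x \<in> X \<Longrightarrow> x \<notin> U \<Longrightarrow> f x = 0"
    and le: "\<And>x. x \<in> X \<Longrightarrow> f x \<le> 1"
  shows "rint m f \<le> m U"
proof -
  have "m (level f (real 0 * 1)) \<le> m U"
    using z by (intro rvalD(4)[OF m open_level[OF f] U]) (force simp: level_def)
  then show ?thesis using rint_sandwich(2)[OF m f, of 1 1] le by simp
qed

lemma rint_one: "rval m \<Longrightarrow> rint m (\<lambda>_. 1) = 1"
proof (rule antisym)
  assume m: "rval m"
  have l: "lip (1 / a) (\<lambda>_. 1)" using a_pos by (intro lip_const) auto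
  show "rint m (\<lambda>_. 1) \<le> 1" using rint_le[OF m l openin_X] rvalD(2)[OF m] by simp
  show "1 \<le> rint m (\<lambda>_. 1)" using rint_ge[OF m l openin_X] rvalD(2)[OF m] by simp
qed

lemma rint_bound:
  assumes m: "rval m" and f: "lip \<gamma> f" and le: "\<And>x. x \<in> X \<Longrightarrow> f x \<le> M" and M: "0 < M"
  shows "rint m f \<le> M"
proof -
  have "m (level f 0) \<le> 1" by (rule rval_bounds[OF m open_level[OF f]])
  then have "M * m (level f 0) \<le> M" using M by simp
  moreover have "rint m f \<le> M * m (level f 0)" using rint_sandwich(2)[OF m f, of 1 M] le M by simp
  ultimately show ?thesis by linarith
qed

text \<open>The slice of \<open>f\<close> between the heights \<open>k * \<delta>\<close> and
  \<open>(k + 1) * \<delta>\<close>, stretched to height 1. It lies between the indicators of two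
  consecutive level sets, and the slices times \<open>\<delta>\<close> add up to
  \<open>f\<close>.\<close>

definition layer :: "real \<Rightarrow> ('a \<Rightarrow> real) \<Rightarrow> nat \<Rightarrow> 'a \<Rightarrow> real" where
  "layer \<delta> f k = (\<lambda>x. min 1 (max 0 (f x - real k * \<delta>) / \<delta>))"

lemma lip_layer':
  assumes "lip \<gamma> f" "0 < \<delta>" shows "lip (max (\<gamma> / \<delta>) (1 / a)) (layer \<delta> f k)"
  unfolding layer_def by (rule lip_layer[OF assms]) (use assms in auto)

lemma layer_bounds: "0 < \<delta> \<Longrightarrow> 0 \<le> layer \<delta> f k x" "layer \<delta> f k x \<le> 1"
  "0 < \<delta> \<Longrightarrow> real (Suc k) * \<delta> < f x \<Longrightarrow> layer \<delta> f k x = 1"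
  "f x \<le> real k * \<delta> \<Longrightarrow> layer \<delta> f k x = 0"
  by (auto simp: layer_def min_def max_def field_simps)

text \<open>An approximate layer-cake formula that mentions Lipschitz functions only and no level
  sets. In this form it is inherited by limits of integrals.\<close>

lemma rint_layer_sum:
  assumes m: "rval m" and f: "lip \<gamma> f" and le: "\<And>x. x \<in> X \<Longrightarrow> f x \<le> real N * \<delta>" and d: "0 < \<delta>"
  shows "\<bar>rint m f - \<delta> * (\<Sum>k<N. rint m (layer \<delta> f k))\<bar> \<le> \<delta>"
proof (rule rint_layers[OF m f le d])
  fix k
  note l = lip_layer'[OF f d, of k] 
  show "m (level f (real (Suc k) * \<delta>)) \<le> rint m (layer \<delta> f k)"
    by (rule rint_ge[OF m l open_level[OF f]]) (auto simp: level_def layer_bounds d simp del: of_nat_Suc)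
  show "rint m (layer \<delta> f k) \<le> m (level f (real k * \<delta>))"
    by (rule rint_le[OF m l open_level[OF f]]) (auto simp: level_def layer_bounds d)
qed

text \<open>For each height \<open>t\<close> the level sets of the functions
  \<open>cones \<gamma> f S\<close> form a directed family with union \<open>level f t\<close>, so
  one finite \<open>S\<close> captures almost all of its mass. Finitely many heights determine the
  integral up to the mesh.\<close>

lemma rint_cones:
  assumes m: "rval m" and f: "lip \<gamma> f" and e: "0 < \<epsilon>"
  shows "\<exists>S. finite S \<and> S \<subseteq> B \<and> S \<noteq> {} \<and> rint m f < rint m (cones \<gamma> f S) + \<epsilon>"
proof -
  \<comment> \<open>Mass 1 forces \<open>X\<close>, hence \<open>B\<close>, to be nonempty; adding
    \<open>b0\<close> to the final set makes it nonempty, as \<open>simple_approximation\<close>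
    requires.\<close>
  have XB: "\<exists>b. b \<in> B"
  proof -
    have "X \<noteq> {}" using rvalD(1,2)[OF m] by auto
    then show ?thesis using cone_approx[OF f] by (meson all_not_in_conv gt_ex lt_ex)
  qed
  then obtain b0 where b0: "b0 \<in> B" ..
  define M where "M = \<gamma> * a + 1"
  have M: "0 < M" using lipD(1)[OF f] a_pos by (simp add: M_def add_nonneg_pos)
  obtain n where "3 * M / \<epsilon> < real n" using reals_Archimedean2 by blast
  then obtain N where N: "3 * M / \<epsilon> < real (Suc N)" by (metis lessI less_trans of_nat_less_iff)
  define \<delta> where "\<delta> = M / Suc N"
  \<comment> \<open>The mesh accounts for less than \<open>\<epsilon> / 3\<close>. A loss of
    \<open>\<epsilon> / (3 * M)\<close> at each of the \<open>Suc N\<close> heights, weighted by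
    \<open>\<delta> = M / Suc N\<close>, adds another \<open>\<epsilon> / 3\<close>.\<close>
  have d: "0 < \<delta>" "3 * \<delta> < \<epsilon>" using N M e by (auto simp: \<delta>_def field_simps)
  have fM: "f x \<le> real (Suc N) * \<delta>" if "x \<in> X" for x
    using lipD(3)[OF f that] by (simp add: \<delta>_def M_def del: of_nat_Suc)
  let ?c = "cones \<gamma> f"
  have lc: "lip \<gamma> (?c S)" if "finite S" "S \<subseteq> B" for S
    using lip_cones_self[OF that(1) _ f] that B_sub by auto
  have "\<exists>S. finite S \<and> S \<subseteq> B \<and> m (level f t) < m (level (?c S) t) + \<epsilon> / (3 * M)" for t
  proof -
    let ?U = "{level (?c S) t |S. finite S \<and> S \<subseteq> B}"
    have dir: "directed_in {U. openin T U} (\<subseteq>) ?U"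
      unfolding directed_in_def
    proof (intro conjI ballI)
      show "?U \<subseteq> {U. openin T U}" using open_level[OF lc] by auto
      show "?U \<noteq> {}" by auto
      fix U V assume "U \<in> ?U" "V \<in> ?U"
      then obtain S S' where S: "finite S" "S \<subseteq> B" "finite S'" "S' \<subseteq> B" "U = level (?c S) t" "V = level (?c S') t" by auto
      have "level (?c S) t \<subseteq> level (?c (S \<union> S')) t" "level (?c S') t \<subseteq> level (?c (S \<union> S')) t"
        using S by (intro level_mono cones_mono; simp)+
      then have "U \<subseteq> level (?c (S \<union> S')) t" "V \<subseteq> level (?c (S \<union> S')) t" using S by simp_all
      moreover have "level (?c (S \<union> S')) t \<in> ?U" using S by (intro CollectI exI[of _ "S \<union> S'"]) auto
      ultimately show "\<exists>W\<in>?U. U \<subseteq> W \<and> V \<subseteq> W" by blast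
    qed
    have un: "\<Union>?U = level f t"
    proof safe
      fix x S assume "finite S" "S \<subseteq> B" "x \<in> level (?c S) t"
      then show "x \<in> level f t" using cones_self_le[of S \<gamma> f x] B_sub f unfolding level_def by force
    next
      fix x assume "x \<in> level f t"
      then obtain b where "b \<in> B" "t < f b - \<gamma> * dt b x" "x \<in> X" using cone_approx[OF f, of x t] by (auto simp: level_def)
      then have "x \<in> level (?c {b}) t" "finite {b}" "{b} \<subseteq> B" using cones_ge[of "{b}" b f \<gamma> x] by (auto simp: level_def)
      then show "x \<in> \<Union>?U" by blast
    qed
    have "0 < \<epsilon> / (3 * M)" using e M by simp
    from rvalD(5)[OF m dir this, unfolded un]
    have "\<exists>U\<in>?U. m (level f t) < m U + \<epsilon> / (3 * M)" .
    then show ?thesis by auto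
  qed
  then obtain S where S: "\<And>t. finite (S t)" "\<And>t. S t \<subseteq> B" "\<And>t. m (level f t) < m (level (?c (S t)) t) + \<epsilon> / (3 * M)"
    by metis
  define R where "R = insert b0 (\<Union>k<Suc N. S (real (Suc k) * \<delta>))"
  have R: "finite R" "R \<subseteq> B" using S b0 by (auto simp: R_def)
  have cR: "?c R x \<le> real (Suc N) * \<delta>" if "x \<in> X" for x
    using cones_self_le[OF R(1) subset_trans[OF R(2) B_sub] f that] fM[OF that] by linarith
  have "m (level f (real (Suc k) * \<delta>)) \<le> m (level (?c R) (real (Suc k) * \<delta>)) + \<epsilon> / (3 * M)" if "k < Suc N" for k
  proof -
    have "S (real (Suc k) * \<delta>) \<subseteq> R" using that by (auto simp: R_def)
    then have "m (level (?c (S (real (Suc k) * \<delta>))) (real (Suc k) * \<delta>)) \<le> m (level (?c R) (real (Suc k) * \<delta>))"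
      using R S by (intro rvalD(4)[OF m] open_level[OF lc] level_mono cones_mono) auto
    then show ?thesis using S(3)[of "real (Suc k) * \<delta>"] by linarith
  qed
  then have "(\<Sum>k<Suc N. m (level f (real (Suc k) * \<delta>))) \<le> (\<Sum>k<Suc N. m (level (?c R) (real (Suc k) * \<delta>)) + \<epsilon> / (3 * M))"
    by (intro sum_mono) auto
  also have "\<dots> = (\<Sum>k<Suc N. m (level (?c R) (real (Suc k) * \<delta>))) + real (Suc N) * (\<epsilon> / (3 * M))"
    unfolding sum.distrib by simp
  finally have "lows \<delta> (Suc N) m f \<le> \<delta> * ((\<Sum>k<Suc N. m (level (?c R) (real (Suc k) * \<delta>))) + real (Suc N) * (\<epsilon> / (3 * M)))"
    unfolding lows_def using d by (intro mult_left_mono) auto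
  also have "\<dots> = lows \<delta> (Suc N) m (?c R) + \<epsilon> / 3"
    using M by (simp add: lows_def \<delta>_def distrib_left del: of_nat_Suc sum.lessThan_Suc)
  finally have "lows \<delta> (Suc N) m f \<le> lows \<delta> (Suc N) m (?c R) + \<epsilon> / 3" .
  then have "rint m f \<le> rint m (?c R) + \<epsilon> / 3 + \<delta>"
    using rint_sandwich[OF m f fM d(1)] rint_sandwich[OF m lc[OF R] cR d(1)] by linarith
  then have "rint m f < rint m (?c R) + \<epsilon>" using d(2) e by linarith
  then show ?thesis using R by (intro exI[of _ R]) (auto simp: R_def)
qed

end

section \<open>Representation of functionals by valuations\<close>

lemma antitone_finite_choice:
  fixes Q :: "nat \<Rightarrow> 'b \<Rightarrow> bool"
  assumes "finite F" and ex: "\<And>k. \<exists>q\<in>F. Q k q" and anti: "\<And>k q. Q (Suc k) q \<Longrightarrow> Q k q"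
  shows "\<exists>q\<in>F. \<forall>k. Q k q"
proof (rule ccontr)
  assume "\<not> ?thesis"
  then obtain k where k: "\<And>q. q \<in> F \<Longrightarrow> \<not> Q (k q) q" by metis
  have anti': "Q i q" if "i \<le> j" "Q j q" for i j q
    using that by (induction j rule: dec_induct) (auto intro: anti)
  obtain q where "q \<in> F" "Q (Max (k ` F)) q" using ex by blast
  then show False using k anti'[of "k q" "Max (k ` F)" q] assms(1) by auto
qed

text \<open>Parents exist at every level, so chains of any finite length start at each level.
  Finiteness of the levels yields a node from which chains of all lengths start, and dependent
  choice prolongs it one step at a time.\<close>

lemma koenig:
  fixes A :: "nat \<Rightarrow> 'b set"
  assumes fin: "\<And>n. finite (A n)" and ne: "\<And>n. A n \<noteq> {}"
    and par: "\<And>n q. q \<in> A (Suc n) \<Longrightarrow> \<exists>p\<in>A n. P p q"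
  shows "\<exists>f. \<forall>n. f n \<in> A n \<and> P (f n) (f (Suc n))"
proof -
  \<comment> \<open>\<open>R k n p\<close> says that a chain of \<open>k\<close> further steps
    starts at \<open>p\<close> in level \<open>n\<close>.\<close>
  define R where "R = rec_nat (\<lambda>n p. p \<in> A n) (\<lambda>k Rk n p. p \<in> A n \<and> (\<exists>q. P p q \<and> Rk (Suc n) q))"
  have R0: "R 0 n p \<longleftrightarrow> p \<in> A n" and
    RS: "R (Suc k) n p \<longleftrightarrow> p \<in> A n \<and> (\<exists>q. P p q \<and> R k (Suc n) q)" for k n p
    by (simp_all add: R_def)
  have RA: "R k n p \<Longrightarrow> p \<in> A n" for k n p by (cases k) (auto simp: R0 RS)
  have ex: "\<exists>p\<in>A n. R k n p" for k n
  proof (induction k arbitrary: n)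
    case 0
    then show ?case using ne[of n] by (auto simp: R0)
  next
    case (Suc k)
    then obtain q where "R k (Suc n) q" "q \<in> A (Suc n)" by blast
    then show ?case using par by (metis RS)
  qed
  have anti: "R (Suc k) n p \<Longrightarrow> R k n p" for k n p
  proof (induction k arbitrary: n p)
    case 0
    then show ?case using RA R0 by blast
  next
    case (Suc k)
    then show ?case using RS by metis
  qed
  have "\<exists>f. \<forall>n. (\<forall>k. R k n (f n)) \<and> P (f n) (f (Suc n))"
  proof (rule dependent_nat_choice)
    show "\<exists>p. \<forall>k. R k 0 p" using antitone_finite_choice[OF fin[of 0], of "\<lambda>k. R k 0"] ex anti by blast
    fix p n assume p: "\<forall>k. R k n p"
    have "\<exists>q\<in>A (Suc n). \<forall>k. P p q \<and> R k (Suc n) q"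
    proof (rule antitone_finite_choice[OF fin])
      fix k
      show "\<exists>q\<in>A (Suc n). P p q \<and> R k (Suc n) q" using p[rule_format, of "Suc k"] RS RA by blast
    qed (use anti in blast)
    then show "\<exists>q. (\<forall>k. R k (Suc n) q) \<and> P p q" by blast
  qed
  then show ?thesis using RA by blast
qed

text \<open>What a limit of integrals is known to satisfy. \<open>J_cones\<close> is
  Scott-continuity on a fixed Lipschitz class, stated for every sufficiently large slope so that
  cones may be made steeper; \<open>J_layers\<close> stands in for \<open>J\<close> being an
  integral.\<close>

locale kr_functional = kr_space +
  fixes J :: "('a \<Rightarrow> real) \<Rightarrow> real"
  assumes J_mono: "lip \<gamma> f \<Longrightarrow> lip \<gamma>' g \<Longrightarrow> (\<And>x. x \<in> X \<Longrightarrow> f x \<le> g x) \<Longrightarrow> J f \<le> J g"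
    and J_max_min: "lip \<gamma> f \<Longrightarrow> lip \<gamma> g \<Longrightarrow>
      J (\<lambda>x. max (f x) (g x)) + J (\<lambda>x. min (f x) (g x)) = J f + J g"
    and J_cones: "lip \<gamma> f \<Longrightarrow> \<gamma> \<le> \<beta> \<Longrightarrow> 0 < \<epsilon> \<Longrightarrow>
      \<exists>S. finite S \<and> S \<subseteq> B \<and> J f < J (cones \<beta> f S) + \<epsilon>"
    and J_zero: "J (\<lambda>_. 0) = 0" and J_one: "J (\<lambda>_. 1) = 1"
    and J_layers: "lip \<gamma> f \<Longrightarrow> (\<And>x. x \<in> X \<Longrightarrow> f x \<le> real N * \<delta>) \<Longrightarrow> 0 < \<delta> \<Longrightarrow>
      \<bar>J f - \<delta> * (\<Sum>k<N. J (layer \<delta> f k))\<bar> \<le> \<delta>"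
begin

section \<open>The valuation induced by a functional\<close>

definition tests :: "'a set \<Rightarrow> ('a \<Rightarrow> real) set" where
  "tests U = {h. (\<exists>\<gamma>. lip \<gamma> h) \<and> (\<forall>x\<in>X. h x \<le> 1 \<and> (x \<notin> U \<longrightarrow> h x = 0))}"

definition nu :: "'a set \<Rightarrow> real" where
  "nu U = (SUP h\<in>tests U. J h)"

lemma lip_one: "lip (1 / a) (\<lambda>_. 1)"
  using a_pos by (intro lip_const) auto

lemma zero_tests: "(\<lambda>_. 0) \<in> tests U"
  using lip_const[of 0 0] by (auto simp: tests_def)

lemma J_nonneg: "lip \<gamma> f \<Longrightarrow> 0 \<le> J f"
  using J_mono[OF lip_const[of 0 0], of \<gamma> f] J_zero lipD(2) by auto

lemma tests_J: "h \<in> tests U \<Longrightarrow> 0 \<le> J h \<and> J h \<le> 1"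
  using J_mono[OF _ lip_one, of _ h] J_nonneg J_one by (auto simp: tests_def)

lemma nu_ge: "h \<in> tests U \<Longrightarrow> J h \<le> nu U"
  unfolding nu_def by (rule cSUP_upper) (use tests_J in \<open>auto intro!: bdd_aboveI2[of _ _ 1]\<close>)

lemma nu_le: "(\<And>h. h \<in> tests U \<Longrightarrow> J h \<le> c) \<Longrightarrow> nu U \<le> c"
  unfolding nu_def by (rule cSUP_least) (use zero_tests in auto)

lemma nu_approx:
  assumes e: "0 < \<epsilon>" shows "\<exists>h\<in>tests U. nu U < J h + \<epsilon>"
proof (rule ccontr)
  assume "\<not> ?thesis"
  then have "J h \<le> nu U - \<epsilon>" if "h \<in> tests U" for h using that by (force simp: not_less)
  then have "nu U \<le> nu U - \<epsilon>" by (rule nu_le)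
  with e show False by simp
qed

lemma nu_mono: "U \<subseteq> V \<Longrightarrow> nu U \<le> nu V"
  by (rule nu_le, rule nu_ge) (auto simp: tests_def)

text \<open>One level of the tree in the tightness argument. A cone at \<open>b\<close> with height
  \<open>f b\<close> and slope \<open>\<beta>\<close> vanishes outside the ball of radius
  \<open>f b / \<beta>\<close> around \<open>b\<close>; \<open>A\<close> records these supporting
  balls, which shrink as the slope grows because \<open>f \<le> 1\<close>.\<close>

lemma cones_refinement:
  assumes f: "lip \<gamma> f" and le: "\<And>x. x \<in> X \<Longrightarrow> f x \<le> 1" and e: "0 < \<epsilon>" and s: "0 < \<sigma>"
  shows "\<exists>\<beta> A f'. \<gamma> \<le> \<beta> \<and> \<alpha> < \<beta> \<and> 0 < \<beta> \<and> finite A \<and> lip \<beta> f' \<and> (\<forall>x\<in>X. f' x \<le> 1) \<and> J f < J f' + \<epsilon> \<and>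
    (\<forall>(b, s)\<in>A. b \<in> B \<and> 0 < s \<and> s \<le> \<sigma> \<and> f b = \<beta> * s) \<and>
    (\<forall>x\<in>X. 0 < f' x \<longrightarrow> (\<exists>(b, s)\<in>A. f' x \<le> \<beta> * (s - dt b x)))"
proof -
  \<comment> \<open>The three bounds serve in turn to keep \<open>f\<close> in
    \<open>lip \<beta>\<close>, to be strictly steeper than the previous stage of slope
    \<open>\<alpha>\<close>, and to force the radii below \<open>\<sigma>\<close>.\<close>
  define \<beta> where "\<beta> = max (max \<gamma> (\<alpha> + 1)) (1 / \<sigma>)"
  have b: "\<gamma> \<le> \<beta>" "\<alpha> < \<beta>" "1 / \<sigma> \<le> \<beta>" by (auto simp: \<beta>_def)
  have "0 < 1 / \<sigma>" using s by simp
  with b(3) have b0: "0 < \<beta>" by linarith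
  obtain S where S: "finite S" "S \<subseteq> B" "J f < J (cones \<beta> f S) + \<epsilon>" using J_cones[OF f b(1) e] by blast
  have SC: "S \<subseteq> C" using S(2) B_sub by simp
  note f\<beta> = lip_mono[OF f b(1)]
  let ?f = "cones \<beta> f S"
  define A where "A = (\<lambda>b. (b, f b / \<beta>)) ` {b \<in> S. 0 < f b}"
  have 1: "\<forall>x\<in>X. ?f x \<le> 1" using cones_self_le[OF S(1) SC f\<beta>] le by force
  have 2: "b \<in> B \<and> 0 < t \<and> t \<le> \<sigma> \<and> f b = \<beta> * t" if A: "(b, t) \<in> A" for b t
  proof -
    from A have bt: "b \<in> S" "0 < f b" "t = f b / \<beta>" by (auto simp: A_def)
    have "f b \<le> 1" using le S(2) B_X bt(1) by auto
    also have "1 \<le> \<beta> * \<sigma>" using b(3) s by (simp add: pos_divide_le_eq)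
    finally have "t \<le> \<sigma>" using b0 bt(3) by (simp add: pos_divide_le_eq mult.commute)
    moreover have "0 < t" "f b = \<beta> * t" using bt b0 by auto
    ultimately show ?thesis using bt(1) S(2) by auto
  qed
  have 3: "\<exists>(b, s)\<in>A. ?f x \<le> \<beta> * (s - dt b x)" if x: "x \<in> X" "0 < ?f x" for x
  proof (cases rule: cones_cases[OF S(1), of \<beta> f x])
    case (2 c)
    have "0 \<le> \<beta> * dt c x" using b0 dt_nonneg by simp
    then have "0 < f c" using 2 x by linarith
    then have "(c, f c / \<beta>) \<in> A" using 2 by (auto simp: A_def)
    moreover have "?f x \<le> \<beta> * (f c / \<beta> - dt c x)" using 2 b0 by (simp add: right_diff_distrib)
    ultimately show ?thesis by blast
  qed (use x in simp)
  have 2: "\<forall>(b, s)\<in>A. b \<in> B \<and> 0 < s \<and> s \<le> \<sigma> \<and> f b = \<beta> * s" using 2 by blast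
  have 3: "\<forall>x\<in>X. 0 < ?f x \<longrightarrow> (\<exists>(b, s)\<in>A. ?f x \<le> \<beta> * (s - dt b x))" using 3 by blast
  have 4: "finite A" using S(1) by (simp add: A_def)
  note 5 = lip_cones_self[OF S(1) SC f\<beta>]
  show ?thesis
    by (rule exI[of _ \<beta>], rule exI[of _ A], rule exI[of _ ?f], intro conjI) (fact b b0 S 1 2 3 4 5)+
qed

lemma nu_cover:
  assumes dir: "directed_in {U. openin T U} (\<subseteq>) \<U>" and h: "h \<in> tests (\<Union>\<U>)" and e: "0 < \<epsilon>"
  shows "\<exists>U\<in>\<U>. J h < nu U + \<epsilon>"
proof (rule ccontr)
  assume neg: "\<not> ?thesis"
  from h obtain \<gamma> where hl: "lip \<gamma> h" and h1: "\<And>x. x \<in> X \<Longrightarrow> h x \<le> 1" and h0: "\<And>x. x \<in> X \<Longrightarrow> x \<notin> \<Union>\<U> \<Longrightarrow> h x = 0"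
    unfolding tests_def by blast
  let ?ball = "\<lambda>b s. {y \<in> X. dt b y < s}"
  \<comment> \<open>A state holds the supporting balls, the slope and the current function. The
    total loss up to stage \<open>n\<close> stays below
    \<open>\<epsilon> * (1 - (1/2) ^ Suc n)\<close>, hence below \<open>\<epsilon>\<close> forever,
    while the radii are halved.\<close>
  define P where "P n st = (case st of (A, \<alpha>, f) \<Rightarrow> finite A \<and> lip \<alpha> f \<and> 0 < \<alpha> \<and> (\<forall>x\<in>X. f x \<le> 1) \<and>
      J h < J f + \<epsilon> * (1 - (1/2) ^ Suc n) \<and> (\<forall>(b, s)\<in>A. b \<in> B \<and> 0 < s \<and> s \<le> a * (1/2) ^ n) \<and>
      (\<forall>x\<in>X. 0 < f x \<longrightarrow> (\<exists>(b, s)\<in>A. f x \<le> \<alpha> * (s - dt b x))) \<and>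
      (n = 0 \<longrightarrow> (\<forall>(b, s)\<in>A. ?ball b s \<subseteq> \<Union>\<U>)))" for n and st :: "('a \<times> real) set \<times> real \<times> ('a \<Rightarrow> real)"
  \<comment> \<open>The strict inequality nests each new ball in an old one with room to spare, as
    \<open>ball_chain_limit\<close> requires.\<close>
  define Q where "Q n st st' \<longleftrightarrow> (\<forall>(b', s')\<in>fst st'. \<exists>(b, s)\<in>fst st. dt b b' < s - s')"
    for n :: nat and st st' :: "('a \<times> real) set \<times> real \<times> ('a \<Rightarrow> real)"
  have "\<exists>st. \<forall>n. P n (st n) \<and> Q n (st n) (st (Suc n))"
  proof (rule dependent_nat_choice)
    obtain \<beta> A f' where s: "\<gamma> \<le> \<beta>" "0 < \<beta>" "finite A" "lip \<beta> f'" "\<forall>x\<in>X. f' x \<le> 1" "J h < J f' + \<epsilon> / 2"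
      "\<forall>(b, s)\<in>A. b \<in> B \<and> 0 < s \<and> s \<le> a \<and> h b = \<beta> * s"
      "\<forall>x\<in>X. 0 < f' x \<longrightarrow> (\<exists>(b, s)\<in>A. f' x \<le> \<beta> * (s - dt b x))"
      using cones_refinement[OF hl h1, of "\<epsilon> / 2" a 0] e a_pos by auto
    \<comment> \<open>The height of the cone is \<open>h b = \<beta> * t\<close>. If
      \<open>h\<close> vanished at a point of this ball, its slope
      \<open>\<gamma> \<le> \<beta>\<close> would not suffice to reach that height at
      \<open>b\<close>.\<close>
    have "?ball b t \<subseteq> \<Union>\<U>" if "(b, t) \<in> A" for b t
    proof (rule subsetI, rule ccontr)
      fix y assume y: "y \<in> ?ball b t" "y \<notin> \<Union>\<U>"
      have bt: "b \<in> B" "h b = \<beta> * t" using s(7) that by auto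
      have "h b \<le> h y + \<gamma> * dt b y" using lipD(4)[OF hl B_X[OF bt(1)]] y by auto
      also have "\<dots> \<le> \<beta> * dt b y" using h0 y s(1) dt_nonneg[of b y] by (auto intro: mult_right_mono)
      also have "\<dots> < \<beta> * t" using y s(2) by auto
      finally show False using bt by simp
    qed
    then have "P 0 (A, \<beta>, f')" using s unfolding P_def by auto
    then show "\<exists>st. P 0 st" by blast
  next
    fix st n assume "P n st"
    then obtain A \<alpha> f where st: "st = (A, \<alpha>, f)" and p: "finite A" "lip \<alpha> f" "0 < \<alpha>" "\<And>x. x \<in> X \<Longrightarrow> f x \<le> 1"
      "J h < J f + \<epsilon> * (1 - (1/2) ^ Suc n)" "\<forall>x\<in>X. 0 < f x \<longrightarrow> (\<exists>(b, s)\<in>A. f x \<le> \<alpha> * (s - dt b x))"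
      unfolding P_def by (cases st) auto
    have "0 < \<epsilon> * (1/2) ^ Suc (Suc n)" "0 < a * (1/2) ^ Suc n" using e a_pos by auto
    from cones_refinement[OF p(2,4) this, of \<alpha>]
    obtain \<beta> A' f' where s: "\<alpha> < \<beta>" "0 < \<beta>" "finite A'" "lip \<beta> f'" "\<forall>x\<in>X. f' x \<le> 1"
      "J f < J f' + \<epsilon> * (1/2) ^ Suc (Suc n)"
      "\<forall>(b, s)\<in>A'. b \<in> B \<and> 0 < s \<and> s \<le> a * (1/2) ^ Suc n \<and> f b = \<beta> * s"
      "\<forall>x\<in>X. 0 < f' x \<longrightarrow> (\<exists>(b, s)\<in>A'. f' x \<le> \<beta> * (s - dt b x))"
      by blast
    have "J h < J f' + \<epsilon> * (1 - (1/2) ^ Suc (Suc n))"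
      using p(5) s(6) by (simp add: algebra_simps)
    then have P': "P (Suc n) (A', \<beta>, f')" using s unfolding P_def by auto
    \<comment> \<open>At the new center \<open>b'\<close> the old function has value
      \<open>\<beta> * s'\<close> and lies below one of its own cones, of slope
      \<open>\<alpha>\<close>. Since \<open>\<alpha> < \<beta>\<close>, the radius shrinks
      strictly.\<close>
    have "\<exists>(b, s)\<in>A. dt b b' < s - s'" if "(b', s') \<in> A'" for b' s'
    proof -
      have b': "b' \<in> B" "0 < s'" "f b' = \<beta> * s'" using s(7) that by auto
      then have "0 < f b'" using s(2) by simp
      then obtain b t where bt: "(b, t) \<in> A" "\<beta> * s' \<le> \<alpha> * (t - dt b b')" using p(6) B_X b' by fastforce
      have "0 < \<beta> * s'" using b' s(2) by simp
      then have pos: "0 < t - dt b b'" using bt(2) p(3) by (smt (verit) mult_nonneg_nonpos)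
      then have "\<alpha> * (t - dt b b') < \<beta> * (t - dt b b')" using s(1) by simp
      then have "\<beta> * s' < \<beta> * (t - dt b b')" using bt(2) by linarith
      then have "s' < t - dt b b'" using s(2) by simp
      then show ?thesis using bt(1) by (intro bexI[of _ "(b, t)"]) auto
    qed
    then have "Q n st (A', \<beta>, f')" unfolding Q_def st by auto
    with P' show "\<exists>st'. P (Suc n) st' \<and> Q n st st'" by blast
  qed
  then obtain st where st: "\<And>n. P n (st n)" "\<And>n. Q n (st n) (st (Suc n))" by blast
  define A where "A n = fst (st n)" for n
  \<comment> \<open>A ball is bad if no single member of the cover contains it.\<close>
  define Bad where "Bad n = {p \<in> A n. \<not> (\<exists>U\<in>\<U>. ?ball (fst p) (snd p) \<subseteq> U)}" for n
  have Afin: "finite (A n)" for n using st(1)[of n] unfolding P_def A_def by (auto split: prod.splits)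
  have AB: "b \<in> B \<and> 0 < s \<and> s \<le> a * (1/2) ^ n" if "(b, s) \<in> A n" for n b s
    using st(1)[of n] that unfolding P_def A_def by (auto split: prod.splits)
  have A0: "?ball b s \<subseteq> \<Union>\<U>" if "(b, s) \<in> A 0" for b s
    using st(1)[of 0] that unfolding P_def A_def by (auto split: prod.splits)
  have "Bad n \<noteq> {}" for n
  proof
    assume empty: "Bad n = {}"
    obtain \<alpha> f where eq: "st n = (A n, \<alpha>, f)" unfolding A_def by (metis prod.collapse)
    have f: "lip \<alpha> f" "0 < \<alpha>" "\<And>x. x \<in> X \<Longrightarrow> f x \<le> 1" "J h < J f + \<epsilon> * (1 - (1/2) ^ Suc n)"
      "\<And>x. x \<in> X \<Longrightarrow> 0 < f x \<Longrightarrow> \<exists>(b, s)\<in>A n. f x \<le> \<alpha> * (s - dt b x)"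
      using st(1)[of n] unfolding P_def eq by auto
    have "\<forall>p\<in>A n. \<exists>U\<in>\<U>. ?ball (fst p) (snd p) \<subseteq> U" using empty unfolding Bad_def by blast
    then obtain u where u: "\<And>p. p \<in> A n \<Longrightarrow> u p \<in> \<U> \<and> ?ball (fst p) (snd p) \<subseteq> u p" by metis
    obtain U where U: "U \<in> \<U>" "\<forall>V\<in>u ` A n. V \<subseteq> U"
    proof -
      have "u ` A n \<subseteq> \<U>" using u by blast
      from directed_finite_upper[OF dir _ _ _ this] Afin[of n] have "\<exists>U\<in>\<U>. \<forall>V\<in>u ` A n. V \<subseteq> U"
        by (metis finite_imageI order.trans order_refl)
      then show ?thesis using that by blast
    qed
    \<comment> \<open>Without bad balls, directedness gives one member \<open>U\<close> containing
      the whole support of the stage \<open>n\<close> function, whose value under \<open>J\<close>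
      then bounds \<open>nu U\<close> from below and contradicts \<open>neg\<close>.\<close>
    have "f \<in> tests U"
      unfolding tests_def
    proof (intro CollectI conjI ballI impI exI[of _ \<alpha>])
      fix x assume x: "x \<in> X" "x \<notin> U"
      show "f x = 0"
      proof (rule ccontr)
        assume "f x \<noteq> 0"
        then have fx: "0 < f x" using lipD(2)[OF f(1) x(1)] by simp
        then obtain b s where bs: "(b, s) \<in> A n" "f x \<le> \<alpha> * (s - dt b x)" using f(5)[OF x(1)] by auto
        then have "0 < s - dt b x" using fx f(2) by (smt (verit) mult_nonneg_nonpos)
        then have "x \<in> ?ball b s" using x by simp
        then show False using u[OF bs(1)] U(2) bs(1) x(2) by force
      qed
    qed (use f in auto)
    then have "J f \<le> nu U" by (rule nu_ge)
    moreover have "\<epsilon> * (1 - (1/2) ^ Suc n) \<le> \<epsilon>" using e by (simp add: algebra_simps)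
    ultimately show False using f(4) neg U(1) by force
  qed
  moreover have "finite (Bad n)" for n using Afin by (simp add: Bad_def)
  \<comment> \<open>A ball enclosing a bad ball is bad, so the bad balls form a tree in which every
    node has a parent.\<close>
  moreover have "\<exists>p\<in>Bad n. dt (fst p) (fst q) < snd p - snd q" if q: "q \<in> Bad (Suc n)" for n q
  proof -
    obtain b' s' where q': "q = (b', s')" by force
    then have qA: "(b', s') \<in> A (Suc n)" using q by (simp add: Bad_def)
    then obtain b s where bs: "(b, s) \<in> A n" "dt b b' < s - s'"
      using st(2)[of n] unfolding Q_def A_def by fastforce
    have "?ball b' s' \<subseteq> ?ball b s"
    proof safe
      fix y assume y: "y \<in> X" "dt b' y < s'"
      have "dt b y \<le> dt b b' + dt b' y" using AB[OF bs(1)] AB[OF qA] by (intro dt_triangle[OF B_X B_X y(1)]) auto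
      then show "dt b y < s" using bs(2) y by linarith
    qed
    then have "(b, s) \<in> Bad n" using q bs(1) unfolding Bad_def q' by (auto dest: subset_trans)
    then show ?thesis using bs(2) q' by (intro bexI[of _ "(b, s)"]) auto
  qed
  ultimately obtain c where c: "\<And>n. c n \<in> Bad n" "\<And>n. dt (fst (c n)) (fst (c (Suc n))) < snd (c n) - snd (c (Suc n))"
    using koenig[of Bad "\<lambda>p q. dt (fst p) (fst q) < snd p - snd q"] by blast
  have cA: "(fst (c n), snd (c n)) \<in> A n" for n using c(1)[of n] by (simp add: Bad_def)
  have lim: "(\<lambda>n. snd (c n)) \<longlonglongrightarrow> 0"
  proof (rule tendsto_sandwich[OF always_eventually always_eventually tendsto_const])
    show "(\<lambda>n. a * (1/2) ^ n) \<longlonglongrightarrow> (0::real)"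
      using tendsto_mult[OF tendsto_const[of a] LIMSEQ_power_zero[of "1/2::real"]] by simp
  qed (use AB[OF cA] in \<open>auto intro: less_imp_le\<close>)
  obtain x where x: "x \<in> X" "\<And>n. dt (fst (c n)) x \<le> snd (c n)"
    "\<And>U. openin T U \<Longrightarrow> x \<in> U \<Longrightarrow> \<exists>n. ?ball (fst (c n)) (snd (c n)) \<subseteq> U"
    using ball_chain_limit[of "\<lambda>n. fst (c n)" "\<lambda>n. snd (c n)", OF _ c(2) lim] AB[OF cA] AB[OF cA, of 0] by auto
  \<comment> \<open>The strict first step places the limit point inside the first ball and so in the
    union. Some later ball then lies in one member of the cover, although it is bad.\<close>
  have "dt (fst (c 0)) x \<le> dt (fst (c 0)) (fst (c 1)) + dt (fst (c 1)) x"
    using AB[OF cA] by (intro dt_triangle[OF B_X B_X x(1)]) auto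
  also have "\<dots> < snd (c 0)" using c(2)[of 0] x(2)[of 1] by simp
  finally have "x \<in> \<Union>\<U>" using A0[OF cA] x(1) by blast
  then obtain U where U: "U \<in> \<U>" "x \<in> U" by blast
  then have "openin T U" using dir unfolding directed_in_def by blast
  then obtain n where "?ball (fst (c n)) (snd (c n)) \<subseteq> U" using x(3) U(2) by blast
  then show False using c(1)[of n] U(1) unfolding Bad_def by blast
qed

lemma nu_cont:
  assumes dir: "directed_in {U. openin T U} (\<subseteq>) \<U>" and e: "0 < \<epsilon>"
  shows "\<exists>U\<in>\<U>. nu (\<Union>\<U>) < nu U + \<epsilon>"
proof -
  obtain h where h: "h \<in> tests (\<Union>\<U>)" "nu (\<Union>\<U>) < J h + \<epsilon> / 2" using nu_approx[of "\<epsilon>/2"] e by auto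
  obtain U where "U \<in> \<U>" "J h < nu U + \<epsilon> / 2" using nu_cover[OF dir h(1), of "\<epsilon>/2"] e by auto
  then show ?thesis using h(2) by (intro bexI[of _ U]) auto
qed

text \<open>Together with \<open>tests_le_layer\<close> this squeezes
  \<open>J (layer \<delta> f k)\<close> between the \<open>nu\<close>-masses of consecutive level
  sets, the hypothesis of \<open>rint_layers\<close>.\<close>

lemma layer_tests:
  assumes "lip \<gamma> f" "0 < \<delta>" shows "layer \<delta> f k \<in> tests (level f (real k * \<delta>))"
  using lip_layer'[OF assms, of k] layer_bounds(2) layer_bounds(4)[of f _ k \<delta>]
  by (auto simp: tests_def level_def not_less)

lemma tests_le_layer:
  assumes f: "lip \<gamma> f" and d: "0 < \<delta>" and h: "h \<in> tests (level f t)" and t: "real (Suc k) * \<delta> \<le> t"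
  shows "J h \<le> J (layer \<delta> f k)"
proof -
  from h obtain \<gamma>' where hl: "lip \<gamma>' h" "\<And>x. x \<in> X \<Longrightarrow> h x \<le> 1" "\<And>x. x \<in> X \<Longrightarrow> x \<notin> level f t \<Longrightarrow> h x = 0"
    by (auto simp: tests_def)
  show ?thesis
  proof (rule J_mono[OF hl(1) lip_layer'[OF f d]])
    fix x assume x: "x \<in> X"
    show "h x \<le> layer \<delta> f k x"
    proof (cases "t < f x")
      case True
      then have "real (Suc k) * \<delta> < f x" using t by linarith
      then show ?thesis using layer_bounds(3)[OF d, of k f x] hl(2)[OF x] by linarith
    next
      case False
      then show ?thesis using hl(3)[OF x] layer_bounds(1)[OF d] x by (simp add: level_def)
    qed
  qed
qed

text \<open>By \<open>nu_cont\<close> the masses of the sets \<open>level f (1 / Suc n)\<close>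
  increase to that of \<open>level f 0\<close>, and the lowest slices are squeezed in between. Thus
  \<open>nu\<close> of a positivity set becomes a limit of values of \<open>J\<close>.\<close>

lemma nu_level_LIMSEQ:
  assumes f: "lip \<gamma> f"
  shows "(\<lambda>n. J (layer (1 / Suc n) f 0)) \<longlonglongrightarrow> nu (level f 0)"
proof (rule LIMSEQ_I)
  fix \<epsilon> :: real assume e: "0 < \<epsilon>"
  let ?U = "range (\<lambda>n. level f (1 / Suc n))"
  have lev: "level f (1 / Suc n) \<subseteq> level f (1 / Suc N)" if "n \<le> N" for n N
    using that by (intro level_mono) (auto simp: frac_le)
  have dir: "directed_in {U. openin T U} (\<subseteq>) ?U"
    unfolding directed_in_def
  proof (intro conjI ballI)
    show "?U \<subseteq> {U. openin T U}" using open_level[OF f] by auto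
    fix U V assume "U \<in> ?U" "V \<in> ?U"
    then obtain n n' where "U = level f (1 / Suc n)" "V = level f (1 / Suc n')" by auto
    then have "U \<subseteq> level f (1 / Suc (max n n'))" "V \<subseteq> level f (1 / Suc (max n n'))"
      using lev[of n "max n n'"] lev[of n' "max n n'"] by auto
    then show "\<exists>W\<in>?U. U \<subseteq> W \<and> V \<subseteq> W" by blast
  qed simp
  have "\<Union>?U = level f 0"
  proof safe
    fix x n assume "x \<in> level f (1 / Suc n)"
    moreover have "0 < 1 / real (Suc n)" by simp
    ultimately show "x \<in> level f 0" unfolding level_def mem_Collect_eq by linarith
  next
    fix x assume x: "x \<in> level f 0"
    then obtain n where "1 / real (Suc n) < f x" using nat_approx_posE[of "f x"] by (auto simp: level_def)
    then show "x \<in> \<Union>?U" using x by (auto simp: level_def)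
  qed
  then obtain n where n: "nu (level f 0) < nu (level f (1 / Suc n)) + \<epsilon>" using nu_cont[OF dir e] by auto
  show "\<exists>no. \<forall>N\<ge>no. norm (J (layer (1 / Suc N) f 0) - nu (level f 0)) < \<epsilon>"
  proof (intro exI[of _ n] allI impI)
    fix N assume N: "n \<le> N"
    have "nu (level f (1 / Suc n)) \<le> J (layer (1 / Suc N) f 0)"
      by (rule nu_le, rule tests_le_layer[OF f]) (use N in \<open>auto simp: frac_le\<close>)
    moreover have "J (layer (1 / Suc N) f 0) \<le> nu (level f 0)"
      using nu_ge[OF layer_tests[OF f, of "1 / Suc N" 0]] by simp
    ultimately show "norm (J (layer (1 / Suc N) f 0) - nu (level f 0)) < \<epsilon>" using n by auto
  qed
qed

section \<open>Modularity, from positivity sets to all open sets\<close>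

lemma layer_max_min:
  assumes "0 < \<delta>"
  shows "layer \<delta> (\<lambda>x. max (f x) (g x)) k = (\<lambda>x. max (layer \<delta> f k x) (layer \<delta> g k x))"
    "layer \<delta> (\<lambda>x. min (f x) (g x)) k = (\<lambda>x. min (layer \<delta> f k x) (layer \<delta> g k x))"
proof -
  have "mono (\<lambda>t. min 1 (max 0 (t - real k * \<delta>) / \<delta>))"
    using assms by (intro monoI min.mono divide_right_mono max.mono) auto
  from max_of_mono[OF this] min_of_mono[OF this]
  show "layer \<delta> (\<lambda>x. max (f x) (g x)) k = (\<lambda>x. max (layer \<delta> f k x) (layer \<delta> g k x))"
    "layer \<delta> (\<lambda>x. min (f x) (g x)) k = (\<lambda>x. min (layer \<delta> f k x) (layer \<delta> g k x))"
    by (simp_all add: layer_def)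
qed

text \<open>Slicing commutes with maxima and minima, so \<open>J_max_min\<close> holds for the
  slices and passes to the limit.\<close>

lemma nu_modular_level:
  assumes f: "lip \<gamma> f" and g: "lip \<gamma> g"
  shows "nu (level f 0 \<union> level g 0) + nu (level f 0 \<inter> level g 0) = nu (level f 0) + nu (level g 0)"
proof -
  note 1 = tendsto_add[OF nu_level_LIMSEQ[OF f] nu_level_LIMSEQ[OF g]]
  note 2 = tendsto_add[OF nu_level_LIMSEQ[OF lip_max[OF f g]] nu_level_LIMSEQ[OF lip_min[OF f g]]]
  have "J (layer (1 / Suc n) (\<lambda>x. max (f x) (g x)) 0) + J (layer (1 / Suc n) (\<lambda>x. min (f x) (g x)) 0)
      = J (layer (1 / Suc n) f 0) + J (layer (1 / Suc n) g 0)" for n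
  proof -
    have d: "0 < 1 / real (Suc n)" by simp
    show ?thesis unfolding layer_max_min[OF d]
      by (rule J_max_min[OF lip_layer'[OF f d] lip_layer'[OF g d]])
  qed
  from LIMSEQ_unique[OF 2[unfolded this] 1] show ?thesis by (simp add: level_max level_min)
qed

text \<open>Open sets inside \<open>U\<close> on which modularity is already available; closed under
  finite unions, they exhaust \<open>U\<close> in a directed way.\<close>

definition pos_sets :: "'a set \<Rightarrow> 'a set set" where
  "pos_sets U = {level g 0 |g. (\<exists>\<gamma>. lip \<gamma> g) \<and> level g 0 \<subseteq> U}"

lemma pos_sets_Un:
  assumes "P \<in> pos_sets U" "P' \<in> pos_sets U" shows "P \<union> P' \<in> pos_sets U"
proof -
  obtain f g \<gamma> \<gamma>' where *: "P = level f 0" "P' = level g 0" "lip \<gamma> f" "lip \<gamma>' g" "P \<subseteq> U" "P' \<subseteq> U"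
    using assms unfolding pos_sets_def by auto
  have "lip (max \<gamma> \<gamma>') (\<lambda>x. max (f x) (g x))"
    by (rule lip_max[OF lip_mono[OF *(3)] lip_mono[OF *(4)]]) auto
  moreover have "P \<union> P' = level (\<lambda>x. max (f x) (g x)) 0" unfolding level_max * ..
  ultimately show ?thesis unfolding pos_sets_def using *(5,6) by (intro CollectI exI[of _ "\<lambda>x. max (f x) (g x)"]) auto
qed

lemma pos_sets_open: "P \<in> pos_sets U \<Longrightarrow> openin T P"
  unfolding pos_sets_def using open_level by auto

lemma pos_sets_modular:
  assumes "P \<in> pos_sets U" "Q \<in> pos_sets V"
  shows "nu (P \<union> Q) + nu (P \<inter> Q) = nu P + nu Q"
proof -
  obtain f g \<gamma> \<gamma>' where *: "P = level f 0" "Q = level g 0" "lip \<gamma> f" "lip \<gamma>' g"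
    using assms unfolding pos_sets_def by auto
  show ?thesis unfolding *(1,2)
    by (rule nu_modular_level[of "max \<gamma> \<gamma>'", OF lip_mono[OF *(3)] lip_mono[OF *(4)]]) auto
qed

text \<open>A basic ball of radius \<open>\<rho>\<close> is the positivity set of the cone of height
  \<open>\<rho>\<close> and slope 1; \<open>\<rho> \<le> a\<close> makes that cone
  admissible.\<close>

lemma Union_pos_sets:
  assumes U: "openin T U" shows "\<Union>(pos_sets U) = U"
proof safe
  fix x assume x: "x \<in> U"
  obtain b \<rho> where b: "b \<in> B" "0 < \<rho>" "\<rho> \<le> a" "dt b x < \<rho>" "{y \<in> X. dt b y < \<rho>} \<subseteq> U" "x \<in> X"
    using U x unfolding open_iff by blast
  have "lip 1 (cones 1 (\<lambda>_. \<rho>) {b})" using b B_sub by (intro lip_cones) auto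
  moreover have "level (cones 1 (\<lambda>_. \<rho>) {b}) 0 = {y \<in> X. dt b y < \<rho>}"
    by (auto simp: level_def cones_insert) (simp add: cones_def)
  ultimately have "{y \<in> X. dt b y < \<rho>} \<in> pos_sets U" unfolding pos_sets_def using b by auto
  then show "x \<in> \<Union>(pos_sets U)" using b by blast
qed (auto simp: pos_sets_def)

text \<open>The operation \<open>c\<close> will be union, intersection and the two projections, so
  that one argument treats all four terms of the modular law. Monotonicity and closure of
  \<open>pos_sets\<close> under unions make the sets \<open>c P Q\<close> directed.\<close>

lemma nu_approx_pair:
  assumes op: "\<And>P Q. openin T P \<Longrightarrow> openin T Q \<Longrightarrow> openin T (c P Q)"
    and mono: "\<And>P P' Q Q'. P \<subseteq> P' \<Longrightarrow> Q \<subseteq> Q' \<Longrightarrow> c P Q \<subseteq> c P' Q'"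
    and sub: "\<And>P Q. P \<subseteq> U \<Longrightarrow> Q \<subseteq> V \<Longrightarrow> c P Q \<subseteq> W"
    and cover: "\<And>x. x \<in> W \<Longrightarrow> \<exists>P\<in>pos_sets U. \<exists>Q\<in>pos_sets V. x \<in> c P Q" and e: "0 < \<epsilon>"
  shows "\<exists>P\<in>pos_sets U. \<exists>Q\<in>pos_sets V. nu W < nu (c P Q) + \<epsilon>"
proof -
  let ?W = "{c P Q |P Q. P \<in> pos_sets U \<and> Q \<in> pos_sets V}"
  have ne: "{} \<in> pos_sets U" for U
  proof -
    have "level (\<lambda>_. 0) 0 = {}" by (auto simp: level_def)
    then show ?thesis unfolding pos_sets_def using lip_const[of 0 0] by auto
  qed
  have dir: "directed_in {U. openin T U} (\<subseteq>) ?W"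
    unfolding directed_in_def
  proof (intro conjI ballI)
    show "?W \<subseteq> {U. openin T U}" using op pos_sets_open by auto
    show "?W \<noteq> {}" using ne by auto
    fix Y Z assume "Y \<in> ?W" "Z \<in> ?W"
    then obtain P Q P' Q' where *: "Y = c P Q" "Z = c P' Q'" "P \<in> pos_sets U" "Q \<in> pos_sets V" "P' \<in> pos_sets U" "Q' \<in> pos_sets V"
      by blast
    have "c (P \<union> P') (Q \<union> Q') \<in> ?W" using *(3-6) pos_sets_Un by blast
    moreover have "Y \<subseteq> c (P \<union> P') (Q \<union> Q')" "Z \<subseteq> c (P \<union> P') (Q \<union> Q')" unfolding * by (intro mono; simp)+
    ultimately show "\<exists>W\<in>?W. Y \<subseteq> W \<and> Z \<subseteq> W" by blast
  qed
  have "P \<subseteq> U" if "P \<in> pos_sets U" for P U using that by (auto simp: pos_sets_def)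
  then have "\<Union>?W \<subseteq> W" using sub by blast
  moreover have "W \<subseteq> \<Union>?W" using cover by blast
  ultimately have "\<Union>?W = W" by (rule subset_antisym)
  then show ?thesis using nu_cont[OF dir e] by auto
qed

lemma nu_modular:
  assumes U: "openin T U" and V: "openin T V"
  shows "nu (U \<union> V) + nu (U \<inter> V) = nu U + nu V"
proof -
  have *: "\<bar>nu (U \<union> V) + nu (U \<inter> V) - (nu U + nu V)\<bar> \<le> 0 + \<epsilon>" if e: "0 < \<epsilon>" for \<epsilon>
  proof -
    have e2: "0 < \<epsilon> / 2" using e by simp
    have "level (\<lambda>_. 0) 0 = {}" by (auto simp: level_def)
    then have ne: "{} \<in> pos_sets W" for W
      using lip_const[of 0 0] unfolding pos_sets_def by (intro CollectI exI[of _ "\<lambda>_. 0"]) auto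
    have cU: "\<exists>P\<in>pos_sets U. x \<in> P" if "x \<in> U" for x using that Union_pos_sets[OF U] by blast
    have cV: "\<exists>P\<in>pos_sets V. x \<in> P" if "x \<in> V" for x using that Union_pos_sets[OF V] by blast
    have "\<exists>P\<in>pos_sets U. \<exists>Q\<in>pos_sets V. nu (U \<union> V) < nu (P \<union> Q) + \<epsilon> / 2"
    proof (rule nu_approx_pair[of "\<lambda>P Q. P \<union> Q" U V "U \<union> V", OF _ _ _ _ e2])
      fix x assume "x \<in> U \<union> V"
      then show "\<exists>P\<in>pos_sets U. \<exists>Q\<in>pos_sets V. x \<in> P \<union> Q" using cU[of x] cV[of x] ne[of U] ne[of V] by fastforce
    qed (assumption | rule openin_Un Un_mono)+
    then obtain P1 where P1: "P1 \<in> pos_sets U" "\<exists>Q\<in>pos_sets V. nu (U \<union> V) < nu (P1 \<union> Q) + \<epsilon> / 2" ..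
    from P1(2) obtain Q1 where Q1: "Q1 \<in> pos_sets V" "nu (U \<union> V) < nu (P1 \<union> Q1) + \<epsilon> / 2" ..
    have "\<exists>P\<in>pos_sets U. \<exists>Q\<in>pos_sets V. nu (U \<inter> V) < nu (P \<inter> Q) + \<epsilon> / 2"
    proof (rule nu_approx_pair[of "\<lambda>P Q. P \<inter> Q" U V "U \<inter> V", OF _ _ _ _ e2])
      fix x assume "x \<in> U \<inter> V"
      then show "\<exists>P\<in>pos_sets U. \<exists>Q\<in>pos_sets V. x \<in> P \<inter> Q" using cU[of x] cV[of x] by simp
    qed (assumption | rule openin_Int Int_mono)+
    then obtain P2 where P2: "P2 \<in> pos_sets U" "\<exists>Q\<in>pos_sets V. nu (U \<inter> V) < nu (P2 \<inter> Q) + \<epsilon> / 2" ..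
    from P2(2) obtain Q2 where Q2: "Q2 \<in> pos_sets V" "nu (U \<inter> V) < nu (P2 \<inter> Q2) + \<epsilon> / 2" ..
    have "\<exists>P\<in>pos_sets U. \<exists>Q\<in>pos_sets V. nu U < nu P + \<epsilon> / 2"
    proof (rule nu_approx_pair[of "\<lambda>P Q. P" U V "U", OF _ _ _ _ e2])
      fix x assume "x \<in> U"
      then show "\<exists>P\<in>pos_sets U. \<exists>Q\<in>pos_sets V. x \<in> P" using cU[of x] ne[of V] by auto
    qed
    then obtain P3 where 3: "P3 \<in> pos_sets U" "nu U < nu P3 + \<epsilon> / 2" by meson
    have "\<exists>P\<in>pos_sets U. \<exists>Q\<in>pos_sets V. nu V < nu Q + \<epsilon> / 2"
    proof (rule nu_approx_pair[of "\<lambda>P Q. Q" U V "V", OF _ _ _ _ e2])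
      fix x assume "x \<in> V"
      then show "\<exists>P\<in>pos_sets U. \<exists>Q\<in>pos_sets V. x \<in> Q" using cV[of x] ne[of U] by auto
    qed
    then obtain Q4 where 4: "Q4 \<in> pos_sets V" "nu V < nu Q4 + \<epsilon> / 2" by meson
    \<comment> \<open>Enlarging to common \<open>P\<close> and \<open>Q\<close> keeps all four
      approximations, because \<open>nu\<close> is monotone. Each direction of the estimate uses two
      of the errors \<open>\<epsilon> / 2\<close>.\<close>
    define P Q where "P = P1 \<union> (P2 \<union> P3)" and "Q = Q1 \<union> (Q2 \<union> Q4)"
    have P: "P \<in> pos_sets U" "Q \<in> pos_sets V" unfolding P_def Q_def by (intro pos_sets_Un P1(1) Q1(1) P2(1) Q2(1) 3(1) 4(1))+
    have PU: "P \<subseteq> U" "Q \<subseteq> V" using P by (auto simp: pos_sets_def)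
    have "nu (P1 \<union> Q1) \<le> nu (P \<union> Q)" "nu (P2 \<inter> Q2) \<le> nu (P \<inter> Q)" "nu P3 \<le> nu P" "nu Q4 \<le> nu Q"
      "nu (P \<union> Q) \<le> nu (U \<union> V)" "nu (P \<inter> Q) \<le> nu (U \<inter> V)" "nu P \<le> nu U" "nu Q \<le> nu V"
      by (rule nu_mono; use PU in \<open>auto simp: P_def Q_def\<close>)+
    then show ?thesis unfolding add_0 using pos_sets_modular[OF P] Q1(2) Q2(2) 3(2) 4(2) by linarith
  qed
  have "\<bar>nu (U \<union> V) + nu (U \<inter> V) - (nu U + nu V)\<bar> \<le> 0" by (rule field_le_epsilon) (rule *)
  then show ?thesis by simp
qed

theorem rval_nu: "rval nu"
  unfolding rval_def
proof (intro conjI allI impI)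
  show "nu {} = 0"
  proof (rule antisym)
    show "nu {} \<le> 0"
    proof (rule nu_le)
      fix h assume "h \<in> tests {}"
      then obtain \<gamma> where "lip \<gamma> h" "\<And>x. x \<in> X \<Longrightarrow> h x \<le> 0" by (auto simp: tests_def)
      then show "J h \<le> 0" using J_mono[OF _ lip_const[of 0 0], of \<gamma> h] J_zero by auto
    qed
    show "0 \<le> nu {}" using nu_ge[OF zero_tests] J_zero by simp
  qed
  show "nu X = 1"
  proof (rule antisym)
    show "nu X \<le> 1" by (rule nu_le) (use tests_J in auto)
    show "1 \<le> nu X" using nu_ge[of "\<lambda>_. 1" X] J_one lip_one by (auto simp: tests_def)
  qed
next
  fix U V assume "openin T U \<and> openin T V"
  then show "nu (U \<union> V) + nu (U \<inter> V) = nu U + nu V" using nu_modular by blast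
next
  fix U V assume "openin T U \<and> openin T V \<and> U \<subseteq> V"
  then show "nu U \<le> nu V" using nu_mono by blast
next
  fix \<U> and \<epsilon> :: real assume "directed_in {U. openin T U} (\<subseteq>) \<U> \<and> 0 < \<epsilon>"
  then show "\<exists>U\<in>\<U>. nu (\<Union>\<U>) < nu U + \<epsilon>" using nu_cont by blast
qed

text \<open>Both numbers are within the mesh of the same Riemann sum of values of \<open>J\<close>
  on slices, one by \<open>rint_layers\<close>, the other by \<open>J_layers\<close>; the mesh tends
  to 0.\<close>

theorem rint_nu:
  assumes f: "lip \<gamma> f" shows "rint nu f = J f"
proof -
  define M where "M = \<gamma> * a + 1"
  have M: "0 < M" using lipD(1)[OF f] a_pos by (simp add: M_def add_nonneg_pos)
  have b: "f x \<le> M" if "x \<in> X" for x using lipD(3)[OF f that] by (simp add: M_def)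
  have *: "\<bar>rint nu f - J f\<bar> \<le> 0 + (2 * M) / real (Suc n)" for n
  proof -
    let ?d = "M / Suc n"
    have d: "0 < ?d" using M by simp
    have le: "f x \<le> real (Suc n) * ?d" if "x \<in> X" for x using b[OF that] by (simp del: of_nat_Suc)
    have "\<bar>rint nu f - ?d * (\<Sum>k<Suc n. J (layer ?d f k))\<bar> \<le> ?d"
    proof (rule rint_layers[OF rval_nu f le d])
      fix k
      show "nu (level f (real (Suc k) * ?d)) \<le> J (layer ?d f k)"
        by (rule nu_le, rule tests_le_layer[OF f d]) auto
      show "J (layer ?d f k) \<le> nu (level f (real k * ?d))"
        by (rule nu_ge, rule layer_tests[OF f d])
    qed
    moreover have "\<bar>J f - ?d * (\<Sum>k<Suc n. J (layer ?d f k))\<bar> \<le> ?d" by (rule J_layers[OF f le d])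
    ultimately have "\<bar>rint nu f - J f\<bar> \<le> ?d + ?d" by linarith
    then show ?thesis by (simp add: add_divide_distrib[symmetric])
  qed
  from Sup_approx_nat[OF *] show ?thesis by simp
qed

end

section \<open>Simple valuations\<close>

text \<open>\<open>s N\<close> rounds \<open>v\<close> down to the grid of mesh
  \<open>\<delta>\<close>, by counting the positive grid points strictly below
  \<open>v\<close>.\<close>

lemma staircase_bounds:
  fixes v \<delta> :: real
  assumes "0 < \<delta>" "0 \<le> v" "v \<le> real N * \<delta>"
  defines "s n \<equiv> \<delta> * (\<Sum>k<n. if real (Suc k) * \<delta> < v then 1 else 0)"
  shows "s N \<le> v" "v \<le> s N + \<delta>"
proof -
  \<comment> \<open>Either every grid point so far has been counted, or one has failed and
    \<open>s n\<close> is already within \<open>\<delta>\<close> of \<open>v\<close>.\<close>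
  have "s n \<le> v \<and> s n \<le> real n * \<delta> \<and> (v \<le> s n + \<delta> \<or> s n = real n * \<delta>)" for n
  proof (induction n)
    case 0
    then show ?case using assms(2) by (simp add: s_def)
  next
    case (Suc n)
    have step: "s (Suc n) = s n + (if real (Suc n) * \<delta> < v then \<delta> else 0)"
      by (simp add: s_def distrib_left)
    have d: "real (Suc n) * \<delta> = real n * \<delta> + \<delta>" by (simp add: algebra_simps)
    show ?case using Suc d assms(1) unfolding step by auto
  qed
  then show "s N \<le> v" "v \<le> s N + \<delta>" using assms(1,3) by (smt (verit, best))+
qed

context kr_space begin

text \<open>Simple valuations with distinct atoms, each carrying its whole weight;
  \<open>simple_normalized_eq\<close> relates them to indexed sums with possible
  repetitions.\<close>

definition smp :: "'a set \<Rightarrow> ('a \<Rightarrow> real) \<Rightarrow> 'a set \<Rightarrow> real" where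
  "smp Z w U = sum w (Z \<inter> U)"

definition wsum :: "'a set \<Rightarrow> ('a \<Rightarrow> real) \<Rightarrow> ('a \<Rightarrow> real) \<Rightarrow> real" where
  "wsum Z w f = (\<Sum>z\<in>Z. w z * f z)"

definition prob_weights :: "'a set \<Rightarrow> ('a \<Rightarrow> real) \<Rightarrow> bool" where
  "prob_weights Z w \<longleftrightarrow> finite Z \<and> Z \<subseteq> X \<and> (\<forall>z\<in>Z. 0 \<le> w z) \<and> sum w Z = 1"

lemma wsum_mono:
  assumes "prob_weights Z w" "\<And>z. z \<in> Z \<Longrightarrow> f z \<le> g z + c"
  shows "wsum Z w f \<le> wsum Z w g + c"
proof -
  have "wsum Z w f \<le> (\<Sum>z\<in>Z. w z * g z + w z * c)"
    unfolding wsum_def using assms by (intro sum_mono) (auto simp: prob_weights_def simp flip: distrib_left intro: mult_left_mono)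
  also have "\<dots> = wsum Z w g + c"
    using assms(1) by (simp add: wsum_def sum.distrib prob_weights_def flip: sum_distrib_right)
  finally show ?thesis .
qed

lemma rval_smp:
  assumes "prob_weights Z w" shows "rval (smp Z w)"
  unfolding rval_def
proof (intro conjI allI impI)
  note p = assms[unfolded prob_weights_def]
  have fin: "finite (Z \<inter> U)" for U using p by simp
  have mono: "smp Z w U \<le> smp Z w V" if "Z \<inter> U \<subseteq> V" for U V
    unfolding smp_def using p that by (intro sum_mono2) auto
  show "smp Z w {} = 0" by (simp add: smp_def)
  show "smp Z w X = 1" using p by (simp add: smp_def Int_absorb2)
  fix U V
  have "sum w (Z \<inter> U \<union> Z \<inter> V) + sum w (Z \<inter> U \<inter> (Z \<inter> V)) = sum w (Z \<inter> U) + sum w (Z \<inter> V)"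
    by (rule sum.union_inter[OF fin fin])
  moreover have "Z \<inter> U \<union> Z \<inter> V = Z \<inter> (U \<union> V)" "Z \<inter> U \<inter> (Z \<inter> V) = Z \<inter> (U \<inter> V)" by auto
  ultimately show "smp Z w (U \<union> V) + smp Z w (U \<inter> V) = smp Z w U + smp Z w V" by (simp add: smp_def)
  show "smp Z w U \<le> smp Z w V" if "openin T U \<and> openin T V \<and> U \<subseteq> V" using that by (intro mono) auto
next
  note p = assms[unfolded prob_weights_def]
  fix \<U> and \<epsilon> :: real assume d: "directed_in {U. openin T U} (\<subseteq>) \<U> \<and> 0 < \<epsilon>"
  have "\<forall>z\<in>Z \<inter> \<Union>\<U>. \<exists>U\<in>\<U>. z \<in> U" by blast
  then obtain u where u: "\<And>z. z \<in> Z \<inter> \<Union>\<U> \<Longrightarrow> u z \<in> \<U> \<and> z \<in> u z" by metis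
  have "u ` (Z \<inter> \<Union>\<U>) \<subseteq> \<U>" using u by blast
  moreover have "finite (u ` (Z \<inter> \<Union>\<U>))" using p by simp
  ultimately obtain U where U: "U \<in> \<U>" "\<forall>V\<in>u ` (Z \<inter> \<Union>\<U>). V \<subseteq> U"
    using directed_finite_upper[OF conjunct1[OF d]] by (metis order.trans order_refl)
  then have "Z \<inter> \<Union>\<U> = Z \<inter> U" using u by blast
  then show "\<exists>U\<in>\<U>. smp Z w (\<Union>\<U>) < smp Z w U + \<epsilon>" using U(1) d by (intro bexI[of _ U]) (auto simp: smp_def)
qed

text \<open>Exchanging the two finite sums turns the lower Riemann sum into the weighted mean of
  \<open>f\<close> rounded down to the grid.\<close>

lemma lows_smp:
  assumes p: "prob_weights Z w" and f: "\<And>x. x \<in> X \<Longrightarrow> 0 \<le> f x" "\<And>x. x \<in> X \<Longrightarrow> f x \<le> real N * \<delta>" and d: "0 < \<delta>"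
  shows "lows \<delta> N (smp Z w) f \<le> wsum Z w f" "wsum Z w f \<le> lows \<delta> N (smp Z w) f + \<delta>"
proof -
  note p' = p[unfolded prob_weights_def]
  define s where "s v = \<delta> * (\<Sum>k<N. if real (Suc k) * \<delta> < v then 1 else 0)" for v
  have "smp Z w (level f t) = (\<Sum>z\<in>Z. w z * (if t < f z then 1 else 0))" for t
  proof -
    have "Z \<inter> level f t = {z \<in> Z. t < f z}" using p' by (auto simp: level_def)
    then show ?thesis using p' by (simp add: smp_def sum.inter_filter if_distrib[of "(*) _"] cong: if_cong)
  qed
  then have "lows \<delta> N (smp Z w) f = \<delta> * (\<Sum>k<N. \<Sum>z\<in>Z. w z * (if real (Suc k) * \<delta> < f z then 1 else 0))"
    by (simp add: lows_def del: of_nat_Suc)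
  also have "\<dots> = \<delta> * (\<Sum>z\<in>Z. w z * (\<Sum>k<N. if real (Suc k) * \<delta> < f z then 1 else 0))"
    by (subst sum.swap) (simp add: sum_distrib_left del: of_nat_Suc)
  also have "\<dots> = wsum Z w (\<lambda>z. s (f z))"
    unfolding wsum_def s_def by (subst sum_distrib_left) (simp add: mult.left_commute del: of_nat_Suc)
  finally have eq: "lows \<delta> N (smp Z w) f = wsum Z w (\<lambda>z. s (f z))" .
  have b: "s (f z) \<le> f z + 0" "f z \<le> s (f z) + \<delta>" if "z \<in> Z" for z
    using staircase_bounds[OF d f] p' that unfolding s_def by auto
  show "lows \<delta> N (smp Z w) f \<le> wsum Z w f" unfolding eq using wsum_mono[OF p b(1)] by simp
  show "wsum Z w f \<le> lows \<delta> N (smp Z w) f + \<delta>" unfolding eq by (rule wsum_mono[OF p b(2)])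
qed

text \<open>Equal masses at the heights \<open>(k + 1) * \<delta>\<close> mean equal lower sums, and
  each integral exceeds its lower sum by at most \<open>\<delta>\<close>.\<close>

lemma rint_smp_close:
  assumes p: "prob_weights Z w" and m: "rval m" and f: "lip \<gamma> f" and le: "\<And>x. x \<in> X \<Longrightarrow> f x \<le> real N * \<delta>" and d: "0 < \<delta>"
    and eq: "\<And>k. k < N \<Longrightarrow> smp Z w (level f (real (Suc k) * \<delta>)) = m (level f (real (Suc k) * \<delta>))"
  shows "\<bar>rint m f - wsum Z w f\<bar> \<le> \<delta>"
proof -
  have "lows \<delta> N (smp Z w) f = lows \<delta> N m f" unfolding lows_def using eq by (simp del: of_nat_Suc)
  moreover have "lows \<delta> N (smp Z w) f \<le> wsum Z w f" "wsum Z w f \<le> lows \<delta> N (smp Z w) f + \<delta>"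
    by (rule lows_smp[OF p]; use lipD(2)[OF f] le d in blast)+
  ultimately show ?thesis using rint_sandwich[OF m f le d] by linarith
qed

lemma rint_smp:
  assumes p: "prob_weights Z w" and f: "lip \<gamma> f"
  shows "rint (smp Z w) f = wsum Z w f"
proof -
  define M where "M = \<gamma> * a + 1"
  have M: "0 < M" using lipD(1)[OF f] a_pos by (simp add: M_def add_nonneg_pos)
  have b: "f x \<le> M" if "x \<in> X" for x using lipD(3)[OF f that] by (simp add: M_def)
  have "\<bar>rint (smp Z w) f - wsum Z w f\<bar> \<le> 0 + M / real (Suc n)" for n
  proof -
    have le: "f x \<le> real (Suc n) * (M / real (Suc n))" if "x \<in> X" for x using b[OF that] by (simp del: of_nat_Suc)
    show ?thesis using rint_smp_close[OF p rval_smp[OF p] f le] M by simp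
  qed
  from Sup_approx_nat[OF this] show ?thesis by simp
qed

text \<open>Induction on the family: an open set \<open>P\<close> splits \<open>m\<close> into its
  restriction to \<open>P\<close> and the remainder off \<open>P\<close>, both again modular and
  monotone. The set \<open>K\<close>, an atom of the splitting so far, carries \<open>m\<close> in
  the sense of the last hypothesis, and the total mass is left free because the parts are not
  normalized.\<close>

lemma weights_on_crescent:
  assumes "finite \<O>" "\<And>U. U \<in> \<O> \<Longrightarrow> openin T U" "m {} = (0::real)" "K \<subseteq> X"
    and "\<And>U V. openin T U \<Longrightarrow> openin T V \<Longrightarrow> m (U \<union> V) + m (U \<inter> V) = m U + m V"
    and "\<And>U V. openin T U \<Longrightarrow> openin T V \<Longrightarrow> U \<subseteq> V \<Longrightarrow> m U \<le> m V"
    and "\<And>U V. openin T U \<Longrightarrow> openin T V \<Longrightarrow> U \<inter> K = V \<inter> K \<Longrightarrow> m U = m V"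
  shows "\<exists>Z w. finite Z \<and> Z \<subseteq> K \<and> (\<forall>z\<in>Z. 0 \<le> w z) \<and> sum w Z = m X \<and> (\<forall>U\<in>\<O>. smp Z w U = m U)"
  using assms
proof (induction \<O> arbitrary: m K rule: finite_induct)
  case empty
  show ?case
  proof (cases "m X = 0")
    case True
    then show ?thesis by (intro exI[of _ "{}"]) auto
  next
    case False
    \<comment> \<open>Positive mass cannot be carried by the empty set. With no open sets left to
      match, all of it may sit at any one point of \<open>K\<close>.\<close>
    then have "K \<noteq> {}" using empty(6)[OF openin_X openin_empty] empty(2) by auto
    then obtain p where "p \<in> K" by blast
    moreover have "0 \<le> m X" using empty(5)[OF openin_empty openin_X] empty(2) by simp
    ultimately show ?thesis by (intro exI[of _ "{p}"] exI[of _ "\<lambda>_. m X"]) auto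
  qed
next
  case (insert P \<O>)
  note mod = insert.prems(4) and mono = insert.prems(5) and supp = insert.prems(6)
  have P: "openin T P" using insert.prems(1) by simp
  have PX: "P \<subseteq> X" using P topspace_T openin_subset by metis
  note Un = openin_Un[OF _ P] and Int = openin_Int[OF _ P]
  have "\<exists>Z w. finite Z \<and> Z \<subseteq> K \<inter> P \<and> (\<forall>z\<in>Z. 0 \<le> w z) \<and> sum w Z = m (X \<inter> P) \<and> (\<forall>U\<in>\<O>. smp Z w U = m (U \<inter> P))"
  proof (rule insert.IH[where m = "\<lambda>U. m (U \<inter> P)" and K = "K \<inter> P"])
    fix U V assume UV: "openin T U" "openin T V"
    show "m ((U \<union> V) \<inter> P) + m (U \<inter> V \<inter> P) = m (U \<inter> P) + m (V \<inter> P)"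
    proof -
      have "(U \<inter> P) \<union> (V \<inter> P) = (U \<union> V) \<inter> P" "(U \<inter> P) \<inter> (V \<inter> P) = U \<inter> V \<inter> P" by auto
      then show ?thesis using mod[OF Int[OF UV(1)] Int[OF UV(2)]] by simp
    qed
    show "U \<subseteq> V \<Longrightarrow> m (U \<inter> P) \<le> m (V \<inter> P)" by (rule mono[OF Int[OF UV(1)] Int[OF UV(2)]]) blast
    show "U \<inter> (K \<inter> P) = V \<inter> (K \<inter> P) \<Longrightarrow> m (U \<inter> P) = m (V \<inter> P)"
      by (rule supp[OF Int[OF UV(1)] Int[OF UV(2)]]) (simp add: Int_ac)
  next
    show "m ({} \<inter> P) = 0" using insert.prems(2) by simp
    show "K \<inter> P \<subseteq> X" using insert.prems(3) by blast
    show "openin T W" if "W \<in> \<O>" for W using insert.prems(1) that by blast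
  qed
  then obtain Z1 w1 where 1: "finite Z1" "Z1 \<subseteq> K \<inter> P" "\<forall>z\<in>Z1. 0 \<le> w1 z" "sum w1 Z1 = m (X \<inter> P)"
    "\<forall>U\<in>\<O>. smp Z1 w1 U = m (U \<inter> P)" by blast
  \<comment> \<open>The mass off \<open>P\<close> is read from open sets alone, as
    \<open>m (U \<union> P) - m P\<close>.\<close>
  have "\<exists>Z w. finite Z \<and> Z \<subseteq> K - P \<and> (\<forall>z\<in>Z. 0 \<le> w z) \<and> sum w Z = m (X \<union> P) - m P \<and> (\<forall>U\<in>\<O>. smp Z w U = m (U \<union> P) - m P)"
  proof (rule insert.IH[where m = "\<lambda>U. m (U \<union> P) - m P" and K = "K - P"])
    fix U V assume UV: "openin T U" "openin T V"
    have "(U \<union> P) \<union> (V \<union> P) = U \<union> V \<union> P" "(U \<union> P) \<inter> (V \<union> P) = U \<inter> V \<union> P" by auto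
    then show "m (U \<union> V \<union> P) - m P + (m (U \<inter> V \<union> P) - m P) = m (U \<union> P) - m P + (m (V \<union> P) - m P)"
      using mod[OF Un[OF UV(1)] Un[OF UV(2)]] by simp
    show "U \<subseteq> V \<Longrightarrow> m (U \<union> P) - m P \<le> m (V \<union> P) - m P"
      by (intro diff_right_mono mono[OF Un[OF UV(1)] Un[OF UV(2)]]) blast
    show "U \<inter> (K - P) = V \<inter> (K - P) \<Longrightarrow> m (U \<union> P) - m P = m (V \<union> P) - m P"
    proof -
      assume "U \<inter> (K - P) = V \<inter> (K - P)"
      then have "(U \<union> P) \<inter> K = (V \<union> P) \<inter> K" by blast
      then show ?thesis using supp[OF Un[OF UV(1)] Un[OF UV(2)]] by simp
    qed
  next
    show "m ({} \<union> P) - m P = 0" by simp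
    show "K - P \<subseteq> X" using insert.prems(3) by blast
    show "openin T W" if "W \<in> \<O>" for W using insert.prems(1) that by blast
  qed
  then obtain Z2 w2 where 2: "finite Z2" "Z2 \<subseteq> K - P" "\<forall>z\<in>Z2. 0 \<le> w2 z" "sum w2 Z2 = m (X \<union> P) - m P"
    "\<forall>U\<in>\<O>. smp Z2 w2 U = m (U \<union> P) - m P" by blast
  define w where "w z = (if z \<in> P then w1 z else w2 z)" for z
  have s: "smp (Z1 \<union> Z2) w U = smp Z1 w1 U + smp Z2 w2 U" for U
  proof -
    have "smp (Z1 \<union> Z2) w U = sum w (Z1 \<inter> U) + sum w (Z2 \<inter> U)"
      unfolding smp_def Int_Un_distrib2 using 1 2 by (intro sum.union_disjoint) auto
    also have "sum w (Z1 \<inter> U) = smp Z1 w1 U" unfolding smp_def using 1 by (intro sum.cong) (auto simp: w_def)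
    also have "sum w (Z2 \<inter> U) = smp Z2 w2 U" unfolding smp_def using 2 by (intro sum.cong) (auto simp: w_def)
    finally show ?thesis .
  qed
  have full: "smp Z u X = sum u Z" if "Z \<subseteq> K" for Z and u :: "'a \<Rightarrow> real"
    unfolding smp_def using that insert.prems(3) by (intro arg_cong[of _ _ "sum u"]) auto
  have ZK: "Z1 \<subseteq> K" "Z2 \<subseteq> K" "Z1 \<union> Z2 \<subseteq> K" using 1 2 by auto
  have XP: "X \<inter> P = P" "X \<union> P = X" using PX by auto
  have "smp (Z1 \<union> Z2) w P = m P"
  proof -
    have "Z1 \<inter> P = Z1" "Z2 \<inter> P = {}" using 1 2 by auto
    then have "smp Z1 w1 P = m P" "smp Z2 w2 P = 0" using 1 XP by (simp_all add: smp_def)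
    then show ?thesis unfolding s by simp
  qed
  moreover have "smp (Z1 \<union> Z2) w U = m U" if "U \<in> \<O>" for U
  proof -
    have "openin T U" using insert.prems(1) that by simp
    from mod[OF this P] show ?thesis unfolding s using 1 2 that by simp
  qed
  moreover have "sum w (Z1 \<union> Z2) = m X"
    unfolding full[OF ZK(3), symmetric] s full[OF ZK(1)] full[OF ZK(2)] using 1 2 XP by simp
  moreover have "finite (Z1 \<union> Z2)" "Z1 \<union> Z2 \<subseteq> K" "\<forall>z\<in>Z1 \<union> Z2. 0 \<le> w z" using 1 2 by (auto simp: w_def)
  ultimately show ?case by blast
qed

lemma weights_matching:
  assumes m: "rval m" and "finite \<O>" "\<And>U. U \<in> \<O> \<Longrightarrow> openin T U"
  shows "\<exists>Z w. prob_weights Z w \<and> (\<forall>U\<in>\<O>. smp Z w U = m U)"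
proof -
  have "m U = m V" if UV: "openin T U" "openin T V" "U \<inter> X = V \<inter> X" for U V
  proof -
    have "U \<subseteq> X" "V \<subseteq> X" using UV topspace_T openin_subset by metis+
    then show ?thesis using UV(3) by (simp add: Int_absorb2)
  qed
  then have "\<exists>Z w. finite Z \<and> Z \<subseteq> X \<and> (\<forall>z\<in>Z. 0 \<le> w z) \<and> sum w Z = m X \<and> (\<forall>U\<in>\<O>. smp Z w U = m U)"
    by (intro weights_on_crescent[OF assms(2,3) rvalD(1)[OF m] order_refl rvalD(3)[OF m] rvalD(4)[OF m]])
  then show ?thesis unfolding prob_weights_def rvalD(2)[OF m] by (elim exE conjE) (intro exI conjI)
qed

text \<open>Round the values of \<open>h\<close> on \<open>S\<close> down to a finite grid and
  extend them by cones of slope 1. The result stays below \<open>h\<close>, loses at most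
  \<open>\<zeta>\<close> on \<open>S\<close>, and there are only finitely many grid-valued functions
  on \<open>S\<close>.\<close>

lemma finite_minorants:
  assumes S: "finite S" "S \<subseteq> C" and z: "0 < \<zeta>"
  shows "\<exists>V. finite V \<and> (\<forall>k\<in>V. lip 1 k) \<and>
    (\<forall>h. lip 1 h \<longrightarrow> (\<exists>k\<in>V. (\<forall>x\<in>X. k x \<le> h x) \<and> (\<forall>b\<in>S. h b \<le> k b + \<zeta>)))"
proof -
  obtain n where n: "a / \<zeta> < real n" using reals_Archimedean2 by blast
  have n0: "0 < real n" using n a_pos z by (smt (verit) divide_pos_pos)
  \<comment> \<open>The mesh divides \<open>a\<close>, so the heights \<open>v b * q\<close> with
    \<open>v b \<le> n\<close> never exceed the bound \<open>a\<close> of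
    \<open>lip 1\<close>.\<close>
  define q where "q = a / real n"
  have q: "0 < q" "q \<le> \<zeta>" "real n * q = a" using n n0 a_pos z by (auto simp: q_def field_simps)
  define K where "K v = cones 1 (\<lambda>b. real (v b) * q) S" for v :: "'a \<Rightarrow> nat"
  define V where "V = K ` (S \<rightarrow>\<^sub>E {..n})"
  have "finite V" unfolding V_def using S(1) by (intro finite_imageI finite_PiE) auto
  moreover have "lip 1 k" if "k \<in> V" for k
  proof -
    obtain v where v: "v \<in> S \<rightarrow>\<^sub>E {..n}" "k = K v" using \<open>k \<in> V\<close> unfolding V_def by blast
    have "real (v b) * q \<le> 1 * a" if "b \<in> S" for b
    proof -
      have "real (v b) * q \<le> real n * q" using v(1) that q(1) by (intro mult_right_mono) (auto simp: PiE_iff)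
      then show ?thesis using q(3) by simp
    qed
    then show ?thesis unfolding v(2) K_def using S by (intro lip_cones) auto
  qed
  moreover have "\<exists>k\<in>V. (\<forall>x\<in>X. k x \<le> h x) \<and> (\<forall>b\<in>S. h b \<le> k b + \<zeta>)" if h: "lip 1 h" for h
  proof -
    define v where "v = restrict (\<lambda>b. nat \<lfloor>h b / q\<rfloor>) S"
    have v: "real (v b) * q \<le> h b" "h b \<le> real (v b) * q + q" "v b \<le> n" if b: "b \<in> S" for b
    proof -
      have h0: "0 \<le> h b" "h b \<le> a" using lipD(2,3)[OF h, of b] b S(2) C_sub by auto
      have hq: "0 \<le> h b / q" using h0 q by simp
      have eq: "real (v b) = of_int \<lfloor>h b / q\<rfloor>" using hq b by (simp add: v_def)
      have "real (v b) \<le> h b / q" "h b / q \<le> real (v b) + 1" unfolding eq by linarith+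
      then show 1: "real (v b) * q \<le> h b" "h b \<le> real (v b) * q + q" using q(1) by (simp_all add: field_simps)
      then have "real (v b) * q \<le> real n * q" using h0 q(3) by linarith
      then show "v b \<le> n" using q(1) by simp
    qed
    have "v \<in> S \<rightarrow>\<^sub>E {..n}" using v(3) by (auto simp: v_def)
    then have KV: "K v \<in> V" by (simp add: V_def)
    have SX: "S \<subseteq> X" using S(2) C_sub by simp
    have "K v x \<le> h x" if x: "x \<in> X" for x
      unfolding K_def
    proof (rule cones_le[where f = h, OF S(1) SX x lipD(2)[OF h x]])
      fix b assume b: "b \<in> S"
      then have "b \<in> X" using SX by blast
      from lipD(4)[OF h this x] show "real (v b) * q \<le> h x + 1 * dt b x" using v(1)[OF b] by linarith
    qed
    moreover have "h b \<le> K v b + \<zeta>" if b: "b \<in> S" for b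
    proof -
      have "real (v b) * q - 1 * dt b b \<le> K v b" unfolding K_def by (rule cones_ge[OF S(1) b])
      moreover have "dt b b = 0" using b SX by (intro dt_refl) auto
      ultimately show ?thesis using v(2)[OF b] q(2) by linarith
    qed
    ultimately show ?thesis using KV by blast
  qed
  ultimately show ?thesis by blast
qed

text \<open>The transport map sends each atom \<open>z\<close> to a maximiser \<open>b z\<close> of the cones in \<open>E\<close>; then \<open>H z - E z\<close>
  dominates both the transport cost and the loss of each \<open>g\<close>, while its mean is small.\<close>

lemma simple_approximation:
  assumes m: "rval m" and G: "finite G" "\<And>g. g \<in> G \<Longrightarrow> lip 1 g" and e: "0 < \<eta>"
  shows "\<exists>Z w. prob_weights Z w \<and> Z \<subseteq> B \<and> (\<forall>h. lip 1 h \<longrightarrow> wsum Z w h \<le> rint m h + \<eta>) \<and>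
    (\<forall>g\<in>G. rint m g \<le> wsum Z w g + \<eta>)"
proof -
  define n where "n = real (card G)"
  define \<gamma> where "\<gamma> = 1 + n"
  have \<gamma>: "1 \<le> \<gamma>" by (simp add: \<gamma>_def n_def)
  \<comment> \<open>The summand \<open>a\<close> pays for moving an atom that no cone reaches, as
    \<open>dt \<le> a\<close>; the sum pays for the loss of every \<open>g\<close> in
    \<open>G\<close>. The constant \<open>\<gamma> = 1 + n\<close> is the resulting Lipschitz
    constant.\<close>
  define H where "H x = a + (\<Sum>g\<in>G. g x)" for x
  have "lip 1 (\<lambda>_. a)" using a_pos by (intro lip_const) auto
  then have H: "lip \<gamma> H" unfolding \<gamma>_def n_def H_def using lip_sum[OF G] by (rule lip_add)
  \<comment> \<open>The upper estimate spends five of these: one on the minorant, three on the mean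
    of \<open>H - E\<close>, one on matching \<open>m\<close> by point masses.\<close>
  define \<zeta> where "\<zeta> = \<eta> / 5"
  have z: "0 < \<zeta>" using e by (simp add: \<zeta>_def)
  obtain S where S: "finite S" "S \<subseteq> B" "S \<noteq> {}" "rint m H < rint m (cones \<gamma> H S) + \<zeta>"
    using rint_cones[OF m H z] by blast
  have SC: "S \<subseteq> C" and SX: "S \<subseteq> X" using S(2) B_sub C_sub by auto
  define E where "E = cones \<gamma> H S"
  have E: "lip \<gamma> E" unfolding E_def by (rule lip_cones_self[OF S(1) SC H])
  obtain V where V: "finite V" "\<And>k. k \<in> V \<Longrightarrow> lip 1 k"
    "\<And>h. lip 1 h \<Longrightarrow> \<exists>k\<in>V. (\<forall>x\<in>X. k x \<le> h x) \<and> (\<forall>b\<in>S. h b \<le> k b + \<zeta>)"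
    using finite_minorants[OF S(1) SC z] by blast
  define F where "F = G \<union> V \<union> {H, E}"
  have F: "finite F" "\<And>f. f \<in> F \<Longrightarrow> lip \<gamma> f"
    using G V H E \<gamma> by (auto simp: F_def intro: lip_mono[of 1])
  obtain N0 where N0: "\<gamma> * a / \<zeta> < real N0" using reals_Archimedean2 by blast
  have ga: "0 < \<gamma> * a" using \<gamma> a_pos by simp
  have N0p: "0 < real N0" using N0 ga z by (smt (verit) divide_pos_pos)
  define \<delta> where "\<delta> = \<gamma> * a / real N0"
  have d: "0 < \<delta>" "\<delta> \<le> \<zeta>" "real N0 * \<delta> = \<gamma> * a" using N0 N0p ga z by (auto simp: \<delta>_def field_simps)
  \<comment> \<open>Exactly the heights that occur in the lower sums of the finitely many functions
    in \<open>F\<close>.\<close>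
  define \<O> where "\<O> = (\<lambda>(f, k). level f (real (Suc k) * \<delta>)) ` (F \<times> {..<N0})"
  have fin: "finite \<O>" unfolding \<O>_def using F(1) by simp
  have op: "openin T U" if "U \<in> \<O>" for U
  proof -
    obtain f k where "f \<in> F" "U = level f (real (Suc k) * \<delta>)" using \<open>U \<in> \<O>\<close> unfolding \<O>_def by force
    then show ?thesis using open_level[OF F(2)] by simp
  qed
  have "\<exists>Z w. prob_weights Z w \<and> (\<forall>U\<in>\<O>. smp Z w U = m U)" by (rule weights_matching[OF m fin op])
  then obtain Z w where Z: "prob_weights Z w" and eq: "\<forall>U\<in>\<O>. smp Z w U = m U"
    by (elim exE conjE)
  have close: "\<bar>rint m f - wsum Z w f\<bar> \<le> \<zeta>" if f: "f \<in> F" for f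
  proof -
    have "\<bar>rint m f - wsum Z w f\<bar> \<le> \<delta>"
    proof (rule rint_smp_close[OF Z m F(2)[OF f]])
      show "f x \<le> real N0 * \<delta>" if "x \<in> X" for x using lipD(3)[OF F(2)[OF f] that] d(3) by simp
      show "smp Z w (level f (real (Suc k) * \<delta>)) = m (level f (real (Suc k) * \<delta>))" if "k < N0" for k
        by (rule bspec[OF eq]) (use f that in \<open>force simp: \<O>_def simp del: of_nat_Suc\<close>)
    qed (rule d)
    then show ?thesis using d(2) by linarith
  qed
  note Z' = Z[unfolded prob_weights_def]
  define \<Delta> where "\<Delta> x = H x - E x" for x
  have "wsum Z w \<Delta> = wsum Z w H - wsum Z w E"
    by (simp add: wsum_def \<Delta>_def right_diff_distrib sum_subtractf)
  \<comment> \<open>One \<open>\<zeta>\<close> from the choice of \<open>S\<close>, and one each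
    from matching the integrals of \<open>H\<close> and \<open>E\<close>.\<close>
  then have D: "wsum Z w \<Delta> \<le> 3 * \<zeta>"
    using close[of H] close[of E] S(4) unfolding E_def[symmetric] F_def by auto
  have "\<exists>b\<in>S. dt b x \<le> \<Delta> x \<and> (\<forall>g\<in>G. g x \<le> g b + \<Delta> x)" if x: "x \<in> X" for x
  proof (cases rule: cones_cases[OF S(1), of \<gamma> H x])
    case 1
    obtain b where b: "b \<in> S" using S(3) by blast
    have "0 \<le> (\<Sum>g\<in>G. g x)" using lipD(2)[OF G(2) x] by (intro sum_nonneg)
    then have "a \<le> \<Delta> x" using 1 by (simp add: \<Delta>_def E_def H_def)
    moreover have "g x \<le> g b + a" if "g \<in> G" for g
      using lipD(3)[OF G(2)[OF that] x] lipD(2)[OF G(2)[OF that], of b] b SX by auto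
    ultimately show ?thesis using b dt_le[of b x] by (intro bexI[of _ b]) force+
  next
    case (2 b)
    have bX: "b \<in> X" using 2 SX by blast
    have g: "g b \<le> g x + dt b x" if "g \<in> G" for g using lipD(4)[OF G(2)[OF that] bX x] by simp
    \<comment> \<open>Each \<open>g x - g b\<close> is at least \<open>- dt b x\<close>. The
      \<open>n\<close> spare multiples of \<open>dt b x\<close> in \<open>\<gamma> * dt b x\<close>
      absorb these, leaving one for the transport cost; keeping one \<open>g\<close> aside gives the
      bound on its loss.\<close>
    have Dx: "\<Delta> x = (\<Sum>g\<in>G. g x - g b) + \<gamma> * dt b x"
      unfolding \<Delta>_def E_def 2 by (simp add: H_def sum_subtractf)
    have "(\<Sum>g\<in>G. - dt b x) \<le> (\<Sum>g\<in>G. g x - g b)" using g by (intro sum_mono) force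
    then have 1: "dt b x \<le> \<Delta> x" unfolding Dx \<gamma>_def n_def by (simp add: algebra_simps)
    have "g x \<le> g b + \<Delta> x" if gG: "g \<in> G" for g
    proof -
      have "(\<Sum>g\<in>G - {g}. - dt b x) \<le> (\<Sum>g\<in>G - {g}. g x - g b)" using g by (intro sum_mono) force
      moreover have "(\<Sum>g\<in>G. g x - g b) = (g x - g b) + (\<Sum>g\<in>G - {g}. g x - g b)"
        using G(1) gG by (rule sum.remove)
      moreover have "(\<Sum>g\<in>G - {g}. - dt b x) = - (real (card (G - {g})) * dt b x)" by simp
      moreover have "real (card (G - {g})) * dt b x \<le> \<gamma> * dt b x"
      proof (rule mult_right_mono[OF _ dt_nonneg])
        show "real (card (G - {g})) \<le> \<gamma>" using card_mono[OF G(1), of "G - {g}"] by (simp add: \<gamma>_def n_def)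
      qed
      ultimately show ?thesis unfolding Dx by linarith
    qed
    with 1 2 show ?thesis by blast
  qed
  then obtain b where b: "\<And>x. x \<in> X \<Longrightarrow> b x \<in> S" "\<And>x. x \<in> X \<Longrightarrow> dt (b x) x \<le> \<Delta> x"
    "\<And>x g. x \<in> X \<Longrightarrow> g \<in> G \<Longrightarrow> g x \<le> g (b x) + \<Delta> x" by metis
  \<comment> \<open>The weights are pushed forward along \<open>b\<close>, adding those of atoms
    sent to the same center.\<close>
  define w' where "w' s = sum w {z \<in> Z. b z = s}" for s
  have bZ: "b ` Z \<subseteq> S" using b(1) Z' by blast
  have push: "wsum S w' f = wsum Z w (\<lambda>z. f (b z))" for f
  proof -
    have "wsum S w' f = (\<Sum>s\<in>S. \<Sum>z\<in>{z \<in> Z. b z = s}. w z * f (b z))"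
      unfolding wsum_def w'_def sum_distrib_right by (intro sum.cong) auto
    also have "\<dots> = wsum Z w (\<lambda>z. f (b z))"
      unfolding wsum_def using Z' S(1) bZ by (intro sum.group) auto
    finally show ?thesis .
  qed
  have "sum w' S = 1" using push[of "\<lambda>_. 1"] Z' by (simp add: wsum_def)
  then have pw: "prob_weights S w'"
    unfolding prob_weights_def using S(1) SX Z' by (auto simp: w'_def intro: sum_nonneg)
  have split: "wsum Z w (\<lambda>z. f z + \<Delta> z) = wsum Z w f + wsum Z w \<Delta>" for f
    by (simp add: wsum_def distrib_left sum.distrib)
  have upper: "wsum S w' h \<le> rint m h + \<eta>" if h: "lip 1 h" for h
  proof -
    obtain k where k: "k \<in> V" "\<And>x. x \<in> X \<Longrightarrow> k x \<le> h x" "\<And>b. b \<in> S \<Longrightarrow> h b \<le> k b + \<zeta>" using V(3)[OF h] by blast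
    have "wsum S w' h \<le> wsum S w' k + \<zeta>" using wsum_mono[OF pw k(3)] .
    also have "wsum S w' k \<le> wsum Z w (\<lambda>z. k z + \<Delta> z) + 0"
      unfolding push
    proof (rule wsum_mono[OF Z])
      fix x assume "x \<in> Z"
      then have x: "x \<in> X" "b x \<in> X" using Z' b(1) SX by auto
      show "k (b x) \<le> k x + \<Delta> x + 0" using lipD(4)[OF V(2)[OF k(1)] x(2,1)] b(2)[OF x(1)] by simp
    qed
    also have "\<dots> \<le> wsum Z w k + 3 * \<zeta>" using D by (simp add: split)
    also have "wsum Z w k \<le> rint m k + \<zeta>" using close[of k] k(1) by (auto simp: F_def)
    also have "rint m k \<le> rint m h" by (rule rint_mono[OF m V(2)[OF k(1)] h k(2)])
    finally show ?thesis by (simp add: \<zeta>_def)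
  qed
  have lower: "rint m g \<le> wsum S w' g + \<eta>" if g: "g \<in> G" for g
  proof -
    have "rint m g \<le> wsum Z w g + \<zeta>" using close[of g] g by (auto simp: F_def)
    also have "wsum Z w g \<le> wsum Z w (\<lambda>z. g (b z) + \<Delta> z) + 0"
      using b(3) g Z' by (intro wsum_mono[OF Z]) auto
    also have "\<dots> \<le> wsum S w' g + 3 * \<zeta>" unfolding push using D by (simp add: split[of "\<lambda>z. g (b z)"])
    finally show ?thesis using z by (simp add: \<zeta>_def)
  qed
  show ?thesis using pw S(2) upper lower by blast
qed

text \<open>Scaling extends the hypothesis to all Lipschitz constants. A Lipschitz function that is
  1 on \<open>level g t\<close> and 0 outside \<open>U\<close> then compares the two masses, and
  such level sets exhaust \<open>U\<close>.\<close>

lemma rval_le_of_rint_le: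
  assumes m: "rval m" and m': "rval m'" and le: "\<And>h. lip 1 h \<Longrightarrow> rint m h \<le> rint m' h" and U: "openin T U"
  shows "m U \<le> m' U"
proof (rule field_le_epsilon)
  fix \<epsilon> :: real assume e: "0 < \<epsilon>"
  \<comment> \<open>The gap between heights 0 and \<open>t > 0\<close> leaves room for a Lipschitz
    function to rise from 0 to 1.\<close>
  let ?W = "{level g t |g t. (\<exists>\<gamma>. lip \<gamma> g) \<and> 0 < t \<and> level g 0 \<subseteq> U}"
  have le': "rint m h \<le> rint m' h" if h: "lip \<gamma> h" for \<gamma> h
  proof -
    have c: "0 < 1 / (\<gamma> + 1)" using lipD(1)[OF h] by simp
    have "lip (1 / (\<gamma> + 1) * \<gamma>) (\<lambda>x. 1 / (\<gamma> + 1) * h x)" using c by (intro lip_scale[OF h]) simp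
    then have "lip 1 (\<lambda>x. 1 / (\<gamma> + 1) * h x)" by (rule lip_mono) (use lipD(1)[OF h] in simp)
    from le[OF this] show ?thesis unfolding rint_scale[OF m h c] rint_scale[OF m' h c] using c by (simp add: divide_le_cancel)
  qed
  have WI: "level g t \<in> ?W" if "lip \<gamma> g" "0 < t" "level g 0 \<subseteq> U" for \<gamma> g t
    using that by (intro CollectI exI[of _ g] exI[of _ t] conjI exI[of _ \<gamma>] refl)
  have dir: "directed_in {U. openin T U} (\<subseteq>) ?W"
    unfolding directed_in_def
  proof (intro conjI ballI)
    show "?W \<subseteq> {U. openin T U}" using open_level by auto
    have "level (\<lambda>_. 0) 1 \<in> ?W" by (rule WI[OF lip_const[of 0 0]]) (auto simp: level_def)
    then show "?W \<noteq> {}" by (metis empty_iff)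
    fix P Q assume "P \<in> ?W" "Q \<in> ?W"
    then obtain f s \<gamma> g t \<gamma>' where *: "P = level f s" "Q = level g t" "lip \<gamma> f" "lip \<gamma>' g" "0 < s" "0 < t"
      "level f 0 \<subseteq> U" "level g 0 \<subseteq> U" by blast
    let ?h = "\<lambda>x. max (f x) (g x)"
    have "lip (max \<gamma> \<gamma>') ?h" by (rule lip_max[OF lip_mono[OF *(3)] lip_mono[OF *(4)]]) auto
    moreover have "level ?h 0 \<subseteq> U" unfolding level_max using * by blast
    moreover have "0 < min s t" using * by simp
    ultimately have "level ?h (min s t) \<in> ?W" using WI by simp
    moreover have "P \<subseteq> level ?h (min s t)" "Q \<subseteq> level ?h (min s t)" unfolding * by (intro level_mono; simp)+
    ultimately show "\<exists>R\<in>?W. P \<subseteq> R \<and> Q \<subseteq> R" by blast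
  qed
  have "\<Union>?W = U"
  proof (intro equalityI subsetI)
    fix x assume x: "x \<in> U"
    obtain b \<rho> where b: "b \<in> B" "0 < \<rho>" "\<rho> \<le> a" "dt b x < \<rho>" "{y \<in> X. dt b y < \<rho>} \<subseteq> U" "x \<in> X"
      using U x unfolding open_iff by blast
    let ?g = "cones 1 (\<lambda>_. \<rho>) {b}"
    have g: "?g y = max 0 (\<rho> - dt b y)" for y by (simp add: cones_def)
    have "lip 1 ?g" using b B_sub by (intro lip_cones) auto
    moreover have "level ?g 0 \<subseteq> U" using b(5) by (auto simp: level_def g)
    moreover have "0 < (\<rho> - dt b x) / 2" using b by simp
    ultimately have "level ?g ((\<rho> - dt b x) / 2) \<in> ?W" using WI by simp
    moreover have "x \<in> level ?g ((\<rho> - dt b x) / 2)" using b by (simp add: level_def g)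
    ultimately show "x \<in> \<Union>?W" by blast
  next
    fix x assume "x \<in> \<Union>?W"
    then obtain g t where g: "0 < t" "level g 0 \<subseteq> U" "x \<in> level g t" by blast
    then have "x \<in> level g 0" by (simp add: level_def)
    then show "x \<in> U" using g(2) by blast
  qed
  with rvalD(5)[OF m dir e] obtain g t \<gamma> where g: "lip \<gamma> g" "0 < t" "level g 0 \<subseteq> U" "m U < m (level g t) + \<epsilon>" by auto
  note l = lip_layer'[OF g(1,2), of 0]
  have "m (level g t) \<le> rint m (layer t g 0)"
    by (rule rint_ge[OF m l open_level[OF g(1)]]) (use g(2) in \<open>auto simp: level_def layer_bounds\<close>)
  also have "\<dots> \<le> rint m' (layer t g 0)" by (rule le'[OF l])
  also have "\<dots> \<le> m' U"
  proof (rule rint_le[OF m' l U])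
    fix x assume "x \<in> X" "x \<notin> U"
    then have "g x \<le> real 0 * t" using g(3) by (force simp: level_def)
    then show "layer t g 0 x = 0" by (rule layer_bounds(4))
  qed (rule layer_bounds(2))
  finally show "m U \<le> m' U + \<epsilon>" using g(4) by linarith
qed

end

section \<open>Limits of directed families\<close>

context kr_space begin

lemma rint_zero: "rval m \<Longrightarrow> rint m (\<lambda>_. 0) = 0"
  using rint_le[OF _ lip_const[of 0 0] openin_empty] rint_nonneg[of m "\<lambda>_. 0"] rvalD(1) by fastforce

lemma lip_normalize:
  assumes h: "lip \<gamma> h"
  shows "0 < 1 / (\<gamma> + 1)" "lip 1 (\<lambda>x. 1 / (\<gamma> + 1) * h x)"
proof -
  show c: "0 < 1 / (\<gamma> + 1)" using lipD(1)[OF h] by simp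
  have "lip (1 / (\<gamma> + 1) * \<gamma>) (\<lambda>x. 1 / (\<gamma> + 1) * h x)" using c by (intro lip_scale[OF h]) simp
  then show "lip 1 (\<lambda>x. 1 / (\<gamma> + 1) * h x)" by (rule lip_mono) (use lipD(1)[OF h] in simp)
qed

text \<open>The order on formal balls over \<open>V1\<close>, read through integrals, as
  \<open>leV_iff\<close> confirms. For valuations in \<open>rval\<close> the test
  \<open>h = 0\<close> gives the comparison of radii.\<close>

definition val_le :: "('a set \<Rightarrow> real) \<times> real \<Rightarrow> ('a set \<Rightarrow> real) \<times> real \<Rightarrow> bool" where
  "val_le p q \<longleftrightarrow> (\<forall>h. lip 1 h \<longrightarrow> rint (fst p) h - snd p \<le> rint (fst q) h - snd q)"

lemma val_leD: "val_le p q \<Longrightarrow> lip 1 h \<Longrightarrow> rint (fst p) h - snd p \<le> rint (fst q) h - snd q"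
  by (simp add: val_le_def)

text \<open>Radii decrease and integrals minus radii increase along \<open>I\<close>, so the
  integrals of each Lipschitz function converge. The limit \<open>J\<close> inherits the lattice and
  slice identities from convergence; only \<open>J_cones\<close> needs the supremum formula.\<close>

theorem directed_limit:
  fixes p :: "'i \<Rightarrow> ('a set \<Rightarrow> real) \<times> real"
  assumes ne: "I \<noteq> {}" and rv: "\<And>i. i \<in> I \<Longrightarrow> rval (fst (p i))" and rn: "\<And>i. i \<in> I \<Longrightarrow> 0 \<le> snd (p i)"
    and dir: "\<And>i j. i \<in> I \<Longrightarrow> j \<in> I \<Longrightarrow> \<exists>k\<in>I. val_le (p i) (p k) \<and> val_le (p j) (p k)"
  defines "R \<equiv> INF i\<in>I. snd (p i)"
  shows "\<exists>n. rval n \<and> (\<forall>i\<in>I. val_le (p i) (n, R)) \<and>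
    (\<forall>h \<epsilon>. lip 1 h \<and> 0 < \<epsilon> \<longrightarrow> (\<exists>i\<in>I. rint n h - R < rint (fst (p i)) h - snd (p i) + \<epsilon>))"
proof -
  let ?up = "\<lambda>i. {j \<in> I. val_le (p i) (p j)}"
  have trans: "val_le (p i) (p k)" if "val_le (p i) (p j)" "val_le (p j) (p k)" for i j k
    using that unfolding val_le_def by (meson order_trans)
  \<comment> \<open>The filter of tails of \<open>I\<close> allows limits to be taken with the usual
    rules for sums, scaling and inequalities.\<close>
  define G where "G = (INF i\<in>I. principal (?up i))"
  have ev: "eventually P G \<longleftrightarrow> (\<exists>i\<in>I. \<forall>j\<in>I. val_le (p i) (p j) \<longrightarrow> P j)" for P
  proof -
    have "eventually P G \<longleftrightarrow> (\<exists>i\<in>I. eventually P (principal (?up i)))"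
      unfolding G_def
    proof (rule eventually_INF_base[OF ne])
      fix i j assume "i \<in> I" "j \<in> I"
      then obtain k where k: "k \<in> I" "val_le (p i) (p k)" "val_le (p j) (p k)" using dir by blast
      then have "?up k \<subseteq> ?up i \<inter> ?up j" using trans by blast
      then show "\<exists>x\<in>I. principal (?up x) \<le> inf (principal (?up i)) (principal (?up j))"
        using k(1) by (intro bexI[of _ k]) auto
    qed
    then show ?thesis by (auto simp: eventually_principal)
  qed
  have refl: "val_le (p i) (p i)" for i by (simp add: val_le_def)
  have nt: "G \<noteq> bot" using ev[of "\<lambda>_. False"] refl by (auto simp: trivial_limit_def)
  have evI: "eventually Q G" if "\<And>i. i \<in> I \<Longrightarrow> Q i" for Q using ev[of Q] that ne by auto
  have mono_lim: "(\<phi> \<longlongrightarrow> (SUP i\<in>I. \<phi> i)) G"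
    if mono: "\<And>i j. i \<in> I \<Longrightarrow> j \<in> I \<Longrightarrow> val_le (p i) (p j) \<Longrightarrow> \<phi> i \<le> \<phi> j" and bdd: "bdd_above (\<phi> ` I)" for \<phi> :: "'i \<Rightarrow> real"
  proof (rule order_tendstoI)
    fix y assume "y < (SUP i\<in>I. \<phi> i)"
    then obtain i where i: "i \<in> I" "y < \<phi> i" using less_cSUP_iff[OF ne bdd] by auto
    show "eventually (\<lambda>j. y < \<phi> j) G" unfolding ev
    proof (intro bexI[of _ i] ballI impI i(1))
      fix j assume "j \<in> I" "val_le (p i) (p j)"
      then show "y < \<phi> j" using mono[OF i(1)] i(2) by fastforce
    qed
  next
    fix y assume y: "(SUP i\<in>I. \<phi> i) < y"
    show "eventually (\<lambda>j. \<phi> j < y) G"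
      by (rule evI) (use cSUP_upper[OF _ bdd] y in fastforce)
  qed
  have lip0: "lip 1 (\<lambda>_. 0)" using a_pos by (intro lip_const) auto
  have rdec: "snd (p j) \<le> snd (p i)" if "i \<in> I" "j \<in> I" "val_le (p i) (p j)" for i j
    using val_leD[OF that(3) lip0] rint_zero[OF rv[OF that(1)]] rint_zero[OF rv[OF that(2)]] by simp
  have "((\<lambda>i. - snd (p i)) \<longlongrightarrow> (SUP i\<in>I. - snd (p i))) G"
    by (rule mono_lim) (use rdec rn in \<open>auto intro!: bdd_aboveI2[of _ _ 0]\<close>)
  from tendsto_minus[OF this] have rlim: "((\<lambda>i. snd (p i)) \<longlongrightarrow> R) G"
    by (simp add: R_def Inf_real_def image_image)
  define J where "J h = Lim G (\<lambda>i. rint (fst (p i)) h)" for h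
  have bnd: "bdd_above ((\<lambda>i. rint (fst (p i)) h - snd (p i)) ` I)" if "lip 1 h" for h
  proof (rule bdd_aboveI2)
    fix i assume i: "i \<in> I"
    have "rint (fst (p i)) h \<le> a" using lipD(3)[OF that] by (intro rint_bound[OF rv[OF i] that _ a_pos]) auto
    then show "rint (fst (p i)) h - snd (p i) \<le> a" using rn[OF i] by simp
  qed
  have lim1: "((\<lambda>i. rint (fst (p i)) h) \<longlongrightarrow> (SUP i\<in>I. rint (fst (p i)) h - snd (p i)) + R) G" if h: "lip 1 h" for h
  proof -
    have "((\<lambda>i. rint (fst (p i)) h - snd (p i)) \<longlongrightarrow> (SUP i\<in>I. rint (fst (p i)) h - snd (p i))) G"
      by (rule mono_lim[OF _ bnd[OF h]]) (rule val_leD[OF _ h])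
    from tendsto_add[OF this rlim] show ?thesis by simp
  qed
  have J1: "J h = (SUP i\<in>I. rint (fst (p i)) h - snd (p i)) + R" if h: "lip 1 h" for h
    unfolding J_def by (rule tendsto_Lim[OF nt lim1[OF h]])
  \<comment> \<open>Other Lipschitz constants are reduced to 1 by dividing by
    \<open>\<gamma> + 1\<close>, which is positive even for \<open>\<gamma> = 0\<close>.\<close>
  have lim: "((\<lambda>i. rint (fst (p i)) h) \<longlongrightarrow> J h) G" if h: "lip \<gamma> h" for \<gamma> h
  proof -
    let ?c = "1 / (\<gamma> + 1)"
    note c = lip_normalize[OF h]
    have "((\<lambda>i. 1 / ?c * rint (fst (p i)) (\<lambda>x. ?c * h x)) \<longlongrightarrow> 1 / ?c * J (\<lambda>x. ?c * h x)) G"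
      using lim1[OF c(2)] unfolding J1[OF c(2)] by (intro tendsto_mult tendsto_const)
    moreover have "eventually (\<lambda>i. 1 / ?c * rint (fst (p i)) (\<lambda>x. ?c * h x) = rint (fst (p i)) h) G"
      by (rule evI) (use rint_scale[OF rv h c(1)] c(1) in simp)
    ultimately have "((\<lambda>i. rint (fst (p i)) h) \<longlongrightarrow> 1 / ?c * J (\<lambda>x. ?c * h x)) G"
      by (rule Lim_transform_eventually)
    then show ?thesis unfolding J_def by (metis tendsto_Lim[OF nt])
  qed
  have Jge: "rint (fst (p i)) h - snd (p i) + R \<le> J h" if "lip 1 h" "i \<in> I" for h i
    unfolding J1[OF that(1)] using cSUP_upper[OF that(2) bnd[OF that(1)]] by simp
  have Jless: "\<exists>i\<in>I. J h - R < rint (fst (p i)) h - snd (p i) + \<epsilon>" if h: "lip 1 h" and e: "0 < \<epsilon>" for h \<epsilon>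
  proof -
    have "(SUP i\<in>I. rint (fst (p i)) h - snd (p i)) - \<epsilon> < (SUP i\<in>I. rint (fst (p i)) h - snd (p i))" using e by simp
    then obtain i where "i \<in> I" "(SUP i\<in>I. rint (fst (p i)) h - snd (p i)) - \<epsilon> < rint (fst (p i)) h - snd (p i)"
      using less_cSUP_iff[OF ne bnd[OF h]] by auto
    then show ?thesis unfolding J1[OF h] by (intro bexI[of _ i]) auto
  qed
  have Jmono: "J f \<le> J g" if "lip \<gamma> f" "lip \<gamma>' g" "\<And>x. x \<in> X \<Longrightarrow> f x \<le> g x" for \<gamma> \<gamma>' f g
    by (rule tendsto_le[OF nt lim[OF that(2)] lim[OF that(1)] evI]) (rule rint_mono[OF rv that])
  have Jscale: "J (\<lambda>x. c * f x) = c * J f" if f: "lip \<gamma> f" and c: "0 < c" for \<gamma> f c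
  proof (rule tendsto_unique[OF nt lim[OF lip_scale[OF f less_imp_le[OF c]]]])
    have "((\<lambda>i. c * rint (fst (p i)) f) \<longlongrightarrow> c * J f) G" by (intro tendsto_mult tendsto_const lim[OF f])
    then show "((\<lambda>i. rint (fst (p i)) (\<lambda>x. c * f x)) \<longlongrightarrow> c * J f) G"
      by (rule Lim_transform_eventually[OF _ evI]) (rule rint_scale[OF rv f c, symmetric])
  qed
  interpret J: kr_functional X B C dt a Fl T J
  proof unfold_locales
    show "J f \<le> J g" if "lip \<gamma> f" "lip \<gamma>' g" "\<And>x. x \<in> X \<Longrightarrow> f x \<le> g x" for \<gamma> \<gamma>' f g
      using Jmono[OF that] .
    show "J (\<lambda>x. max (f x) (g x)) + J (\<lambda>x. min (f x) (g x)) = J f + J g" if f: "lip \<gamma> f" and g: "lip \<gamma> g" for \<gamma> f g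
    proof (rule tendsto_unique[OF nt tendsto_add[OF lim[OF lip_max[OF f g]] lim[OF lip_min[OF f g]]]])
      show "((\<lambda>i. rint (fst (p i)) (\<lambda>x. max (f x) (g x)) + rint (fst (p i)) (\<lambda>x. min (f x) (g x))) \<longlongrightarrow> J f + J g) G"
        by (rule Lim_transform_eventually[OF tendsto_add[OF lim[OF f] lim[OF g]] evI])
          (rule rint_max_min[OF rv f g, symmetric])
    qed
    show "J (\<lambda>_. 0) = 0"
      by (rule tendsto_unique[OF nt lim[OF lip0]], rule Lim_transform_eventually[OF tendsto_const evI])
        (rule rint_zero[OF rv, symmetric])
    have "lip (1 / a) (\<lambda>_. 1)" using a_pos by (intro lip_const) auto
    then show "J (\<lambda>_. 1) = 1"
      by (rule tendsto_unique[OF nt lim], intro Lim_transform_eventually[OF tendsto_const evI])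
        (rule rint_one[OF rv, symmetric])
    show "\<bar>J f - \<delta> * (\<Sum>k<N. J (layer \<delta> f k))\<bar> \<le> \<delta>"
      if f: "lip \<gamma> f" and le: "\<And>x. x \<in> X \<Longrightarrow> f x \<le> real N * \<delta>" and d: "0 < \<delta>" for \<gamma> f N \<delta>
    proof (rule tendsto_upperbound[OF _ evI nt])
      show "((\<lambda>i. \<bar>rint (fst (p i)) f - \<delta> * (\<Sum>k<N. rint (fst (p i)) (layer \<delta> f k))\<bar>)
          \<longlongrightarrow> \<bar>J f - \<delta> * (\<Sum>k<N. J (layer \<delta> f k))\<bar>) G"
        by (intro tendsto_intros lim[OF f] lim[OF lip_layer'[OF f d]])
      show "\<bar>rint (fst (p i)) f - \<delta> * (\<Sum>k<N. rint (fst (p i)) (layer \<delta> f k))\<bar> \<le> \<delta>" if "i \<in> I" for i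
        by (rule rint_layer_sum[OF rv[OF that] f le d])
    qed
    \<comment> \<open>An index \<open>i\<close> that nearly attains the supremum for
      \<open>c * f\<close> is kept fixed; cones approximate \<open>f\<close> for that one valuation.
      Its radius then occurs on both sides and cancels.\<close>
    show "\<exists>S. finite S \<and> S \<subseteq> B \<and> J f < J (cones \<beta> f S) + \<epsilon>" if f: "lip \<gamma> f" and \<beta>: "\<gamma> \<le> \<beta>" and e: "0 < \<epsilon>" for \<gamma> f \<beta> \<epsilon>
    proof -
      note f = lip_mono[OF f \<beta>]
      define c where "c = 1 / (\<beta> + 1)"
      note n = lip_normalize[folded c_def]
      have c: "0 < c" using n(1)[OF f] by (simp add: c_def)
      have ce: "0 < c * \<epsilon> / 2" using c e by simp
      obtain i where i: "i \<in> I" "J (\<lambda>x. c * f x) - R < rint (fst (p i)) (\<lambda>x. c * f x) - snd (p i) + c * \<epsilon> / 2"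
        using Jless[OF lip_normalize(2)[OF f] ce] unfolding c_def by blast
      obtain S where S: "finite S" "S \<subseteq> B" "rint (fst (p i)) f < rint (fst (p i)) (cones \<beta> f S) + \<epsilon> / 2"
        using rint_cones[OF rv[OF i(1)] f, of "\<epsilon>/2"] e by auto
      have cl: "lip \<beta> (cones \<beta> f S)" using lip_cones_self[OF S(1) subset_trans[OF S(2) B_sub] f] .
      have "rint (fst (p i)) (\<lambda>x. c * cones \<beta> f S x) - snd (p i) + R \<le> J (\<lambda>x. c * cones \<beta> f S x)"
        using Jge[OF lip_normalize(2)[OF cl] i(1)] unfolding c_def .
      then have 1: "c * rint (fst (p i)) (cones \<beta> f S) - snd (p i) + R \<le> c * J (cones \<beta> f S)"
        unfolding Jscale[OF cl c] rint_scale[OF rv[OF i(1)] cl c] .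
      have 2: "c * J f - R < c * rint (fst (p i)) f - snd (p i) + c * \<epsilon> / 2"
        using i(2) unfolding Jscale[OF f c] rint_scale[OF rv[OF i(1)] f c] .
      have "c * rint (fst (p i)) f < c * (rint (fst (p i)) (cones \<beta> f S) + \<epsilon> / 2)" using S(3) c by simp
      then have "c * J f < c * (J (cones \<beta> f S) + \<epsilon>)" using 1 2 by (simp add: distrib_left)
      then have "J f < J (cones \<beta> f S) + \<epsilon>" using c by simp
      then show ?thesis using S by blast
    qed
  qed
  have "val_le (p i) (J.nu, R)" if "i \<in> I" for i
    unfolding val_le_def fst_conv snd_conv
  proof (intro allI impI)
    fix h assume h: "lip 1 h"
    show "rint (fst (p i)) h - snd (p i) \<le> rint J.nu h - R" using Jge[OF h that] J.rint_nu[OF h] by simp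
  qed
  moreover have "\<exists>i\<in>I. rint J.nu h - R < rint (fst (p i)) h - snd (p i) + \<epsilon>" if "lip 1 h" "0 < \<epsilon>" for h \<epsilon>
    using Jless[OF that] J.rint_nu[OF that(1)] by simp
  ultimately show ?thesis using J.rval_nu by blast
qed

end

section \<open>Algebraic Yoneda-complete spaces\<close>

lemma enn2ereal_le_iff: "enn2ereal u \<le> ereal t \<longleftrightarrow> 0 \<le> t \<and> u \<le> ennreal t"
proof (cases "0 \<le> t")
  case True
  then show ?thesis by (simp add: less_eq_ennreal.rep_eq enn2ereal_ennreal)
next
  case False
  then have "ereal t < 0" by simp
  then have "\<not> enn2ereal u \<le> ereal t" using enn2ereal_nonneg[of u] by (meson less_le_trans not_le order_trans)
  then show ?thesis using False by simp
qed

lemma enn2ereal_less_iff: "enn2ereal u < ereal t \<longleftrightarrow> u < ennreal t"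
proof (cases "0 \<le> t")
  case True
  then show ?thesis by (simp add: less_ennreal.rep_eq enn2ereal_ennreal)
next
  case False
  then have "ereal t < 0" "ennreal t = 0" by (simp_all add: ennreal_neg)
  moreover have "\<not> enn2ereal u < ereal t"
    using enn2ereal_nonneg[of u] \<open>ereal t < 0\<close> by (meson less_trans not_le)
  ultimately show ?thesis by simp
qed

lemma ball_le_iff: "ball_le d (x, r) (y, s) \<longleftrightarrow> s \<le> r \<and> d x y \<le> ennreal (r - s)"
  by (simp add: ball_le_def enn2ereal_le_iff)

lemma ball_refl: "quasi_metric_on X d \<Longrightarrow> p \<in> formal_balls X \<Longrightarrow> ball_le d p p"
  by (cases p) (auto simp: ball_le_iff quasi_metric_on_def formal_balls_def)

lemma ball_trans:
  assumes "quasi_metric_on X d" "p \<in> formal_balls X" "q \<in> formal_balls X" "u \<in> formal_balls X"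
    and "ball_le d p q" "ball_le d q u"
  shows "ball_le d p u"
proof -
  obtain x r y s z t where *: "p = (x, r)" "q = (y, s)" "u = (z, t)" by (cases p, cases q, cases u)
  then have X: "x \<in> X" "y \<in> X" "z \<in> X" using assms by (auto simp: formal_balls_def)
  have le: "s \<le> r" "t \<le> s" "d x y \<le> ennreal (r - s)" "d y z \<le> ennreal (s - t)"
    using assms(5,6) by (auto simp: * ball_le_iff)
  have "d x z \<le> d x y + d y z" using assms(1) X unfolding quasi_metric_on_def by blast
  also have "\<dots> \<le> ennreal (r - s) + ennreal (s - t)" using le by (intro add_mono)
  also have "\<dots> = ennreal (r - t)" using le by (simp flip: ennreal_plus)
  finally show ?thesis using le by (simp add: * ball_le_iff)
qed

lemma center_set_eq:
  "{(y, s). (y, s) \<in> formal_balls X \<and> enn2ereal (d x y) < ereal (\<epsilon> - s)} =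
   {(y, s). (y, s) \<in> formal_balls X \<and> d x y < ennreal (\<epsilon> - s)}"
  by (simp add: enn2ereal_less_iff)

text \<open>Upward closure comes from the triangle inequality at every point \<open>x\<close>; what
  distinguishes center points is that directed suprema cannot enter such a set from outside.\<close>

lemma center_set_up:
  assumes qm: "quasi_metric_on X d" and x: "x \<in> X" and y: "(y, s) \<in> formal_balls X" and z: "(z, t) \<in> formal_balls X"
    and less: "d x y < ennreal (\<epsilon> - s)" and le: "ball_le d (y, s) (z, t)"
  shows "d x z < ennreal (\<epsilon> - t)"
proof -
  have X: "y \<in> X" "z \<in> X" using y z by (auto simp: formal_balls_def)
  have e: "0 < \<epsilon> - s" using less by (metis ennreal_eq_0_iff not_le not_less_zero)
  have st: "t \<le> s" "d y z \<le> ennreal (s - t)" using le by (auto simp: ball_le_iff)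
  have "d x z \<le> d x y + d y z" using qm x X unfolding quasi_metric_on_def by blast
  also have "\<dots> \<le> d x y + ennreal (s - t)" using st by (intro add_mono) auto
  also have "\<dots> < ennreal (\<epsilon> - s) + ennreal (s - t)" using less by (simp add: ennreal_add_left_cancel_less add.commute)
  also have "\<dots> = ennreal (\<epsilon> - t)" using e st by (simp flip: ennreal_plus)
  finally show ?thesis .
qed

text \<open>The radius of a supremum is the infimum \<open>r\<close> of the radii. Lowering all
  radii by \<open>r\<close> gives a directed family which, by Yoneda-completeness, has a supremum;
  its radius is 0, and raising it again by \<open>r\<close> yields an upper bound of
  \<open>D\<close> of radius \<open>r\<close>.\<close>

lemma supremum_radius:
  assumes qm: "quasi_metric_on X d" and yc: "yoneda_complete X d"
    and D: "directed_in (formal_balls X) (ball_le d) D" and sup: "supremum_in (formal_balls X) (ball_le d) D (x, s)"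
    and e: "0 < \<epsilon>"
  shows "\<exists>(y, t)\<in>D. t < s + \<epsilon>"
proof (rule ccontr)
  assume neg: "\<not> ?thesis"
  have DF: "D \<subseteq> formal_balls X" and Dne: "D \<noteq> {}" using D by (auto simp: directed_in_def)
  define r where "r = (INF q\<in>D. snd q)"
  have bdd: "bdd_below (snd ` D)" using DF by (auto simp: formal_balls_def intro!: bdd_belowI2[of _ 0])
  have r_le: "r \<le> t" if "(y, t) \<in> D" for y t unfolding r_def using cINF_lower[OF bdd that] by simp
  have "s + \<epsilon> \<le> r" unfolding r_def using neg Dne by (intro cINF_greatest) (auto simp: not_less)
  define D' where "D' = (\<lambda>(y, t). (y, t - r)) ` D"
  have "directed_in (formal_balls X) (ball_le d) D'"
    unfolding directed_in_def
  proof (intro conjI ballI)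
    show "D' \<subseteq> formal_balls X" using DF r_le by (auto simp: D'_def formal_balls_def)
    show "D' \<noteq> {}" using Dne by (simp add: D'_def)
    fix p q assume "p \<in> D'" "q \<in> D'"
    then obtain y t y' t' where *: "p = (y, t - r)" "q = (y', t' - r)" "(y, t) \<in> D" "(y', t') \<in> D" by (auto simp: D'_def)
    obtain z u where z: "(z, u) \<in> D" "ball_le d (y, t) (z, u)" "ball_le d (y', t') (z, u)"
      using D *(3,4) unfolding directed_in_def by (metis surj_pair)
    then have "(z, u - r) \<in> D'" "ball_le d p (z, u - r)" "ball_le d q (z, u - r)"
      by (auto simp: D'_def * ball_le_iff intro!: image_eqI[of _ _ "(z, u)"])
    then show "\<exists>z\<in>D'. ball_le d p z \<and> ball_le d q z" by blast
  qed
  then obtain y0 u where u: "supremum_in (formal_balls X) (ball_le d) D' (y0, u)"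
    using yc unfolding yoneda_complete_def dcpo_on_def by (metis surj_pair)
  have y0: "y0 \<in> X" "0 \<le> u" using u by (auto simp: supremum_in_def formal_balls_def)
  have ub: "u \<le> t - r \<and> d y y0 \<le> ennreal (t - r - u)" if "(y, t) \<in> D" for y t
  proof -
    have "(y, t - r) \<in> D'" using that by (force simp: D'_def)
    then have "ball_le d (y, t - r) (y0, u)" using u unfolding supremum_in_def by blast
    then show ?thesis by (simp add: ball_le_iff)
  qed
  \<comment> \<open>\<open>r + u\<close> is a lower bound of all radii of \<open>D\<close>, hence at
    most their infimum.\<close>
  have "r + u \<le> r" unfolding r_def using ub Dne
    by (subst r_def[symmetric]) (intro cINF_greatest, auto simp: r_def[symmetric] dest!: ub)
  then have u0: "u = 0" using y0 by simp
  have r0: "0 \<le> r" unfolding r_def using Dne DF by (intro cINF_greatest) (auto simp: formal_balls_def)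
  have "ball_le d p (y0, r)" if "p \<in> D" for p
    using ub[of "fst p" "snd p"] that r_le[of "fst p" "snd p"] u0 by (cases p) (auto simp: ball_le_iff)
  moreover have "(y0, r) \<in> formal_balls X" using y0 r0 by (simp add: formal_balls_def)
  ultimately have "ball_le d (x, s) (y0, r)" using sup unfolding supremum_in_def by blast
  then have "r \<le> s" by (simp add: ball_le_iff)
  then show False using \<open>s + \<epsilon> \<le> r\<close> e by simp
qed

lemma openin_d_scott: "openin (d_scott_topology X d) U \<longleftrightarrow>
    (\<exists>V. scott_open (formal_balls X) (ball_le d) V \<and> U = {x \<in> X. (x, 0) \<in> V})"
  unfolding d_scott_topology_def openin_pullback_topology ball_topology_def openin_scott_topology
  by (auto simp: vimage_def Int_def conj_commute)

locale alg_qms =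
  fixes X :: "'a set" and d :: "'a \<Rightarrow> 'a \<Rightarrow> ennreal" and B :: "'a set" and a :: real
  assumes qm: "quasi_metric_on X d" and yc: "yoneda_complete X d" and sb: "strong_basis X d B"
    and a_pos: "0 < a"
begin

abbreviation "BX \<equiv> formal_balls X"
abbreviation "le \<equiv> ball_le d"
abbreviation "C \<equiv> center_points X d"
abbreviation "T \<equiv> d_scott_topology X d"

definition dt :: "'a \<Rightarrow> 'a \<Rightarrow> real" where
  "dt x y = enn2real (min (d x y) (ennreal a))"

definition Dx :: "'a \<Rightarrow> ('a \<times> real) set" where
  "Dx x = (SOME D. D \<subseteq> formal_balls B \<and> directed_in BX le D \<and> supremum_in BX le D (x, 0))"

definition Fl :: "'a \<Rightarrow> 'a filter" where
  "Fl x = (INF p\<in>Dx x. principal (fst ` {q \<in> Dx x. le p q}))"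

lemma ennreal_dt: "ennreal (dt x y) = min (d x y) (ennreal a)"
proof -
  have "min (d x y) (ennreal a) \<le> ennreal a" by simp
  then have "min (d x y) (ennreal a) < top" using ennreal_less_top le_less_trans by blast
  then show ?thesis by (simp add: dt_def)
qed

lemma dt_nonneg: "0 \<le> dt x y" by (simp add: dt_def)

lemma dt_le: "dt x y \<le> a"
proof -
  have "ennreal (dt x y) \<le> ennreal a" unfolding ennreal_dt by simp
  then show ?thesis using a_pos by (simp add: ennreal_le_iff)
qed

lemma dt_le_of: "d x y \<le> ennreal e \<Longrightarrow> 0 \<le> e \<Longrightarrow> dt x y \<le> e"
  using ennreal_dt[of x y] ennreal_le_iff[of e "dt x y"] by (metis min.coboundedI1)

lemma d_eq_dt: "dt x y < a \<Longrightarrow> d x y = ennreal (dt x y)"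
proof -
  assume "dt x y < a"
  then have "ennreal (dt x y) < ennreal a" using a_pos by (simp add: ennreal_less_iff dt_nonneg)
  then show ?thesis using ennreal_dt[of x y] by (metis min.strict_order_iff min_def)
qed

lemma d_less_iff: "r \<le> a \<Longrightarrow> d x y < ennreal r \<longleftrightarrow> dt x y < r"
proof
  assume r: "r \<le> a" and "dt x y < r"
  then show "d x y < ennreal r" using d_eq_dt[of x y] by (simp add: ennreal_less_iff dt_nonneg)
next
  assume r: "r \<le> a" and less: "d x y < ennreal r"
  then have "ennreal (dt x y) < ennreal r" unfolding ennreal_dt by (simp add: min.strict_coboundedI1)
  then show "dt x y < r" by (simp add: ennreal_less_iff dt_nonneg)
qed

lemma Dx:
  assumes "x \<in> X"
  shows "Dx x \<subseteq> formal_balls B" "directed_in BX le (Dx x)" "supremum_in BX le (Dx x) (x, 0)"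
proof -
  have "\<exists>D. D \<subseteq> formal_balls B \<and> directed_in BX le D \<and> supremum_in BX le D (x, 0)"
    using sb assms unfolding strong_basis_def by blast
  from someI_ex[OF this] show "Dx x \<subseteq> formal_balls B" "directed_in BX le (Dx x)" "supremum_in BX le (Dx x) (x, 0)"
    unfolding Dx_def by blast+
qed

lemma Dx_mem:
  assumes "x \<in> X" "(b, r) \<in> Dx x" shows "b \<in> B" "0 \<le> r" "d b x \<le> ennreal r" "(b, r) \<in> BX"
proof -
  show "b \<in> B" "0 \<le> r" using Dx(1)[OF assms(1)] assms(2) by (auto simp: formal_balls_def)
  have "le (b, r) (x, 0)" using Dx(3)[OF assms(1)] assms(2) unfolding supremum_in_def by blast
  then show "d b x \<le> ennreal r" by (simp add: ball_le_iff)
  show "(b, r) \<in> BX" using Dx(2)[OF assms(1)] assms(2) unfolding directed_in_def by blast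
qed

lemma eventually_Fl:
  assumes x: "x \<in> X"
  shows "eventually P (Fl x) \<longleftrightarrow> (\<exists>p\<in>Dx x. \<forall>q\<in>Dx x. le p q \<longrightarrow> P (fst q))"
proof -
  note D = Dx[OF x]
  have DB: "Dx x \<subseteq> BX" and ne: "Dx x \<noteq> {}" using D(2) by (auto simp: directed_in_def)
  have "eventually P (Fl x) \<longleftrightarrow> (\<exists>p\<in>Dx x. eventually P (principal (fst ` {q \<in> Dx x. le p q})))"
    unfolding Fl_def
  proof (rule eventually_INF_base[OF ne])
    fix p q assume pq: "p \<in> Dx x" "q \<in> Dx x"
    then obtain u where u: "u \<in> Dx x" "le p u" "le q u" using D(2) unfolding directed_in_def by blast
    have "{v \<in> Dx x. le u v} \<subseteq> {v \<in> Dx x. le p v} \<inter> {v \<in> Dx x. le q v}"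
      using ball_trans[OF qm _ _ _ u(2)] ball_trans[OF qm _ _ _ u(3)] pq u(1) DB by blast
    then show "\<exists>u\<in>Dx x. principal (fst ` {v \<in> Dx x. le u v}) \<le>
        inf (principal (fst ` {v \<in> Dx x. le p v})) (principal (fst ` {v \<in> Dx x. le q v}))"
      using u(1) by (intro bexI[of _ u]) auto
  qed
  also have "\<dots> \<longleftrightarrow> (\<exists>p\<in>Dx x. \<forall>q\<in>Dx x. le p q \<longrightarrow> P (fst q))"
    unfolding eventually_principal by blast
  finally show ?thesis .
qed

text \<open>A Scott-open set containing \<open>(x, 0)\<close> contains a member of
  \<open>Dx x\<close> and, being upward closed, the whole tail above it.\<close>

lemma eventually_Fl_open:
  assumes x: "x \<in> X" and V: "scott_open BX le V" and xV: "(x, 0) \<in> V"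
    and P: "\<And>b r. (b, r) \<in> V \<Longrightarrow> (b, r) \<in> Dx x \<Longrightarrow> P b"
  shows "eventually P (Fl x)"
  unfolding eventually_Fl[OF x]
proof -
  obtain p where p: "p \<in> Dx x" "p \<in> V" using scott_openD(3)[OF V Dx(2,3)[OF x] xV] by blast
  have "P (fst q)" if q: "q \<in> Dx x" "le p q" for q
  proof -
    have "q \<in> BX" using q Dx(2)[OF x] by (auto simp: directed_in_def)
    then have "q \<in> V" using scott_openD(2)[OF V p(2)] q(2) by blast
    then show ?thesis using P[of "fst q" "snd q"] q(1) by simp
  qed
  then show "\<exists>p\<in>Dx x. \<forall>q\<in>Dx x. le p q \<longrightarrow> P (fst q)" using p by blast
qed

lemma Dx_small: "x \<in> X \<Longrightarrow> 0 < \<epsilon> \<Longrightarrow> \<exists>(b, r)\<in>Dx x. r < \<epsilon>"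
  using supremum_radius[OF qm yc Dx(2,3)] by simp

lemma center_open: "c \<in> C \<Longrightarrow> scott_open BX le {(y, s). (y, s) \<in> BX \<and> d c y < ennreal (\<epsilon> - s)}"
proof (cases "0 < \<epsilon>")
  case True
  assume "c \<in> C"
  then show ?thesis using True unfolding center_points_def center_set_eq ball_topology_def openin_scott_topology by blast
next
  case False
  then have "{(y, s). (y, s) \<in> BX \<and> d c y < ennreal (\<epsilon> - s)} = {}"
    by (auto simp: formal_balls_def ennreal_neg)
  moreover have "scott_open BX le {}" by (simp add: scott_open_def)
  ultimately show ?thesis by (simp only:)
qed

lemma B_C: "B \<subseteq> C" using sb by (simp add: strong_basis_def)
lemma C_X: "C \<subseteq> X" by (auto simp: center_points_def)

lemma dt_triangle:
  assumes "x \<in> X" "y \<in> X" "z \<in> X" shows "dt x z \<le> dt x y + dt y z"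
proof (cases "dt x y < a \<and> dt y z < a")
  case True
  have "d x z \<le> d x y + d y z" using qm assms unfolding quasi_metric_on_def by blast
  also have "\<dots> = ennreal (dt x y + dt y z)" using True d_eq_dt by (simp add: dt_nonneg)
  finally show ?thesis by (rule dt_le_of) (simp add: dt_nonneg)
next
  case False
  then show ?thesis using dt_le[of x z] dt_nonneg[of x y] dt_nonneg[of y z] by linarith
qed

lemma dt_refl: "x \<in> X \<Longrightarrow> dt x x = 0"
  using qm by (simp add: dt_def quasi_metric_on_def)

lemma Fl_nontriv: "x \<in> X \<Longrightarrow> Fl x \<noteq> bot"
proof
  assume x: "x \<in> X" and "Fl x = bot"
  then have "eventually (\<lambda>_. False) (Fl x)" by simp
  then obtain p where p: "p \<in> Dx x" "\<not> le p p" unfolding eventually_Fl[OF x] by blast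
  then have "p \<in> BX" using Dx(2)[OF x] by (auto simp: directed_in_def)
  then show False using ball_refl[OF qm] p(2) by blast
qed

lemma Fl_B: "x \<in> X \<Longrightarrow> eventually (\<lambda>b. b \<in> B) (Fl x)"
  unfolding eventually_Fl using Dx_mem(1) Dx_small[OF _ zero_less_one] by fastforce

lemma Fl_dt: "x \<in> X \<Longrightarrow> ((\<lambda>b. dt b x) \<longlongrightarrow> 0) (Fl x)"
proof (rule order_tendstoI)
  fix \<epsilon> :: real assume x: "x \<in> X" and e: "0 < \<epsilon>"
  obtain b r where p: "(b, r) \<in> Dx x" "r < \<epsilon>" using Dx_small[OF x e] by blast
  show "eventually (\<lambda>b. dt b x < \<epsilon>) (Fl x)"
    unfolding eventually_Fl[OF x]
  proof (intro bexI[OF _ p(1)] ballI impI)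
    fix q assume q: "q \<in> Dx x" "le (b, r) q"
    obtain c s where c: "q = (c, s)" by force
    have "dt c x \<le> s" using Dx_mem[OF x] q(1) c by (intro dt_le_of) auto
    moreover have "s \<le> r" using q(2) c by (simp add: ball_le_iff)
    ultimately show "dt (fst q) x < \<epsilon>" using p(2) c by simp
  qed
next
  fix \<epsilon> :: real assume "x \<in> X" "\<epsilon> < 0"
  then have "\<epsilon> < dt b x" for b using dt_nonneg[of b x] by linarith
  then show "eventually (\<lambda>b. \<epsilon> < dt b x) (Fl x)" by simp
qed

text \<open>The upper estimate is the Scott-openness in the definition of center points; the lower
  one is the triangle inequality with \<open>Fl_dt\<close>.\<close>

lemma Fl_center:
  assumes c: "c \<in> C" and x: "x \<in> X" shows "((\<lambda>y. dt c y) \<longlongrightarrow> dt c x) (Fl x)"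
proof (rule order_tendstoI)
  fix v assume v: "dt c x < v"
  show "eventually (\<lambda>y. dt c y < v) (Fl x)"
  proof (cases "v \<le> a")
    case True
    show ?thesis
    proof (rule eventually_Fl_open[OF x center_open[OF c, of v]])
      show "(x, 0) \<in> {(y, s). (y, s) \<in> BX \<and> d c y < ennreal (v - s)}"
        using v True x by (simp add: d_less_iff formal_balls_def)
      fix b r assume "(b, r) \<in> {(y, s). (y, s) \<in> BX \<and> d c y < ennreal (v - s)}"
      then have "0 \<le> r" "d c b < ennreal (v - r)" by (auto simp: formal_balls_def)
      then show "dt c b < v" using True d_less_iff[of "v - r" c b] by simp
    qed
  next
    case False
    then have "dt c y < v" for y using dt_le[of c y] by simp
    then show ?thesis by simp
  qed
next
  fix v assume v: "v < dt c x"
  have "eventually (\<lambda>y. dt y x < dt c x - v) (Fl x)"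
    using Fl_dt[OF x] by (rule order_tendstoD) (use v in simp)
  moreover have "eventually (\<lambda>y. y \<in> X) (Fl x)"
    using Fl_B[OF x] by (rule eventually_mono) (use B_C C_X in auto)
  ultimately show "eventually (\<lambda>y. v < dt c y) (Fl x)"
  proof eventually_elim
    case (elim y)
    then show ?case using dt_triangle[of c y x] c C_X x by auto
  qed
qed

text \<open>\<open>(b, r)\<close> is the supremum of the concentric balls of radius
  \<open>r + 1 / (n + 1)\<close>, one of which must already lie in \<open>V\<close>.\<close>

lemma scott_open_enlarge:
  assumes V: "scott_open BX le V" and b: "(b, r) \<in> V"
  shows "\<exists>\<eta>>0. (b, r + \<eta>) \<in> V"
proof -
  have bX: "b \<in> X" "0 \<le> r" using scott_openD(1)[OF V b] by (auto simp: formal_balls_def)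
  have dbb: "d b b = 0" using qm bX by (simp add: quasi_metric_on_def)
  let ?E = "range (\<lambda>n. (b, r + 1 / real (Suc n)))"
  have "directed_in BX le ?E"
    unfolding directed_in_def
  proof (intro conjI ballI)
    show "?E \<subseteq> BX" using bX by (auto simp: formal_balls_def)
    fix p q assume "p \<in> ?E" "q \<in> ?E"
    then obtain m n where mn: "p = (b, r + 1 / real (Suc m))" "q = (b, r + 1 / real (Suc n))" by auto
    have "le p (b, r + 1 / real (Suc (max m n)))" "le q (b, r + 1 / real (Suc (max m n)))"
      unfolding mn ball_le_iff dbb by (auto simp: frac_le)
    then show "\<exists>z\<in>?E. le p z \<and> le q z" by blast
  qed simp
  moreover have "supremum_in BX le ?E (b, r)"
    unfolding supremum_in_def
  proof (intro conjI ballI impI)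
    show "(b, r) \<in> BX" using bX by (simp add: formal_balls_def)
    show "le p (b, r)" if "p \<in> ?E" for p using that by (auto simp: ball_le_iff dbb)
    fix u assume u: "u \<in> BX" "\<forall>p\<in>?E. le p u"
    obtain y s where y: "u = (y, s)" by force
    have *: "s \<le> r + 1 / real (Suc n)" "d b y \<le> ennreal (r + 1 / real (Suc n) - s)" for n
      using u(2) y by (auto simp: ball_le_iff simp del: of_nat_Suc)
    have sr: "s \<le> r" using Sup_approx_nat[OF *(1)] .
    have "(\<lambda>n. ennreal (r + 1 / real (Suc n) - s)) \<longlonglongrightarrow> ennreal (r + 0 - s)"
      by (intro tendsto_ennrealI tendsto_intros LIMSEQ_Suc[OF lim_const_over_n])
    then have "d b y \<le> ennreal (r - s)" using *(2) by (intro LIMSEQ_le_const) auto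
    then show "le (b, r) u" using sr y by (simp add: ball_le_iff)
  qed
  ultimately obtain p where "p \<in> ?E" "p \<in> V" using scott_openD(3)[OF V _ _ b] by blast
  then obtain n where "(b, r + 1 / real (Suc n)) \<in> V" by blast
  then show ?thesis by (intro exI[of _ "1 / real (Suc n)"]) simp
qed

lemma open_iff: "openin T U \<longleftrightarrow> U \<subseteq> X \<and>
    (\<forall>x\<in>U. \<exists>b\<in>B. \<exists>\<rho>>0. \<rho> \<le> a \<and> dt b x < \<rho> \<and> {y \<in> X. dt b y < \<rho>} \<subseteq> U)"
proof
  assume "openin T U"
  then obtain V where V: "scott_open BX le V" "U = {x \<in> X. (x, 0) \<in> V}" unfolding openin_d_scott by blast
  show "U \<subseteq> X \<and> (\<forall>x\<in>U. \<exists>b\<in>B. \<exists>\<rho>>0. \<rho> \<le> a \<and> dt b x < \<rho> \<and> {y \<in> X. dt b y < \<rho>} \<subseteq> U)"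
  proof (intro conjI ballI)
    fix x assume "x \<in> U"
    then have x: "x \<in> X" "(x, 0) \<in> V" using V(2) by auto
    obtain p where p: "p \<in> Dx x" "p \<in> V" using scott_openD(3)[OF V(1) Dx(2,3)[OF x(1)] x(2)] by blast
    obtain p' where p': "p' \<in> Dx x" "snd p' < a" using Dx_small[OF x(1) a_pos] by auto
    obtain b r where q: "(b, r) \<in> Dx x" "le p (b, r)" "le p' (b, r)"
      using Dx(2)[OF x(1)] p(1) p'(1) unfolding directed_in_def by (metis surj_pair)
    note br = Dx_mem[OF x(1) q(1)]
    have bV: "(b, r) \<in> V" by (rule scott_openD(2)[OF V(1) p(2) br(4) q(2)])
    have ra: "r < a" using q(3) p'(2) by (cases p') (simp add: ball_le_iff)
    obtain \<eta> where \<eta>: "0 < \<eta>" "(b, r + \<eta>) \<in> V" using scott_open_enlarge[OF V(1) bV] by blast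
    \<comment> \<open>The radius must exceed \<open>r\<close> strictly, to contain \<open>x\<close>,
      while staying at most \<open>r + \<eta>\<close>, to remain in \<open>V\<close>, and at most
      \<open>a\<close>, where truncation is invisible.\<close>
    define \<rho> where "\<rho> = r + min \<eta> (a - r)"
    have bb: "d b b = 0" "b \<in> X" using qm br(4) by (auto simp: quasi_metric_on_def formal_balls_def)
    have \<rho>: "0 < \<rho>" "\<rho> \<le> a" "r < \<rho>" using \<eta> ra br(2) by (auto simp: \<rho>_def)
    have \<rho>V: "(b, \<rho>) \<in> V"
      by (rule scott_openD(2)[OF V(1) \<eta>(2)]) (use bb \<rho> in \<open>auto simp: formal_balls_def ball_le_iff \<rho>_def\<close>)
    have "dt b x < \<rho>" using dt_le_of[OF br(3,2)] \<rho> by simp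
    moreover have "{y \<in> X. dt b y < \<rho>} \<subseteq> U"
    proof safe
      fix y assume y: "y \<in> X" "dt b y < \<rho>"
      then have "d b y < ennreal \<rho>" using d_less_iff[OF \<rho>(2)] by simp
      then have "le (b, \<rho>) (y, 0)" using \<rho> by (simp add: ball_le_iff less_imp_le)
      then have "(y, 0) \<in> V" using scott_openD(2)[OF V(1) \<rho>V] y(1) by (simp add: formal_balls_def)
      then show "y \<in> U" using V(2) y(1) by simp
    qed
    ultimately show "\<exists>b\<in>B. \<exists>\<rho>>0. \<rho> \<le> a \<and> dt b x < \<rho> \<and> {y \<in> X. dt b y < \<rho>} \<subseteq> U"
      using br(1) \<rho> by blast
  qed (use V in auto)
next
  assume U: "U \<subseteq> X \<and> (\<forall>x\<in>U. \<exists>b\<in>B. \<exists>\<rho>>0. \<rho> \<le> a \<and> dt b x < \<rho> \<and> {y \<in> X. dt b y < \<rho>} \<subseteq> U)"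
  \<comment> \<open>Each basic ball around a center lifts to a Scott-open set of formal balls whose
    trace at radius 0 is that ball.\<close>
  let ?K = "{{(y, s). (y, s) \<in> BX \<and> d b y < ennreal (\<rho> - s)} |b \<rho>. b \<in> B \<and> \<rho> \<le> a \<and> {y \<in> X. dt b y < \<rho>} \<subseteq> U}"
  have "openin (scott_topology BX le) (\<Union>?K)"
    by (rule openin_Union) (use center_open B_C in auto)
  moreover have "U = {x \<in> X. (x, 0) \<in> \<Union>?K}"
  proof (intro equalityI subsetI)
    fix x assume x: "x \<in> U"
    then obtain b \<rho> where b: "b \<in> B" "\<rho> \<le> a" "dt b x < \<rho>" "{y \<in> X. dt b y < \<rho>} \<subseteq> U" "x \<in> X" using U by blast
    then have "(x, 0) \<in> {(y, s). (y, s) \<in> BX \<and> d b y < ennreal (\<rho> - s)}"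
      by (simp add: formal_balls_def d_less_iff)
    then show "x \<in> {x \<in> X. (x, 0) \<in> \<Union>?K}" using b by blast
  next
    fix x assume "x \<in> {x \<in> X. (x, 0) \<in> \<Union>?K}"
    then obtain b \<rho> where "x \<in> X" "\<rho> \<le> a" "{y \<in> X. dt b y < \<rho>} \<subseteq> U" "d b x < ennreal (\<rho> - 0)" by auto
    then show "x \<in> U" using d_less_iff[of \<rho> b x] by auto
  qed
  ultimately show "openin T U" unfolding openin_d_scott openin_scott_topology by blast
qed

text \<open>The steps are at most \<open>a\<close>, so the truncated distances agree with the true
  ones and the pairs \<open>(b m, s m)\<close> form a chain of formal balls. Its supremum has radius
  0 because the radii tend to 0.\<close>

lemma ball_chain_limit:
  assumes b: "\<And>m. b m \<in> B" and step: "\<And>m. dt (b m) (b (Suc m)) < s m - s (Suc m)"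
    and s: "s \<longlonglongrightarrow> 0" "s 0 \<le> a"
  shows "\<exists>x\<in>X. (\<forall>m. dt (b m) x \<le> s m) \<and>
    (\<forall>U. openin T U \<and> x \<in> U \<longrightarrow> (\<exists>m. {y \<in> X. dt (b m) y < s m} \<subseteq> U))"
proof -
  have bX: "b m \<in> X" for m using b B_C C_X by blast
  have dec: "s (Suc m) \<le> s m" for m using step[of m] dt_nonneg[of "b m" "b (Suc m)"] by linarith
  have dec': "s n \<le> s m" if "m \<le> n" for m n using that dec by (rule lift_Suc_antimono_le[of s, rotated])
  have pos: "0 \<le> s m" for m by (rule LIMSEQ_le_const2[OF s(1)]) (use dec' in blast)
  have sa: "s m \<le> a" for m using dec'[of 0 m] s(2) by simp
  let ?f = "\<lambda>m. (b m, s m)"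
  have fB: "?f m \<in> BX" for m using bX pos by (simp add: formal_balls_def)
  have lestep: "le (?f m) (?f (Suc m))" for m
  proof -
    have "s m - s (Suc m) \<le> a" using sa[of m] pos[of "Suc m"] by simp
    then show ?thesis using step[of m] d_less_iff[of "s m - s (Suc m)" "b m" "b (Suc m)"] dec[of m]
      by (simp add: ball_le_iff less_imp_le)
  qed
  have chain: "le (?f m) (?f n)" if "m \<le> n" for m n
    using that
  proof (induction n rule: dec_induct)
    case base
    then show ?case using ball_refl[OF qm fB] .
  next
    case (step n)
    then show ?case using ball_trans[OF qm fB fB fB _ lestep] by blast
  qed
  have "directed_in BX le (range ?f)"
    unfolding directed_in_def
  proof (intro conjI ballI)
    fix p q assume "p \<in> range ?f" "q \<in> range ?f"
    then obtain m n where "p = ?f m" "q = ?f n" by blast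
    then have "le p (?f (max m n))" "le q (?f (max m n))" using chain by auto
    then show "\<exists>z\<in>range ?f. le p z \<and> le q z" by blast
  qed (use fB in auto)
  then obtain x u where sup: "supremum_in BX le (range ?f) (x, u)" and dir: "directed_in BX le (range ?f)"
    using yc unfolding yoneda_complete_def dcpo_on_def by (metis surj_pair)
  have x: "x \<in> X" "0 \<le> u" and ub: "\<And>m. u \<le> s m \<and> d (b m) x \<le> ennreal (s m - u)"
    using sup unfolding supremum_in_def by (auto simp: formal_balls_def ball_le_iff)
  have "u \<le> 0" by (rule LIMSEQ_le_const[OF s(1)]) (use ub in blast)
  then have u: "u = 0" using x by simp
  have 1: "dt (b m) x \<le> s m" for m using ub[of m] u pos by (intro dt_le_of) auto
  have 2: "\<exists>m. {y \<in> X. dt (b m) y < s m} \<subseteq> U" if U: "openin T U" "x \<in> U" for U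
  proof -
    obtain V where V: "scott_open BX le V" "U = {x \<in> X. (x, 0) \<in> V}" using U(1) unfolding openin_d_scott by blast
    then have "(x, u) \<in> V" using U(2) u by simp
    then obtain m where m: "?f m \<in> V" using scott_openD(3)[OF V(1) dir sup] by blast
    have "y \<in> U" if y: "y \<in> X" "dt (b m) y < s m" for y
    proof -
      have "d (b m) y < ennreal (s m)" using d_less_iff[OF sa] y by simp
      then have "le (?f m) (y, 0)" using pos by (simp add: ball_le_iff less_imp_le)
      then show ?thesis using scott_openD(2)[OF V(1) m] y(1) V(2) by (simp add: formal_balls_def)
    qed
    then show ?thesis by blast
  qed
  show ?thesis using x 1 2 by blast
qed

sublocale kr_space X B C dt a Fl T
  by unfold_locales
    (fact a_pos B_C C_X topspace_d_scott_topology dt_nonneg dt_le | rule dt_refl dt_triangle Fl_nontriv Fl_B Fl_dt Fl_center open_iff ball_chain_limit; assumption)+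

end

section \<open>The Kantorovich-Rubinstein quasi-metric\<close>

lemma dR_le_iff: "dR v w \<le> e \<longleftrightarrow> v \<le> w + e"
proof (cases "v \<le> w")
  case True
  then show ?thesis by (simp add: dR_def add_increasing2)
next
  case False
  show ?thesis
  proof (cases "v = \<infinity>")
    case True
    then show ?thesis using False by (auto simp: dR_def top_unique)
  next
    case v: False
    have "v - w \<le> e \<longleftrightarrow> v \<le> e + w"
      using False v by (simp add: ennreal_minus_le_iff add.commute)
    then show ?thesis using False v by (simp add: dR_def add.commute)
  qed
qed

lemma dR_ball_le_iff: "ball_le dR (v, r) (w, s) \<longleftrightarrow> s \<le> r \<and> v \<le> w + ennreal (r - s)"
  by (simp add: ball_le_iff dR_le_iff)

text \<open>Preimages of these sets reveal both the Lipschitz inequality and the lower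
  semicontinuity of a map in \<open>L1\<close>. If a directed \<open>D\<close> avoids the set, then
  \<open>(c + \<tau>, \<tau>)\<close>, with \<open>\<tau>\<close> the infimum of its radii, is an
  upper bound, so the supremum avoids it too.\<close>

lemma scott_open_above:
  "scott_open (formal_balls UNIV) (ball_le dR) {(v, t). 0 \<le> t \<and> ereal (c + t) < enn2ereal v}"
proof (rule scott_openI)
  have le_real: "enn2ereal v \<le> enn2ereal w + ereal e" if "v \<le> w + ennreal e" "0 \<le> e" for v w e
    using that by (simp add: less_eq_ennreal.rep_eq plus_ennreal.rep_eq enn2ereal_ennreal)
  show "{(v, t). 0 \<le> t \<and> ereal (c + t) < enn2ereal v} \<subseteq> formal_balls UNIV" by (auto simp: formal_balls_def)
  fix p q assume p: "p \<in> {(v, t). 0 \<le> t \<and> ereal (c + t) < enn2ereal v}" and q: "q \<in> formal_balls UNIV" and le: "ball_le dR p q"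
  obtain v t w u where *: "p = (v, t)" "q = (w, u)" by (cases p, cases q)
  have 1: "u \<le> t" "v \<le> w + ennreal (t - u)" "0 \<le> u" using le q by (auto simp: * dR_ball_le_iff formal_balls_def)
  have "ereal (c + t) < enn2ereal v" using p * by simp
  also have "\<dots> \<le> enn2ereal w + ereal (t - u)" using 1 by (intro le_real) auto
  finally have "ereal (c + u) < enn2ereal w" by (cases "enn2ereal w") auto
  then show "q \<in> {(v, t). 0 \<le> t \<and> ereal (c + t) < enn2ereal v}" using 1 * by simp
next
  fix D s assume D: "directed_in (formal_balls UNIV) (ball_le dR) D" and sup: "supremum_in (formal_balls UNIV) (ball_le dR) D s"
    and s: "s \<in> {(v, t). 0 \<le> t \<and> ereal (c + t) < enn2ereal v}"
  show "\<exists>x\<in>D. x \<in> {(v, t). 0 \<le> t \<and> ereal (c + t) < enn2ereal v}"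
  proof (rule ccontr)
    assume neg: "\<not> ?thesis"
    obtain v t where st: "s = (v, t)" by force
    have Dne: "D \<noteq> {}" and pos: "\<And>w u. (w, u) \<in> D \<Longrightarrow> 0 \<le> u" using D by (auto simp: directed_in_def formal_balls_def)
    have le: "0 \<le> c + u \<and> w \<le> ennreal (c + u)" if "(w, u) \<in> D" for w u
    proof -
      have "\<not> ereal (c + u) < enn2ereal w" using neg pos[OF that] that by blast
      then show ?thesis using enn2ereal_le_iff[of w "c + u"] by (simp add: not_less)
    qed
    define \<tau> where "\<tau> = (INF p\<in>D. snd p)"
    have bdd: "bdd_below (snd ` D)" using pos by (auto intro!: bdd_belowI2[of _ 0])
    have \<tau>_le: "\<tau> \<le> u" if "(w, u) \<in> D" for w u unfolding \<tau>_def using cINF_lower[OF bdd that] by simp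
    have \<tau>0: "0 \<le> \<tau>" unfolding \<tau>_def using pos Dne by (intro cINF_greatest) auto
    \<comment> \<open>As \<open>c\<close> may be negative, this is needed before
      \<open>c + \<tau>\<close> can be used as a point of \<open>ennreal\<close>:
      \<open>ennreal\<close> would send a negative number to 0.\<close>
    have "- c \<le> \<tau>" unfolding \<tau>_def
    proof (rule cINF_greatest[OF Dne])
      fix p assume "p \<in> D"
      then show "- c \<le> snd p" using le[of "fst p" "snd p"] by simp
    qed
    then have \<tau>c: "0 \<le> c + \<tau>" by simp
    have "ball_le dR p (ennreal (c + \<tau>), \<tau>)" if "p \<in> D" for p
    proof -
      obtain w u where p: "p = (w, u)" by force
      have "ennreal (c + \<tau>) + ennreal (u - \<tau>) = ennreal (c + u)" using \<tau>c \<tau>_le[of w u] that p by (simp flip: ennreal_plus)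
      then show ?thesis using le[of w u] \<tau>_le[of w u] that p by (simp add: dR_ball_le_iff)
    qed
    moreover have "(ennreal (c + \<tau>), \<tau>) \<in> formal_balls UNIV" using \<tau>0 by (simp add: formal_balls_def)
    ultimately have "ball_le dR (v, t) (ennreal (c + \<tau>), \<tau>)" using sup unfolding supremum_in_def st by blast
    then have "\<tau> \<le> t" "v \<le> ennreal (c + \<tau>) + ennreal (t - \<tau>)" by (auto simp: dR_ball_le_iff)
    then have "v \<le> ennreal (c + t)" using \<tau>c by (simp flip: ennreal_plus)
    then have "enn2ereal v \<le> ereal (c + t)" using \<tau>c \<open>\<tau> \<le> t\<close> by (simp add: enn2ereal_le_iff)
    moreover have "ereal (c + t) < enn2ereal v" using s st by simp
    ultimately show False by (simp add: leD)
  qed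
qed

context alg_qms begin

text \<open>A cone at a center \<open>b\<close> nearly attains \<open>f x\<close>, and the formal
  balls close to \<open>b\<close> form a Scott-open set containing \<open>(x, s)\<close>. A member
  of \<open>D\<close> in that set inherits the estimate from the Lipschitz inequality.\<close>

lemma scott_continuous_lip:
  assumes f: "lip 1 f" and D: "directed_in BX le D" and sup: "supremum_in BX le D (x, s)" and e: "0 < \<epsilon>"
  shows "\<exists>(y, t)\<in>D. f x - s < f y - t + \<epsilon>"
proof -
  have x: "x \<in> X" "0 \<le> s" using sup by (auto simp: supremum_in_def formal_balls_def)
  obtain b where b: "b \<in> B" "f x - \<epsilon> / 2 < f b - 1 * dt b x" "dt b x < a"
    using cone_approx[OF f x(1), of "f x - \<epsilon>/2" 1] e by auto
  let ?V = "{(y, t). (y, t) \<in> BX \<and> d b y < ennreal ((dt b x + \<epsilon> / 2 + s) - t)}"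
  have V: "scott_open BX le ?V" using center_open b(1) B_C by blast
  have "d b x < ennreal (dt b x + \<epsilon> / 2)" using e b(3) by (simp add: d_eq_dt ennreal_less_iff dt_nonneg)
  then have "(x, s) \<in> ?V" using x by (simp add: formal_balls_def)
  then obtain p where "p \<in> D" "p \<in> ?V" using scott_openD(3)[OF V D sup] by blast
  then obtain y t where y: "(y, t) \<in> D" "y \<in> X" "d b y < ennreal ((dt b x + \<epsilon> / 2 + s) - t)"
    by (auto simp: formal_balls_def)
  have "0 < (dt b x + \<epsilon> / 2 + s) - t" using y(3) by (metis ennreal_eq_0_iff not_le not_less_zero)
  then have "dt b y \<le> (dt b x + \<epsilon> / 2 + s) - t" using y(3) by (intro dt_le_of) auto
  moreover have "f b \<le> f y + 1 * dt b y" using lipD(4)[OF f B_X[OF b(1)] y(2)] .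
  ultimately have "f x - s < f y - t + \<epsilon>" using b(2) by linarith
  then show ?thesis using y(1) by blast
qed

text \<open>If \<open>f x\<close> exceeded \<open>f y + dt x y\<close>, the Scott-open set
  \<open>pre\<close> with \<open>c = f y\<close> would contain \<open>(x, dt x y)\<close> and hence
  \<open>(y, 0)\<close>, which is absurd. Where the truncation is active, the bound \<open>a\<close>
  on the values suffices.\<close>

lemma L1_imp_lip:
  assumes h: "h \<in> L1 a X d"
  shows "lip 1 (\<lambda>x. enn2real (h x))" "x \<in> X \<Longrightarrow> h x = ennreal (enn2real (h x))"
proof -
  let ?f = "\<lambda>x. enn2real (h x)"
  have ha: "h x \<le> ennreal a" if "x \<in> X" for x using h that by (simp add: L1_def)
  show hf: "h x = ennreal (?f x)" if "x \<in> X" for x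
    using le_less_trans[OF ha[OF that] ennreal_less_top] by simp
  have fa: "?f x \<le> a" if "x \<in> X" for x
    using ha[OF that] hf[OF that] a_pos by (metis ennreal_le_iff less_imp_le)
  have cont: "continuous_map (ball_topology X d) (ball_topology UNIV dR) (\<lambda>(x, r). (h x, r))"
    using h by (simp add: L1_def lipschitz1_continuous_def)
  have pre: "scott_open BX le {(x, t). (x, t) \<in> BX \<and> c + t < ?f x}" for c
  proof -
    have "openin (ball_topology UNIV dR) {(v, t). 0 \<le> t \<and> ereal (c + t) < enn2ereal v}"
      unfolding ball_topology_def openin_scott_topology by (rule scott_open_above)
    from openin_continuous_map_preimage[OF cont this]
    have "scott_open BX le {p \<in> BX. (case p of (x, r) \<Rightarrow> (h x, r)) \<in> {(v, t). 0 \<le> t \<and> ereal (c + t) < enn2ereal v}}"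
      unfolding ball_topology_def openin_scott_topology topspace_scott_topology .
    moreover have "{p \<in> BX. (case p of (x, r) \<Rightarrow> (h x, r)) \<in> {(v, t). 0 \<le> t \<and> ereal (c + t) < enn2ereal v}}
        = {(x, t). (x, t) \<in> BX \<and> c + t < ?f x}"
    proof -
      have "ereal (c + t) < enn2ereal (h x) \<longleftrightarrow> c + t < ?f x" if "x \<in> X" for x t
        by (subst hf[OF that]) (simp add: enn2ereal_ennreal)
      then show ?thesis by (auto simp: formal_balls_def)
    qed
    ultimately show ?thesis by simp
  qed
  have L: "?f x \<le> ?f y + dt x y" if xy: "x \<in> X" "y \<in> X" for x y
  proof (cases "dt x y < a")
    case True
    show ?thesis
    proof (rule ccontr)
      assume "\<not> ?thesis"
      then have "(x, dt x y) \<in> {(x, t). (x, t) \<in> BX \<and> ?f y + t < ?f x}"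
        using xy by (simp add: formal_balls_def dt_nonneg)
      moreover have "le (x, dt x y) (y, 0)" using d_eq_dt[OF True] by (simp add: ball_le_iff dt_nonneg)
      moreover have "(y, 0) \<in> BX" using xy by (simp add: formal_balls_def)
      ultimately have "(y, 0) \<in> {(x, t). (x, t) \<in> BX \<and> ?f y + t < ?f x}" using scott_openD(2)[OF pre] by blast
      then show False by simp
    qed
  next
    case False
    then show ?thesis using fa[OF xy(1)] by (simp add: add_increasing not_less order_trans)
  qed
  have lim: "(?f \<longlongrightarrow> ?f x) (Fl x)" if x: "x \<in> X" for x
  proof (rule order_tendstoI)
    fix v assume v: "v < ?f x"
    show "eventually (\<lambda>y. v < ?f y) (Fl x)"
      by (rule eventually_Fl_open[OF x pre[of v]]) (use v x in \<open>auto simp: formal_balls_def\<close>)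
  next
    fix v assume v: "?f x < v"
    have "eventually (\<lambda>y. dt y x < v - ?f x) (Fl x)"
      using Fl_dt[OF x] by (rule order_tendstoD) (use v in simp)
    then show "eventually (\<lambda>y. ?f y < v) (Fl x)"
      using Fl_X[OF x]
    proof eventually_elim
      case (elim y)
      then show ?case using L[OF elim(2) x] by linarith
    qed
  qed
  show "lip 1 ?f" unfolding lip_def using fa L lim by auto
qed

text \<open>Scott-continuity follows once the map on formal balls preserves directed suprema;
  \<open>supremum_radius\<close> controls the radius of an upper bound and
  \<open>scott_continuous_lip\<close> its point.\<close>

lemma lip_imp_L1:
  assumes f: "lip 1 f" shows "(\<lambda>x. ennreal (f x)) \<in> L1 a X d"
proof -
  let ?\<phi> = "\<lambda>(x, r). (ennreal (f x), r)"
  have mono: "ball_le dR (ennreal (f x), r) (ennreal (f y), s)" if "le (x, r) (y, s)" "x \<in> X" "y \<in> X" for x y r s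
  proof -
    have sr: "s \<le> r" "d x y \<le> ennreal (r - s)" using that(1) by (auto simp: ball_le_iff)
    have "f x \<le> f y + (r - s)" using lipD(4)[OF f that(2,3)] dt_le_of[OF sr(2)] sr(1) by linarith
    then have "ennreal (f x) \<le> ennreal (f y + (r - s))" by (rule ennreal_leI)
    also have "\<dots> = ennreal (f y) + ennreal (r - s)" using lipD(2)[OF f that(3)] sr(1) by simp
    finally show ?thesis using sr by (simp add: dR_ball_le_iff)
  qed
  have "continuous_map (ball_topology X d) (ball_topology UNIV dR) ?\<phi>"
    unfolding continuous_map_def ball_topology_def openin_scott_topology topspace_scott_topology
  proof (intro conjI allI impI)
    show "?\<phi> \<in> BX \<rightarrow> formal_balls UNIV" by (auto simp: formal_balls_def)
    fix V assume V: "scott_open (formal_balls UNIV) (ball_le dR) V"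
    show "scott_open BX le {x \<in> BX. ?\<phi> x \<in> V}"
    proof (rule scott_openI)
      fix p q assume "p \<in> {x \<in> BX. ?\<phi> x \<in> V}" "q \<in> BX" "le p q"
      moreover have "?\<phi> q \<in> formal_balls UNIV" using \<open>q \<in> BX\<close> by (auto simp: formal_balls_def)
      ultimately show "q \<in> {x \<in> BX. ?\<phi> x \<in> V}"
        using mono[of "fst p" "snd p" "fst q" "snd q"] scott_openD(2)[OF V, of "?\<phi> p" "?\<phi> q"]
        by (auto simp: formal_balls_def)
    next
      fix D p assume D: "directed_in BX le D" and sup: "supremum_in BX le D p" and p: "p \<in> {x \<in> BX. ?\<phi> x \<in> V}"
      obtain x s where xs: "p = (x, s)" by force
      have x: "x \<in> X" "0 \<le> s" using p xs by (auto simp: formal_balls_def)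
      have DX: "y \<in> X \<and> 0 \<le> t" if "(y, t) \<in> D" for y t using D that by (auto simp: directed_in_def formal_balls_def)
      have "directed_in (formal_balls UNIV) (ball_le dR) (?\<phi> ` D)"
        unfolding directed_in_def
      proof (intro conjI ballI)
        show "?\<phi> ` D \<subseteq> formal_balls UNIV" using DX by (auto simp: formal_balls_def)
        show "?\<phi> ` D \<noteq> {}" using D by (auto simp: directed_in_def)
        fix u v assume "u \<in> ?\<phi> ` D" "v \<in> ?\<phi> ` D"
        then obtain y t y' t' where *: "u = (ennreal (f y), t)" "v = (ennreal (f y'), t')" "(y, t) \<in> D" "(y', t') \<in> D" by auto
        obtain z r where z: "(z, r) \<in> D" "le (y, t) (z, r)" "le (y', t') (z, r)"
          using D *(3,4) unfolding directed_in_def by (metis surj_pair)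
        have "ball_le dR u (ennreal (f z), r)" "ball_le dR v (ennreal (f z), r)"
          unfolding * using z DX *(3,4) by (auto intro!: mono)
        moreover have "(ennreal (f z), r) \<in> ?\<phi> ` D" using z(1) by force
        ultimately show "\<exists>w\<in>?\<phi> ` D. ball_le dR u w \<and> ball_le dR v w" by blast
      qed
      moreover have "supremum_in (formal_balls UNIV) (ball_le dR) (?\<phi> ` D) (ennreal (f x), s)"
        unfolding supremum_in_def
      proof (intro conjI ballI impI)
        show "(ennreal (f x), s) \<in> formal_balls UNIV" using x by (simp add: formal_balls_def)
        fix u assume "u \<in> ?\<phi> ` D"
        then obtain y t where y: "u = (ennreal (f y), t)" "(y, t) \<in> D" by auto
        then have "le (y, t) (x, s)" using sup xs unfolding supremum_in_def by blast
        then show "ball_le dR u (ennreal (f x), s)" unfolding y(1) using DX[OF y(2)] x by (intro mono) auto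
      next
        fix u assume "u \<in> formal_balls UNIV" and ub: "\<forall>v\<in>?\<phi> ` D. ball_le dR v u"
        then obtain w r where u: "u = (w, r)" "0 \<le> r" by (auto simp: formal_balls_def)
        have ub: "r \<le> t \<and> ennreal (f y) \<le> w + ennreal (t - r)" if "(y, t) \<in> D" for y t
        proof -
          have "(ennreal (f y), t) \<in> ?\<phi> ` D" using that by force
          then show ?thesis using ub u by (auto simp: dR_ball_le_iff)
        qed
        have rs: "r \<le> s"
        proof (rule field_le_epsilon)
          fix e :: real assume "0 < e"
          then obtain y t where "(y, t) \<in> D" "t < s + e" using supremum_radius[OF qm yc D] sup xs by blast
          then show "r \<le> s + e" using ub by fastforce
        qed
        have "ennreal (f x) \<le> w + ennreal (s - r)"
        proof (cases w)
          case (real w')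
          have "f x \<le> w' + (s - r)"
          proof (rule field_le_epsilon)
            fix e :: real assume e: "0 < e"
            obtain y t where y: "(y, t) \<in> D" "f x - s < f y - t + e"
              using scott_continuous_lip[OF f D _ e] sup xs by blast
            have "ennreal (f y) \<le> ennreal (w' + (t - r))" using ub[OF y(1)] real by simp
            then have "f y \<le> w' + (t - r)" using real ub[OF y(1)] by (subst (asm) ennreal_le_iff) auto
            then show "f x \<le> w' + (s - r) + e" using y(2) by linarith
          qed
          then have "ennreal (f x) \<le> ennreal (w' + (s - r))" by (rule ennreal_leI)
          then show ?thesis using real rs by simp
        qed simp
        then show "ball_le dR (ennreal (f x), s) u" using rs u by (simp add: dR_ball_le_iff)
      qed
      moreover have "(ennreal (f x), s) \<in> V" using p xs by simp
      ultimately have "\<exists>v\<in>?\<phi> ` D. v \<in> V" using scott_openD(3)[OF V] by blast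
      then show "\<exists>q\<in>D. q \<in> {x \<in> BX. ?\<phi> x \<in> V}" using D by (auto simp: directed_in_def)
    qed auto
  qed
  then show ?thesis
    unfolding L1_def lipschitz1_continuous_def using lipD(3)[OF f] by (auto intro!: ennreal_leI)
qed

section \<open>Translation between \<open>V1\<close> and real-valued valuations\<close>

abbreviation "VX \<equiv> V1 T"
abbreviation "BV \<equiv> formal_balls (V1 T)"
abbreviation "leV \<equiv> ball_le (dKR a X d)"

definition rep :: "('a set \<Rightarrow> ennreal) \<Rightarrow> 'a set \<Rightarrow> real" where
  "rep \<nu> U = enn2real (\<nu> U)"

definition val :: "('a set \<Rightarrow> real) \<Rightarrow> 'a set \<Rightarrow> ennreal" where
  "val m = restrict (\<lambda>U. ennreal (m U)) {U. openin T U}"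

lemma rep_nonneg: "0 \<le> rep \<nu> U"
  by (simp add: rep_def)

lemma V1_rep:
  assumes "\<nu> \<in> VX"
  shows "openin T U \<Longrightarrow> \<nu> U = ennreal (rep \<nu> U)" "rval (rep \<nu>)"
proof -
  have v: "continuous_valuation T \<nu>" "\<nu> X = 1" using assms by (auto simp: V1_def)
  have mono: "\<nu> U \<le> \<nu> V" if "openin T U" "openin T V" "U \<subseteq> V" for U V
    using v(1) that unfolding continuous_valuation_def by blast
  have fin: "\<nu> U < top" if "openin T U" for U
  proof -
    have "U \<subseteq> X" using openin_subset[OF that] by simp
    then have "\<nu> U \<le> 1" using mono[OF that openin_X] v(2) by simp
    then show ?thesis using le_less_trans ennreal_one_less_top by blast
  qed
  show eq: "\<nu> U = ennreal (rep \<nu> U)" if "openin T U" for U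
    using fin[OF that] by (simp add: rep_def)
  show "rval (rep \<nu>)"
    unfolding rval_def
  proof (intro conjI allI impI)
    show "rep \<nu> {} = 0" using v(1) by (simp add: rep_def continuous_valuation_def)
    show "rep \<nu> X = 1" using v(2) by (simp add: rep_def)
  next
    fix U V assume UV: "openin T U \<and> openin T V"
    then have "\<nu> (U \<union> V) + \<nu> (U \<inter> V) = \<nu> U + \<nu> V" using v(1) unfolding continuous_valuation_def by blast
    then have "ennreal (rep \<nu> (U \<union> V)) + ennreal (rep \<nu> (U \<inter> V)) = ennreal (rep \<nu> U) + ennreal (rep \<nu> V)"
      unfolding eq[OF conjunct1[OF UV]] eq[OF conjunct2[OF UV]]
        eq[OF openin_Un[OF conjunct1[OF UV] conjunct2[OF UV]]] eq[OF openin_Int[OF conjunct1[OF UV] conjunct2[OF UV]]] .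
    then have "ennreal (rep \<nu> (U \<union> V) + rep \<nu> (U \<inter> V)) = ennreal (rep \<nu> U + rep \<nu> V)"
      by (simp add: rep_nonneg)
    then show "rep \<nu> (U \<union> V) + rep \<nu> (U \<inter> V) = rep \<nu> U + rep \<nu> V"
      by (subst (asm) ennreal_inj) (simp_all add: rep_nonneg)
  next
    fix U V assume UV: "openin T U \<and> openin T V \<and> U \<subseteq> V"
    then have "\<nu> U \<le> \<nu> V" using mono by blast
    then show "rep \<nu> U \<le> rep \<nu> V" unfolding rep_def using fin UV by (intro enn2real_mono) auto
  next
    fix \<U> and \<epsilon> :: real assume d: "directed_in {U. openin T U} (\<subseteq>) \<U> \<and> 0 < \<epsilon>"
    then have sup: "\<nu> (\<Union>\<U>) = (SUP U\<in>\<U>. \<nu> U)" using v(1) unfolding continuous_valuation_def by blast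
    have op: "openin T U" if "U \<in> \<U>" for U using d that by (auto simp: directed_in_def)
    then have "openin T (\<Union>\<U>)" by blast
    note eqU = eq[OF this]
    show "\<exists>U\<in>\<U>. rep \<nu> (\<Union>\<U>) < rep \<nu> U + \<epsilon>"
    proof (rule ccontr)
      assume neg: "\<not> ?thesis"
      have "\<nu> U \<le> ennreal (rep \<nu> (\<Union>\<U>) - \<epsilon>)" if "U \<in> \<U>" for U
        unfolding eq[OF op[OF that]] using neg that by (intro ennreal_leI) force
      then have "\<nu> (\<Union>\<U>) \<le> ennreal (rep \<nu> (\<Union>\<U>) - \<epsilon>)" unfolding sup by (rule SUP_least)
      then have le: "ennreal (rep \<nu> (\<Union>\<U>)) \<le> ennreal (rep \<nu> (\<Union>\<U>) - \<epsilon>)" using eqU by simp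
      obtain U where "U \<in> \<U>" using d by (auto simp: directed_in_def)
      then have "rep \<nu> U + \<epsilon> \<le> rep \<nu> (\<Union>\<U>)" using neg not_less by blast
      \<comment> \<open>\<open>ennreal\<close> collapses negative reals to 0, so the difference must
        be nonnegative before the inequality can be read in the reals.\<close>
      then have "0 \<le> rep \<nu> (\<Union>\<U>) - \<epsilon>" using rep_nonneg[of \<nu> U] by linarith
      then show False using le d by (subst (asm) ennreal_le_iff) auto
    qed
  qed
qed

lemma val_V1:
  assumes m: "rval m" shows "val m \<in> VX" "openin T U \<Longrightarrow> rep (val m) U = m U"
proof -
  have ev: "val m U = ennreal (m U)" if "openin T U" for U using that by (simp add: val_def)
  show "openin T U \<Longrightarrow> rep (val m) U = m U" using rval_bounds(1)[OF m] by (simp add: rep_def ev)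
  note nn = rval_bounds(1)[OF m]
  have "val m (\<Union>\<U>) = (SUP U\<in>\<U>. val m U)" if d: "directed_in {U. openin T U} (\<subseteq>) \<U>" for \<U>
  proof (rule antisym)
    have op: "openin T U" if "U \<in> \<U>" for U using d that by (auto simp: directed_in_def)
    then have opU: "openin T (\<Union>\<U>)" by blast
    show "val m (\<Union>\<U>) \<le> (SUP U\<in>\<U>. val m U)"
    proof (rule ennreal_le_epsilon)
      fix e :: real assume e: "0 < e"
      then obtain U where U: "U \<in> \<U>" "m (\<Union>\<U>) < m U + e" using rvalD(5)[OF m d] by blast
      have "val m (\<Union>\<U>) \<le> ennreal (m U + e)" unfolding ev[OF opU] using U(2) by (intro ennreal_leI) simp
      also have "\<dots> = val m U + ennreal e" using nn[OF op[OF U(1)]] e by (simp add: ev op U(1))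
      also have "\<dots> \<le> (SUP U\<in>\<U>. val m U) + ennreal e" using U(1) by (intro add_right_mono SUP_upper)
      finally show "val m (\<Union>\<U>) \<le> (SUP U\<in>\<U>. val m U) + ennreal e" .
    qed
    show "(SUP U\<in>\<U>. val m U) \<le> val m (\<Union>\<U>)"
    proof (rule SUP_least)
      fix U assume U: "U \<in> \<U>"
      show "val m U \<le> val m (\<Union>\<U>)"
        unfolding ev[OF opU] ev[OF op[OF U]] using U by (intro ennreal_leI rvalD(4)[OF m op[OF U] opU]) auto
    qed
  qed
  moreover have "val m (U \<union> V) + val m (U \<inter> V) = val m U + val m V" if "openin T U" "openin T V" for U V
    using rvalD(3)[OF m that] that nn by (simp add: ev openin_Un openin_Int flip: ennreal_plus)
  ultimately show "val m \<in> VX"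
    unfolding V1_def continuous_valuation_def
    using rvalD[OF m] openin_X by (auto simp: ev intro!: ennreal_leI) (auto simp: val_def)
qed

lemma rint_cong:
  assumes "\<And>U. openin T U \<Longrightarrow> m U = m' U" "lip \<gamma> f" shows "rint m f = rint m' f"
  unfolding rint_def using assms(1)[OF open_level[OF assms(2)]] by simp

lemma val_integral_rint:
  assumes \<nu>: "\<nu> \<in> VX" and f: "lip 1 f" and h: "\<And>x. x \<in> X \<Longrightarrow> h x = ennreal (f x)"
  shows "val_integral T h \<nu> = ennreal (rint (rep \<nu>) f)"
proof -
  have "\<nu> {x \<in> topspace T. ennreal t < h x} = ennreal (rep \<nu> (level f t))" if "0 \<le> t" for t
  proof -
    have "{x \<in> topspace T. ennreal t < h x} = level f t"
      using h that lipD(2)[OF f] by (auto simp: level_def ennreal_less_iff)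
    then show ?thesis using V1_rep(1)[OF \<nu> open_level[OF f]] by simp
  qed
  then have "val_integral T h \<nu> = (\<integral>\<^sup>+t\<in>{0..}. ennreal (rep \<nu> (level f t)) \<partial>lborel)"
    unfolding val_integral_def by (intro nn_integral_cong) (simp split: split_indicator)
  also have "\<dots> = ennreal (rint (rep \<nu>) f)"
    using lipD(3)[OF f] a_pos by (intro rint_sandwich(4)[OF V1_rep(2)[OF \<nu>] f, of 1 a]) auto
  finally show ?thesis .
qed

lemma dKR_le_iff:
  assumes \<nu>: "\<nu> \<in> VX" and \<nu>': "\<nu>' \<in> VX" and e: "0 \<le> e"
  shows "dKR a X d \<nu> \<nu>' \<le> ennreal e \<longleftrightarrow> (\<forall>f. lip 1 f \<longrightarrow> rint (rep \<nu>) f \<le> rint (rep \<nu>') f + e)"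
proof -
  have *: "dR (val_integral T h \<nu>) (val_integral T h \<nu>') \<le> ennreal e \<longleftrightarrow> rint (rep \<nu>) f \<le> rint (rep \<nu>') f + e"
    if f: "lip 1 f" "\<And>x. x \<in> X \<Longrightarrow> h x = ennreal (f x)" for h f
  proof -
    have 1: "val_integral T h \<nu> = ennreal (rint (rep \<nu>) f)" by (rule val_integral_rint[OF \<nu> f])
    have 2: "val_integral T h \<nu>' = ennreal (rint (rep \<nu>') f)" by (rule val_integral_rint[OF \<nu>' f])
    have "dR (val_integral T h \<nu>) (val_integral T h \<nu>') \<le> ennreal e \<longleftrightarrow>
        ennreal (rint (rep \<nu>) f) \<le> ennreal (rint (rep \<nu>') f + e)"
      unfolding dR_le_iff 1 2 using e by (simp add: rint_nonneg)
    also have "\<dots> \<longleftrightarrow> rint (rep \<nu>) f \<le> rint (rep \<nu>') f + e"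
      using e rint_nonneg[of "rep \<nu>'" f] by (intro ennreal_le_iff) simp
    finally show ?thesis .
  qed
  show ?thesis
    unfolding dKR_def SUP_le_iff
  proof (intro iffI allI impI ballI)
    fix f assume "\<forall>h\<in>L1 a X d. dR (val_integral T h \<nu>) (val_integral T h \<nu>') \<le> ennreal e" and f: "lip 1 f"
    then have "dR (val_integral T (\<lambda>x. ennreal (f x)) \<nu>) (val_integral T (\<lambda>x. ennreal (f x)) \<nu>') \<le> ennreal e"
      using lip_imp_L1[OF f] by blast
    then show "rint (rep \<nu>) f \<le> rint (rep \<nu>') f + e" using *[OF f refl] by blast
  next
    fix h assume all: "\<forall>f. lip 1 f \<longrightarrow> rint (rep \<nu>) f \<le> rint (rep \<nu>') f + e" and h: "h \<in> L1 a X d"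
    show "dR (val_integral T h \<nu>) (val_integral T h \<nu>') \<le> ennreal e"
    proof (rule iffD2[OF *[OF L1_imp_lip(1)[OF h]]])
      show "h x = ennreal (enn2real (h x))" if "x \<in> X" for x by (rule L1_imp_lip(2)[OF h that])
      show "rint (rep \<nu>) (\<lambda>x. enn2real (h x)) \<le> rint (rep \<nu>') (\<lambda>x. enn2real (h x)) + e"
        using all L1_imp_lip(1)[OF h] by blast
    qed
  qed
qed

lemma leV_iff:
  assumes \<nu>: "\<nu> \<in> VX" and \<nu>': "\<nu>' \<in> VX"
  shows "leV (\<nu>, r) (\<nu>', s) \<longleftrightarrow> val_le (rep \<nu>, r) (rep \<nu>', s)"
proof
  assume "leV (\<nu>, r) (\<nu>', s)"
  then have "s \<le> r" "dKR a X d \<nu> \<nu>' \<le> ennreal (r - s)" by (auto simp: ball_le_iff)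
  then show "val_le (rep \<nu>, r) (rep \<nu>', s)"
    using dKR_le_iff[OF \<nu> \<nu>', of "r - s"] unfolding val_le_def fst_conv snd_conv by (simp add: algebra_simps)
next
  assume le: "val_le (rep \<nu>, r) (rep \<nu>', s)"
  \<comment> \<open>The zero test function isolates the radii, since both integrals vanish.\<close>
  have "lip 1 (\<lambda>_. 0)" using a_pos by (intro lip_const) auto
  from val_leD[OF le this] have sr: "s \<le> r" by (simp add: rint_zero V1_rep(2) \<nu> \<nu>')
  then show "leV (\<nu>, r) (\<nu>', s)"
    using dKR_le_iff[OF \<nu> \<nu>', of "r - s"] le unfolding val_le_def fst_conv snd_conv by (simp add: ball_le_iff algebra_simps)
qed

text \<open>Separation rests on \<open>rval_le_of_rint_le\<close> in both directions; membership in
  \<open>extensional\<close> lifts equality on open sets to equality of functions.\<close>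

lemma quasi_metric_KR: "quasi_metric_on VX (dKR a X d)"
  unfolding quasi_metric_on_def
proof (intro conjI ballI impI)
  fix \<nu> assume "\<nu> \<in> VX"
  then show "dKR a X d \<nu> \<nu> = 0" using dKR_le_iff[of \<nu> \<nu> 0] by simp
next
  fix \<nu>1 \<nu>2 \<nu>3
  show "dKR a X d \<nu>1 \<nu>3 \<le> dKR a X d \<nu>1 \<nu>2 + dKR a X d \<nu>2 \<nu>3"
    unfolding dKR_def[of a X d \<nu>1 \<nu>3]
  proof (rule SUP_least)
    fix h assume h: "h \<in> L1 a X d"
    let ?I = "val_integral T h"
    have up: "?I \<mu> \<le> ?I \<mu>' + dKR a X d \<mu> \<mu>'" for \<mu> \<mu>'
      unfolding dR_le_iff[symmetric] dKR_def by (rule SUP_upper[OF h])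
    have "?I \<nu>1 \<le> ?I \<nu>2 + dKR a X d \<nu>1 \<nu>2" by (rule up)
    also have "\<dots> \<le> (?I \<nu>3 + dKR a X d \<nu>2 \<nu>3) + dKR a X d \<nu>1 \<nu>2" by (intro add_right_mono up)
    finally show "dR (?I \<nu>1) (?I \<nu>3) \<le> dKR a X d \<nu>1 \<nu>2 + dKR a X d \<nu>2 \<nu>3" by (simp add: dR_le_iff ac_simps)
  qed
next
  fix \<nu> \<nu>' assume \<nu>: "\<nu> \<in> VX" and \<nu>': "\<nu>' \<in> VX" and 0: "dKR a X d \<nu> \<nu>' = 0 \<and> dKR a X d \<nu>' \<nu> = 0"
  have "rint (rep \<nu>) f \<le> rint (rep \<nu>') f" "rint (rep \<nu>') f \<le> rint (rep \<nu>) f" if "lip 1 f" for f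
    using dKR_le_iff[OF \<nu> \<nu>', of 0] dKR_le_iff[OF \<nu>' \<nu>, of 0] 0 that by auto
  then have "rep \<nu> U = rep \<nu>' U" if "openin T U" for U
    using rval_le_of_rint_le[OF V1_rep(2)[OF \<nu>] V1_rep(2)[OF \<nu>'] _ that]
      rval_le_of_rint_le[OF V1_rep(2)[OF \<nu>'] V1_rep(2)[OF \<nu>] _ that] by (simp add: order_antisym)
  then have "\<nu> U = \<nu>' U" if "openin T U" for U using V1_rep(1)[OF \<nu> that] V1_rep(1)[OF \<nu>' that] that by simp
  moreover have "\<nu> \<in> extensional {U. openin T U}" "\<nu>' \<in> extensional {U. openin T U}"
    using \<nu> \<nu>' by (auto simp: V1_def continuous_valuation_def)
  ultimately show "\<nu> = \<nu>'" by (intro extensionalityI) auto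
qed

end

context alg_qms begin

section \<open>Yoneda-completeness, with suprema computed test function by test function\<close>

lemma rint_val: "rval m \<Longrightarrow> lip \<gamma> f \<Longrightarrow> rint (rep (val m)) f = rint m f"
  by (rule rint_cong[OF val_V1(2)])

lemma directed_KR_limit:
  assumes D: "directed_in BV leV D"
  shows "\<exists>n R. rval n \<and> 0 \<le> R \<and> (\<forall>\<nu> r. (\<nu>, r) \<in> D \<longrightarrow> leV (\<nu>, r) (val n, R)) \<and>
    (\<forall>s. (\<forall>(\<nu>, r)\<in>D. s \<le> r) \<longrightarrow> s \<le> R) \<and>
    (\<forall>h \<epsilon>. lip 1 h \<and> 0 < \<epsilon> \<longrightarrow> (\<exists>(\<nu>, r)\<in>D. rint n h - R < rint (rep \<nu>) h - r + \<epsilon>))"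
proof -
  let ?p = "\<lambda>q. (rep (fst q), snd q)"
  have DV: "fst q \<in> VX" "0 \<le> snd q" if "q \<in> D" for q
    using D that by (auto simp: directed_in_def formal_balls_def)
  have ne: "D \<noteq> {}" using D by (simp add: directed_in_def)
  have le: "val_le (?p q) (?p q') \<longleftrightarrow> leV q q'" if "q \<in> D" "q' \<in> D" for q q'
    using leV_iff[OF DV(1)[OF that(1)] DV(1)[OF that(2)], of "snd q" "snd q'"] by simp
  define R where "R = (INF q\<in>D. snd q)"
  have "\<exists>n. rval n \<and> (\<forall>q\<in>D. val_le (?p q) (n, INF q\<in>D. snd (?p q))) \<and>
    (\<forall>h \<epsilon>. lip 1 h \<and> 0 < \<epsilon> \<longrightarrow> (\<exists>q\<in>D. rint n h - (INF q\<in>D. snd (?p q)) < rint (fst (?p q)) h - snd (?p q) + \<epsilon>))"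
  proof (rule directed_limit[OF ne])
    fix q q' assume q: "q \<in> D" "q' \<in> D"
    then obtain u where "u \<in> D" "leV q u" "leV q' u" using D unfolding directed_in_def by blast
    then show "\<exists>u\<in>D. val_le (?p q) (?p u) \<and> val_le (?p q') (?p u)" using le q by blast
  qed (use DV V1_rep(2) in auto)
  then obtain n where n: "rval n" and ub: "\<And>q. q \<in> D \<Longrightarrow> val_le (?p q) (n, R)"
    and lub: "\<And>h \<epsilon>. lip 1 h \<Longrightarrow> 0 < \<epsilon> \<Longrightarrow> \<exists>q\<in>D. rint n h - R < rint (rep (fst q)) h - snd q + \<epsilon>"
    unfolding R_def snd_conv fst_conv by blast
  have R0: "0 \<le> R" unfolding R_def using ne DV by (intro cINF_greatest) auto
  have 1: "leV (\<nu>, r) (val n, R)" if q: "(\<nu>, r) \<in> D" for \<nu> r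
  proof -
    have "\<nu> \<in> VX" using DV[OF q] by simp
    then show ?thesis using ub[OF q] unfolding leV_iff[OF \<open>\<nu> \<in> VX\<close> val_V1(1)[OF n]]
      by (simp add: val_le_def rint_val[OF n])
  qed
  have 2: "s \<le> R" if "\<forall>(\<nu>, r)\<in>D. s \<le> r" for s
    unfolding R_def using ne that by (intro cINF_greatest) auto
  have 3: "\<exists>(\<nu>, r)\<in>D. rint n h - R < rint (rep \<nu>) h - r + \<epsilon>" if "lip 1 h" "0 < \<epsilon>" for h \<epsilon>
    using lub[OF that] by (auto simp: case_prod_beta)
  show ?thesis using n R0 1 2 3 by blast
qed

lemma yoneda_KR: "yoneda_complete VX (dKR a X d)"
  unfolding yoneda_complete_def dcpo_on_def
proof (intro allI impI)
  fix D assume D: "directed_in BV leV D"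
  obtain n R where n: "rval n" "0 \<le> R" and ub: "\<And>\<nu> r. (\<nu>, r) \<in> D \<Longrightarrow> leV (\<nu>, r) (val n, R)"
    and lub: "\<And>h \<epsilon>. lip 1 h \<Longrightarrow> 0 < \<epsilon> \<Longrightarrow> \<exists>(\<nu>, r)\<in>D. rint n h - R < rint (rep \<nu>) h - r + \<epsilon>"
    using directed_KR_limit[OF D] by metis
  note nV = val_V1(1)[OF n(1)]
  have "supremum_in BV leV D (val n, R)"
    unfolding supremum_in_def
  proof (intro conjI ballI impI)
    show "(val n, R) \<in> BV" using nV n(2) by (simp add: formal_balls_def)
    show "leV q (val n, R)" if "q \<in> D" for q using ub[of "fst q" "snd q"] that by simp
    fix u assume u: "u \<in> BV" "\<forall>q\<in>D. leV q u"
    obtain \<mu> s where us: "u = (\<mu>, s)" by force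
    have \<mu>: "\<mu> \<in> VX" using u(1) us by (simp add: formal_balls_def)
    have "rint n h - R \<le> rint (rep \<mu>) h - s" if h: "lip 1 h" for h
    proof (rule field_le_epsilon)
      fix e :: real assume "0 < e"
      then obtain \<nu> r where q: "(\<nu>, r) \<in> D" "rint n h - R < rint (rep \<nu>) h - r + e" using lub[OF h] by blast
      have \<nu>: "\<nu> \<in> VX" using D q(1) by (auto simp: directed_in_def formal_balls_def)
      have "leV (\<nu>, r) (\<mu>, s)" using u(2) q(1) us by blast
      then have "rint (rep \<nu>) h - r \<le> rint (rep \<mu>) h - s" using leV_iff[OF \<nu> \<mu>] val_leD[OF _ h] by fastforce
      then show "rint n h - R \<le> rint (rep \<mu>) h - s + e" using q(2) by linarith
    qed
    then show "leV (val n, R) u" unfolding us leV_iff[OF nV \<mu>] by (simp add: val_le_def rint_val[OF n(1)])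
  qed
  then show "\<exists>s. supremum_in BV leV D s" ..
qed

text \<open>A supremum lies below the upper bound constructed in \<open>directed_KR_limit\<close>,
  so it inherits the pointwise approximation by members of \<open>D\<close>.\<close>

lemma supremum_KR:
  assumes D: "directed_in BV leV D" and sup: "supremum_in BV leV D (\<nu>, s)" and h: "lip 1 h" and e: "0 < \<epsilon>"
  shows "\<exists>(\<mu>, r)\<in>D. rint (rep \<nu>) h - s < rint (rep \<mu>) h - r + \<epsilon>"
proof -
  obtain n R where n: "rval n" "0 \<le> R" and ub: "\<And>\<nu> r. (\<nu>, r) \<in> D \<Longrightarrow> leV (\<nu>, r) (val n, R)"
    and lub: "\<And>h \<epsilon>. lip 1 h \<Longrightarrow> 0 < \<epsilon> \<Longrightarrow> \<exists>(\<nu>, r)\<in>D. rint n h - R < rint (rep \<nu>) h - r + \<epsilon>"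
    using directed_KR_limit[OF D] by metis
  note nV = val_V1(1)[OF n(1)]
  have \<nu>: "\<nu> \<in> VX" using sup by (simp add: supremum_in_def formal_balls_def)
  have "(val n, R) \<in> BV" using nV n(2) by (simp add: formal_balls_def)
  moreover have "\<forall>q\<in>D. leV q (val n, R)" using ub by auto
  ultimately have "leV (\<nu>, s) (val n, R)" using sup unfolding supremum_in_def by blast
  then have "rint (rep \<nu>) h - s \<le> rint n h - R"
    unfolding leV_iff[OF \<nu> nV] using h by (auto simp: val_le_def rint_val[OF n(1)])
  moreover obtain \<mu> r where "(\<mu>, r) \<in> D" "rint n h - R < rint (rep \<mu>) h - r + \<epsilon>" using lub[OF h e] by blast
  ultimately show ?thesis by (intro bexI[of _ "(\<mu>, r)"]) auto
qed

section \<open>Simple valuations as center points and as a strong basis\<close>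

lemma simple_normalized_eq:
  assumes S: "S \<subseteq> X"
  shows "simple_normalized_valuations T S = {val (smp Z w) |Z w. prob_weights Z w \<and> Z \<subseteq> S}"
proof (intro equalityI subsetI)
  fix \<mu> assume "\<mu> \<in> simple_normalized_valuations T S"
  then obtain n :: nat and \<alpha> :: "nat \<Rightarrow> real" and x where
    \<mu>: "\<mu> = restrict (\<lambda>U. \<Sum>i=1..n. ennreal (\<alpha> i) * dirac (x i) U) {U. openin T U}"
    and \<alpha>: "\<And>i. i \<in> {1..n} \<Longrightarrow> 0 \<le> \<alpha> i \<and> x i \<in> S" "(\<Sum>i=1..n. \<alpha> i) = 1"
    unfolding simple_normalized_valuations_def by blast
  \<comment> \<open>Indices with the same point are merged and their coefficients added.\<close>
  define Z where "Z = x ` {1..n}"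
  define w where "w z = sum \<alpha> {i \<in> {1..n}. x i = z}" for z
  have grp: "(\<Sum>z\<in>Z. w z * g z) = (\<Sum>i=1..n. \<alpha> i * g (x i))" for g
  proof -
    have "(\<Sum>z\<in>Z. w z * g z) = (\<Sum>z\<in>Z. \<Sum>i\<in>{i \<in> {1..n}. x i = z}. \<alpha> i * g (x i))"
      unfolding w_def sum_distrib_right by (intro sum.cong) auto
    also have "\<dots> = (\<Sum>i=1..n. \<alpha> i * g (x i))" by (intro sum.group) (auto simp: Z_def)
    finally show ?thesis .
  qed
  have Z: "finite Z" "Z \<subseteq> S" using \<alpha> by (auto simp: Z_def)
  have "sum w Z = 1" using grp[of "\<lambda>_. 1"] \<alpha>(2) by simp
  moreover have "0 \<le> w z" for z using \<alpha> by (auto simp: w_def intro!: sum_nonneg)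
  ultimately have p: "prob_weights Z w" using Z S by (auto simp: prob_weights_def)
  have "(\<Sum>i=1..n. ennreal (\<alpha> i) * dirac (x i) U) = ennreal (smp Z w U)" for U
  proof -
    have "(\<Sum>i=1..n. ennreal (\<alpha> i) * dirac (x i) U) = (\<Sum>i=1..n. ennreal (\<alpha> i * (if x i \<in> U then 1 else 0)))"
      by (intro sum.cong) (auto simp: dirac_def)
    also have "\<dots> = ennreal (\<Sum>i=1..n. \<alpha> i * (if x i \<in> U then 1 else 0))"
      using \<alpha> by (intro sum_ennreal) auto
    also have "(\<Sum>i=1..n. \<alpha> i * (if x i \<in> U then 1 else 0)) = (\<Sum>z\<in>Z. w z * (if z \<in> U then 1 else 0))"
      using grp[of "\<lambda>z. if z \<in> U then 1 else 0"] by simp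
    also have "\<dots> = smp Z w U"
      unfolding smp_def using Z(1) by (simp add: sum.inter_restrict if_distrib[of "(*) _"] cong: if_cong)
    finally show ?thesis .
  qed
  then have "\<mu> = val (smp Z w)" unfolding \<mu> val_def by simp
  then show "\<mu> \<in> {val (smp Z w) |Z w. prob_weights Z w \<and> Z \<subseteq> S}" using p Z(2) by blast
next
  fix \<mu> assume "\<mu> \<in> {val (smp Z w) |Z w. prob_weights Z w \<and> Z \<subseteq> S}"
  then obtain Z w where \<mu>: "\<mu> = val (smp Z w)" and p: "prob_weights Z w" and ZS: "Z \<subseteq> S" by blast
  note p' = p[unfolded prob_weights_def]
  obtain x where x: "bij_betw x {1..card Z} Z" using ex_bij_betw_nat_finite_1 p' by blast
  have xZ: "x i \<in> Z" if "i \<in> {1..card Z}" for i using bij_betwE[OF x] that by blast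
  have sum: "(\<Sum>i=1..card Z. g (x i)) = sum g Z" for g :: "'a \<Rightarrow> real" by (rule sum.reindex_bij_betw[OF x])
  have "(\<Sum>i=1..card Z. ennreal (w (x i)) * dirac (x i) U) = ennreal (smp Z w U)" for U
  proof -
    have "(\<Sum>i=1..card Z. ennreal (w (x i)) * dirac (x i) U) = (\<Sum>i=1..card Z. ennreal (if x i \<in> U then w (x i) else 0))"
      by (intro sum.cong) (auto simp: dirac_def)
    also have "\<dots> = ennreal (\<Sum>i=1..card Z. if x i \<in> U then w (x i) else 0)"
      using p' xZ by (intro sum_ennreal) auto
    also have "(\<Sum>i=1..card Z. if x i \<in> U then w (x i) else 0) = smp Z w U"
      unfolding smp_def using sum[of "\<lambda>z. if z \<in> U then w z else 0"] p' by (simp add: sum.inter_restrict)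
    finally show ?thesis .
  qed
  then have "\<mu> = restrict (\<lambda>U. \<Sum>i=1..card Z. ennreal (w (x i)) * dirac (x i) U) {U. openin T U}"
    unfolding \<mu> val_def by simp
  moreover have "\<forall>i\<in>{1..card Z}. 0 \<le> w (x i) \<and> x i \<in> S" using xZ p' ZS by blast
  moreover have "(\<Sum>i=1..card Z. w (x i)) = 1" using sum[of w] p' by simp
  ultimately show "\<mu> \<in> simple_normalized_valuations T S"
    unfolding simple_normalized_valuations_def by (intro CollectI exI[of _ "card Z"] exI[of _ "\<lambda>i. w (x i)"] exI[of _ x]) simp
qed

lemma rint_simple:
  assumes p: "prob_weights Z w" and f: "lip \<gamma> f" shows "rint (rep (val (smp Z w))) f = wsum Z w f"
  using rint_val[OF rval_smp[OF p] f] rint_smp[OF p f] by simp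

text \<open>Only the values of a test function at the atoms matter, so the supremum defining the distance
  from a simple valuation is a maximum over finitely many test functions, up to an arbitrarily small error.\<close>

lemma simple_center:
  assumes p: "prob_weights Z w" and Z: "Z \<subseteq> C"
  shows "val (smp Z w) \<in> center_points VX (dKR a X d)"
  unfolding center_points_def ball_topology_def openin_scott_topology center_set_eq
proof (intro CollectI conjI allI impI)
  let ?\<mu> = "val (smp Z w)"
  show \<mu>: "?\<mu> \<in> VX" by (rule val_V1(1)[OF rval_smp[OF p]])
  fix \<epsilon> :: real assume "0 < \<epsilon>"
  let ?W = "{(\<nu>, s). (\<nu>, s) \<in> BV \<and> dKR a X d ?\<mu> \<nu> < ennreal (\<epsilon> - s)}"
  show "scott_open BV leV ?W"
  proof (rule scott_openI)
    fix u v assume "u \<in> ?W" "v \<in> BV" "leV u v"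
    then show "v \<in> ?W" using center_set_up[OF quasi_metric_KR \<mu>, of "fst u" "snd u" "fst v" "snd v" \<epsilon>] by auto
  next
    fix D u assume D: "directed_in BV leV D" and sup: "supremum_in BV leV D u" and u: "u \<in> ?W"
    obtain \<nu> s where us: "u = (\<nu>, s)" by force
    have \<nu>: "\<nu> \<in> VX" and less: "dKR a X d ?\<mu> \<nu> < ennreal (\<epsilon> - s)" using u us by (auto simp: formal_balls_def)
    define \<theta> where "\<theta> = enn2real (dKR a X d ?\<mu> \<nu>)"
    have fin: "dKR a X d ?\<mu> \<nu> = ennreal \<theta>"
      unfolding \<theta>_def using less_trans[OF less ennreal_less_top] by simp
    have \<theta>0: "0 \<le> \<theta>" by (simp add: \<theta>_def)
    then have \<theta>: "0 \<le> \<theta>" "\<theta> < \<epsilon> - s" using less unfolding fin by (simp_all add: ennreal_less_iff)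
    have \<mu>\<nu>: "wsum Z w f \<le> rint (rep \<nu>) f + \<theta>" if "lip 1 f" for f
      using dKR_le_iff[OF \<mu> \<nu> \<theta>(1)] fin rint_simple[OF p that] that by auto
    \<comment> \<open>A third of the slack: one \<open>\<kappa>\<close> for replacing a test by its
      minorant, one for approximating the supremum by a member of \<open>D\<close>, and one left
      over for strictness.\<close>
    define \<kappa> where "\<kappa> = (\<epsilon> - s - \<theta>) / 3"
    have \<kappa>: "0 < \<kappa>" using \<theta> by (simp add: \<kappa>_def)
    have finZ: "finite Z" using p by (simp add: prob_weights_def)
    obtain V where V: "finite V" "\<And>k. k \<in> V \<Longrightarrow> lip 1 k"
      "\<And>h. lip 1 h \<Longrightarrow> \<exists>k\<in>V. (\<forall>x\<in>X. k x \<le> h x) \<and> (\<forall>b\<in>Z. h b \<le> k b + \<kappa>)"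
      using finite_minorants[OF finZ Z \<kappa>] by blast
    \<comment> \<open>Each of the finitely many minorants gets its own member of \<open>D\<close>; a
      common upper bound in \<open>D\<close> then serves all test functions.\<close>
    have "\<forall>k\<in>V. \<exists>q\<in>D. rint (rep \<nu>) k - s < rint (rep (fst q)) k - snd q + \<kappa>"
      using supremum_KR[OF D sup[unfolded us] V(2) \<kappa>] by (force simp: case_prod_beta)
    then obtain q where q: "\<And>k. k \<in> V \<Longrightarrow> q k \<in> D" "\<And>k. k \<in> V \<Longrightarrow> rint (rep \<nu>) k - s < rint (rep (fst (q k))) k - snd (q k) + \<kappa>"
      by metis
    have "\<exists>z\<in>D. \<forall>x\<in>q ` V. leV x z"
      by (rule directed_finite_upper[OF D]) (use V(1) q(1) ball_refl[OF quasi_metric_KR] ball_trans[OF quasi_metric_KR] in \<open>blast+\<close>)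
    then obtain \<nu>' r where z: "(\<nu>', r) \<in> D" "\<And>k. k \<in> V \<Longrightarrow> leV (q k) (\<nu>', r)" by (metis imageI surj_pair)
    have DV: "fst v \<in> VX \<and> 0 \<le> snd v" if "v \<in> D" for v using D that by (auto simp: directed_in_def formal_balls_def)
    have \<nu>': "\<nu>' \<in> VX" "0 \<le> r" using DV[OF z(1)] by auto
    define e where "e = \<theta> + 2 * \<kappa> + s - r"
    have main: "wsum Z w f \<le> rint (rep \<nu>') f + e" if f: "lip 1 f" for f
    proof -
      obtain k where k: "k \<in> V" "\<And>x. x \<in> X \<Longrightarrow> k x \<le> f x" "\<And>b. b \<in> Z \<Longrightarrow> f b \<le> k b + \<kappa>" using V(3)[OF f] by blast
      have "wsum Z w f \<le> wsum Z w k + \<kappa>" by (rule wsum_mono[OF p k(3)])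
      also have "wsum Z w k \<le> rint (rep \<nu>) k + \<theta>" by (rule \<mu>\<nu>[OF V(2)[OF k(1)]])
      also have "rint (rep \<nu>) k \<le> rint (rep (fst (q k))) k - snd (q k) + \<kappa> + s" using q(2)[OF k(1)] by simp
      also have "rint (rep (fst (q k))) k - snd (q k) \<le> rint (rep \<nu>') k - r"
        using z(2)[OF k(1)] leV_iff[of "fst (q k)" \<nu>' "snd (q k)" r] DV[OF q(1)[OF k(1)]] \<nu>' val_leD[OF _ V(2)[OF k(1)]]
        by fastforce
      also have "rint (rep \<nu>') k \<le> rint (rep \<nu>') f"
        by (rule rint_mono[OF V1_rep(2)[OF \<nu>'(1)] V(2)[OF k(1)] f k(2)])
      finally show ?thesis by (simp add: e_def)
    qed
    have l0: "lip 1 (\<lambda>_. 0)" using a_pos by (intro lip_const) auto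
    \<comment> \<open>The zero test function yields the nonnegativity that \<open>dKR_le_iff\<close>
      demands of its real bound.\<close>
    have e0: "0 \<le> e" using main[OF l0] rint_zero[OF V1_rep(2)[OF \<nu>'(1)]] by (simp add: wsum_def)
    have "dKR a X d ?\<mu> \<nu>' \<le> ennreal e"
      unfolding dKR_le_iff[OF \<mu> \<nu>'(1) e0] using main rint_simple[OF p] by simp
    also have "\<dots> < ennreal (\<epsilon> - r)" using e0 \<kappa> by (simp add: ennreal_less_iff e_def \<kappa>_def field_simps)
    finally have "(\<nu>', r) \<in> ?W" using \<nu>' by (simp add: formal_balls_def)
    then show "\<exists>v\<in>D. v \<in> ?W" using z(1) by blast
  qed auto
qed

text \<open>The strict margin \<open>r' < r\<close> makes the family directed: after finitely many
  tests have been matched up to \<open>\<eta>\<close>, the margin pays for all errors and for the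
  radius of the new ball.\<close>

lemma simple_dense:
  assumes \<nu>: "\<nu> \<in> VX"
  defines "D \<equiv> {(val (smp Z w), r) |Z w r. prob_weights Z w \<and> Z \<subseteq> B \<and>
      (\<exists>r'. 0 \<le> r' \<and> r' < r \<and> (\<forall>h. lip 1 h \<longrightarrow> wsum Z w h \<le> rint (rep \<nu>) h + r'))}"
  shows "directed_in BV leV D" "supremum_in BV leV D (\<nu>, 0)"
proof -
  note m = V1_rep(2)[OF \<nu>]
  have le_simple: "leV (val (smp Z w), r) (\<mu>, s) \<longleftrightarrow> (\<forall>h. lip 1 h \<longrightarrow> wsum Z w h - r \<le> rint (rep \<mu>) h - s)"
    if "prob_weights Z w" "\<mu> \<in> VX" for Z w \<mu> r s
    unfolding leV_iff[OF val_V1(1)[OF rval_smp[OF that(1)]] that(2)] val_le_def using rint_simple[OF that(1)] by simp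
  \<comment> \<open>Radius \<open>2 * \<eta>\<close> for an error of \<open>\<eta>\<close> provides
    the strict margin required by \<open>D\<close>.\<close>
  have mem: "\<exists>Z w. prob_weights Z w \<and> (val (smp Z w), 2 * \<eta>) \<in> D \<and> (\<forall>g\<in>G. rint (rep \<nu>) g \<le> wsum Z w g + \<eta>)"
    if G: "finite G" "\<And>g. g \<in> G \<Longrightarrow> lip 1 g" and e: "0 < \<eta>" for G \<eta>
  proof -
    obtain Z w where Z: "prob_weights Z w" "Z \<subseteq> B" "\<And>h. lip 1 h \<Longrightarrow> wsum Z w h \<le> rint (rep \<nu>) h + \<eta>"
      "\<forall>g\<in>G. rint (rep \<nu>) g \<le> wsum Z w g + \<eta>"
      using simple_approximation[OF m G e] by blast
    have "(val (smp Z w), 2 * \<eta>) \<in> D"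
      unfolding D_def using Z e by (intro CollectI exI[of _ Z] exI[of _ w] exI[of _ "2 * \<eta>"] conjI refl exI[of _ \<eta>]) auto
    with Z show ?thesis by blast
  qed
  have DV: "D \<subseteq> BV" unfolding D_def using val_V1(1)[OF rval_smp] by (auto simp: formal_balls_def)
  have step: "\<exists>V \<eta>0. finite V \<and> (\<forall>k\<in>V. lip 1 k) \<and> 0 < \<eta>0 \<and>
      (\<forall>Z w \<eta>. prob_weights Z w \<and> 0 < \<eta> \<and> \<eta> \<le> \<eta>0 \<and> (\<forall>g\<in>V. rint (rep \<nu>) g \<le> wsum Z w g + \<eta>) \<longrightarrow>
        leV p (val (smp Z w), 2 * \<eta>))" if pD: "p \<in> D" for p
  proof -
    obtain Z w r r' where p: "p = (val (smp Z w), r)" "prob_weights Z w" "Z \<subseteq> B" "0 \<le> r'" "r' < r"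
      "\<And>h. lip 1 h \<Longrightarrow> wsum Z w h \<le> rint (rep \<nu>) h + r'"
      using pD unfolding D_def by blast
    \<comment> \<open>A quarter of the margin: replacing a test by its minorant costs
      \<open>\<eta>0\<close>, matching costs \<open>\<eta>\<close>, the new radius
      \<open>2 * \<eta>\<close>, and \<open>\<eta> \<le> \<eta>0\<close>.\<close>
    define \<eta>0 where "\<eta>0 = (r - r') / 4"
    have e0: "0 < \<eta>0" using p(5) by (simp add: \<eta>0_def)
    have "finite Z" "Z \<subseteq> C" using p(2,3) B_C by (auto simp: prob_weights_def)
    from finite_minorants[OF this e0] obtain V where V: "finite V" "\<forall>k\<in>V. lip 1 k"
      "\<And>h. lip 1 h \<Longrightarrow> \<exists>k\<in>V. (\<forall>x\<in>X. k x \<le> h x) \<and> (\<forall>b\<in>Z. h b \<le> k b + \<eta>0)" by blast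
    have "leV p (val (smp Z' w'), 2 * \<eta>)"
      if *: "prob_weights Z' w'" "0 < \<eta>" "\<eta> \<le> \<eta>0" "\<forall>g\<in>V. rint (rep \<nu>) g \<le> wsum Z' w' g + \<eta>" for Z' w' \<eta>
      unfolding p(1) le_simple[OF p(2) val_V1(1)[OF rval_smp[OF *(1)]]]
    proof (intro allI impI)
      fix h assume h: "lip 1 h"
      obtain k where k: "k \<in> V" "\<And>x. x \<in> X \<Longrightarrow> k x \<le> h x" "\<And>b. b \<in> Z \<Longrightarrow> h b \<le> k b + \<eta>0" using V(3)[OF h] by blast
      have kl: "lip 1 k" using V(2) k(1) by blast
      have "wsum Z w h \<le> wsum Z w k + \<eta>0" by (rule wsum_mono[OF p(2) k(3)])
      moreover have "wsum Z w k \<le> rint (rep \<nu>) k + r'" by (rule p(6)[OF kl])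
      moreover have "rint (rep \<nu>) k \<le> wsum Z' w' k + \<eta>" using *(4) k(1) by blast
      moreover have "wsum Z' w' k \<le> wsum Z' w' h + 0"
        using k(2) *(1) by (intro wsum_mono[OF *(1)]) (auto simp: prob_weights_def)
      ultimately have "wsum Z w h - r \<le> wsum Z' w' h - 2 * \<eta>" using *(3) unfolding \<eta>0_def by (simp add: field_simps)
      then show "wsum Z w h - r \<le> rint (rep (val (smp Z' w'))) h - 2 * \<eta>" using rint_simple[OF *(1) h] by simp
    qed
    then show ?thesis using V(1,2) e0 by blast
  qed
  show "directed_in BV leV D"
    unfolding directed_in_def
  proof (intro conjI ballI)
    show "D \<subseteq> BV" by (rule DV)
    show "D \<noteq> {}" using mem[of "{}" 1] by auto
    fix p q assume pq: "p \<in> D" "q \<in> D"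
    obtain V \<eta>1 where V: "finite V" "\<forall>k\<in>V. lip 1 k" "0 < \<eta>1"
      "\<And>Z w \<eta>. prob_weights Z w \<Longrightarrow> 0 < \<eta> \<Longrightarrow> \<eta> \<le> \<eta>1 \<Longrightarrow> \<forall>g\<in>V. rint (rep \<nu>) g \<le> wsum Z w g + \<eta> \<Longrightarrow> leV p (val (smp Z w), 2 * \<eta>)"
      using step[OF pq(1)] by metis
    obtain V' \<eta>2 where V': "finite V'" "\<forall>k\<in>V'. lip 1 k" "0 < \<eta>2"
      "\<And>Z w \<eta>. prob_weights Z w \<Longrightarrow> 0 < \<eta> \<Longrightarrow> \<eta> \<le> \<eta>2 \<Longrightarrow> \<forall>g\<in>V'. rint (rep \<nu>) g \<le> wsum Z w g + \<eta> \<Longrightarrow> leV q (val (smp Z w), 2 * \<eta>)"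
      using step[OF pq(2)] by metis
    define \<eta> where "\<eta> = min \<eta>1 \<eta>2"
    have \<eta>: "0 < \<eta>" "\<eta> \<le> \<eta>1" "\<eta> \<le> \<eta>2" using V(3) V'(3) by (auto simp: \<eta>_def)
    have "finite (V \<union> V')" "\<And>g. g \<in> V \<union> V' \<Longrightarrow> lip 1 g" using V V' by auto
    from mem[OF this \<eta>(1)] obtain Z w where Z: "prob_weights Z w" "(val (smp Z w), 2 * \<eta>) \<in> D"
      "\<forall>g\<in>V \<union> V'. rint (rep \<nu>) g \<le> wsum Z w g + \<eta>" by blast
    have "leV p (val (smp Z w), 2 * \<eta>)" using V(4)[OF Z(1) \<eta>(1,2)] Z(3) by simp
    moreover have "leV q (val (smp Z w), 2 * \<eta>)" using V'(4)[OF Z(1) \<eta>(1,3)] Z(3) by simp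
    ultimately show "\<exists>z\<in>D. leV p z \<and> leV q z" using Z(2) by blast
  qed
  show "supremum_in BV leV D (\<nu>, 0)"
    unfolding supremum_in_def
  proof (intro conjI ballI impI)
    show "(\<nu>, 0) \<in> BV" using \<nu> by (simp add: formal_balls_def)
    fix p assume "p \<in> D"
    then obtain Z w r r' where p: "p = (val (smp Z w), r)" "prob_weights Z w" "r' < r"
      "\<And>h. lip 1 h \<Longrightarrow> wsum Z w h \<le> rint (rep \<nu>) h + r'"
      unfolding D_def by blast
    show "leV p (\<nu>, 0)" unfolding p(1) le_simple[OF p(2) \<nu>] using p(3,4) by fastforce
  next
    fix u assume u: "u \<in> BV" "\<forall>p\<in>D. leV p u"
    obtain \<mu> s where us: "u = (\<mu>, s)" by force
    have \<mu>: "\<mu> \<in> VX" using u(1) us by (simp add: formal_balls_def)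
    have "rint (rep \<nu>) h - 0 \<le> rint (rep \<mu>) h - s" if h: "lip 1 h" for h
    proof (rule field_le_epsilon)
      fix e :: real assume e: "0 < e"
      then have e3: "0 < e / 3" by simp
      obtain Z w where Z: "prob_weights Z w" "(val (smp Z w), 2 * (e / 3)) \<in> D" "rint (rep \<nu>) h \<le> wsum Z w h + e / 3"
        using mem[of "{h}" "e / 3"] h e3 by auto
      have "leV (val (smp Z w), 2 * (e / 3)) (\<mu>, s)" using u(2) Z(2) us by blast
      then have "wsum Z w h - 2 * (e / 3) \<le> rint (rep \<mu>) h - s" using le_simple[OF Z(1) \<mu>] h by blast
      then show "rint (rep \<nu>) h - 0 \<le> rint (rep \<mu>) h - s + e" using Z(3) by simp
    qed
    then show "leV (\<nu>, 0) u" unfolding us leV_iff[OF \<nu> \<mu>] by (simp add: val_le_def)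
  qed
qed

text \<open>The approximating families use atoms from \<open>B\<close> only, so any \<open>S\<close>
  between \<open>B\<close> and \<open>C\<close> works; the theorem takes \<open>S = C\<close> and
  \<open>S = B\<close>.\<close>

lemma simple_strong_basis:
  assumes S: "B \<subseteq> S" "S \<subseteq> C"
  shows "strong_basis VX (dKR a X d) (simple_normalized_valuations T S)"
  unfolding strong_basis_def
proof (intro conjI ballI)
  have SX: "S \<subseteq> X" using S(2) C_X by simp
  show "simple_normalized_valuations T S \<subseteq> center_points VX (dKR a X d)"
    unfolding simple_normalized_eq[OF SX] using simple_center S(2) by blast
  fix \<nu> assume \<nu>: "\<nu> \<in> VX"
  let ?D = "{(val (smp Z w), r) |Z w r. prob_weights Z w \<and> Z \<subseteq> B \<and>
      (\<exists>r'. 0 \<le> r' \<and> r' < r \<and> (\<forall>h. lip 1 h \<longrightarrow> wsum Z w h \<le> rint (rep \<nu>) h + r'))}"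
  have "?D \<subseteq> formal_balls (simple_normalized_valuations T S)"
    unfolding formal_balls_def simple_normalized_eq[OF SX] using S(1) by fastforce
  then show "\<exists>D\<subseteq>formal_balls (simple_normalized_valuations T S). directed_in BV leV D \<and> supremum_in BV leV D (\<nu>, 0)"
    using simple_dense[OF \<nu>] by blast
qed

end

theorem theorem11p21:
  fixes X :: "'a set" and d :: "'a \<Rightarrow> 'a \<Rightarrow> ennreal" and B :: "'a set" and a :: real
  assumes "quasi_metric_on X d"
    and "yoneda_complete X d"
    and "algebraic_qms X d"
    and "strong_basis X d B"
    and "a > 0"
  shows "quasi_metric_on (V1 (d_scott_topology X d)) (dKR a X d) \<and>
         yoneda_complete (V1 (d_scott_topology X d)) (dKR a X d) \<and>
         algebraic_qms (V1 (d_scott_topology X d)) (dKR a X d) \<and>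
         simple_normalized_valuations (d_scott_topology X d) (center_points X d)
           \<subseteq> center_points (V1 (d_scott_topology X d)) (dKR a X d) \<and>
         strong_basis (V1 (d_scott_topology X d)) (dKR a X d)
           (simple_normalized_valuations (d_scott_topology X d) (center_points X d)) \<and>
         strong_basis (V1 (d_scott_topology X d)) (dKR a X d)
           (simple_normalized_valuations (d_scott_topology X d) B)"
proof -
  interpret alg_qms X d B a using assms by unfold_locales
  have C: "strong_basis VX (dKR a X d) (simple_normalized_valuations T C)"
    using B_C by (intro simple_strong_basis) auto
  then have "simple_normalized_valuations T C \<subseteq> center_points VX (dKR a X d)" by (simp add: strong_basis_def)
  moreover have "strong_basis VX (dKR a X d) (simple_normalized_valuations T B)"
    using B_C by (intro simple_strong_basis) auto
  ultimately show ?thesis using quasi_metric_KR yoneda_KR C unfolding algebraic_qms_def by blast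
qed

end
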